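(* Let $(G,P)$ be a weak quasi-lattice ordered group with set of atoms $P_a$. If the collection $$\mathcal{A}_{P_a}=\Big\{\bigsqcup_{j=1}^n p_j\Omega_{K_j}: p_j\in P\text{ and } K_j\subset P_a\text{ finite or empty}\Big\}$$ is an algebra of subsets of $P$, then $\mathcal{A}_{P_a}=\mathcal{B}_P$ and reduction of the positivity condition to generators holds for $P$, that is: for every compactly aligned product system $\{X_p\}_{p\in P}$ of essential $C^*$-correspondences over $P$ with $X_e=A$, every homomorphism $N:P\to(0,\infty)$ and every $\beta\in\mathbb{R}$, a tracial state $\tau$ on $A$ satisfies $$\tau(a)+\sum_{\emptyset\neq K\subset J}(-1)^{|K|}N(\vee K)^{-\beta}\,\mathrm{Tr}_\tau^{\vee K}(a)\ \geq\ 0$$ for all $a\in A_+$ and all finite $J\subset P\setminus\{e\}$ if and only if it satisfies this inequality for all $a\in A_+$ and all finite $J\subset P_a$. Summands with $\vee K=\infty$ are zero.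
   Context: Monoids. A weak quasi-lattice ordered group $(G,P)$ is a discrete group $G$ with a submonoid $P$ such that $P\cap P^{-1}=\{e\}$ and, whenever $p,q\in P$ satisfy $pP\cap qP\ne\emptyset$, there is a (unique) $p\vee q\in P$ with $pP\cap qP=(p\vee q)P$. Write $p\le q$ if $q\in pP$. For finite nonempty $K\subset P$, $\vee K\in P$ is the element with $\bigcap_{k\in K}kP=(\vee K)P$ if this intersection is nonempty, and $\vee K=\infty$ otherwise. An atom is $s\in P\setminus\{e\}$ that is not a product of two elements of $P\setminus\{e\}$; $P_a$ is the set of atoms. Sets. For finite $K\subset P$, $\Omega_K=\bigcap_{k\in K}(P\setminus kP)$, with $\Omega_\emptyset=P$. $\mathcal{A}_{P_a}$ consists of all finite (possibly empty) disjoint unions of sets $p\Omega_K$ with $p\in P$, $K\subset P_a$ finite or empty; in particular $\emptyset\in\mathcal{A}_{P_a}$. An algebra of subsets of $P$ is a nonempty collection closed under complements and finite unions. $\mathcal{B}_P$ is the algebra of subsets of $P$ generated by the sets $pP$, $p\in P$. Product systems. A $C^*$-correspondence over a $C^*$-algebra $A$ is a right Hilbert $A$-module $X$ with a left action $\varphi:A\to\mathcal{L}(X)$; it is essential if $\overline{\varphi(A)X}=X$. A product system over $P$ is a family $(X_p)_{p\in P}$ of $C^*$-correspondences over $A$ with a monoid structure on $\bigcup_pX_p$ such that $\xi\zeta\in X_{pq}$ for $\xi\in X_p,\zeta\in X_q$, the map $\xi\otimes\zeta\mapsto\xi\zeta$ extends to an isometric isomorphism $X_p\otimes_AX_q\simeq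 X_{pq}$ for all $p,q\in P$ with $p\ne e$, $X_e={}_AA_A$, and multiplication by $X_e$ gives the bimodule structure. For $p\le r$ let $\iota_p^r:\mathcal{L}(X_p)\to\mathcal{L}(X_r)$ be $S\mapsto S\otimes I_{p^{-1}r}$ under $X_r\simeq X_p\otimes_AX_{p^{-1}r}$. $X$ is compactly aligned if $\iota^r_p(\mathcal{K}(X_p))\iota^r_q(\mathcal{K}(X_q))\subset\mathcal{K}(X_r)$ whenever $pP\cap qP=rP$. Induced traces. For a finite positive trace $\tau$ on $A$ and a $C^*$-correspondence $Y$, $\mathrm{Tr}^Y_\tau(T)=\sup_H\sum_{\xi\in H}\tau(\langle\xi,T\xi\rangle)$ for $T\in\mathcal{L}(Y)_+$, the supremum over finite $H\subset Y$ with $\sum_{\xi\in H}\theta_{\xi,\xi}\le1$, where $\theta_{\xi,\zeta}\eta=\xi\langle\zeta,\eta\rangle$. $\mathrm{Tr}^p_\tau(a)$ means $\mathrm{Tr}^{X_p}_\tau(\varphi_p(a))$ for $a\in A_+$, a possibly infinite trace on $A$; the inequality for $J=\{q\}$ forces $\mathrm{Tr}^q_\tau(a)<\infty$. *)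

theory Defs
  imports
    "HOL-Analysis.Sigma_Algebra"
    "HOL-Analysis.Operator_Norm"
    "HOL-Library.Extended_Nonnegative_Real"
    "HOL-Algebra.Coset"
begin

section \<open>Complex vector spaces, C*-algebras and tracial states\<close>

class complex_vector = ab_group_add +
  fixes scaleC :: "complex \<Rightarrow> 'a \<Rightarrow> 'a" (infixr "*\<^sub>C" 75)
  assumes scaleC_add_right: "c *\<^sub>C (x + y) = c *\<^sub>C x + c *\<^sub>C y"
    and scaleC_add_left: "(c + d) *\<^sub>C x = c *\<^sub>C x + d *\<^sub>C x"
    and scaleC_scaleC: "c *\<^sub>C (d *\<^sub>C x) = (c * d) *\<^sub>C x"
    and scaleC_one: "1 *\<^sub>C x = x"

text \<open>C*-algebras are not assumed to be unital.\<close>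

class cstar_algebra = real_normed_algebra + complete_space + complex_vector +
  fixes star :: "'a \<Rightarrow> 'a"
  assumes scaleR_scaleC: "r *\<^sub>R x = complex_of_real r *\<^sub>C x"
    and scaleC_mult_left: "(c *\<^sub>C x) * y = c *\<^sub>C (x * y)"
    and scaleC_mult_right: "x * (c *\<^sub>C y) = c *\<^sub>C (x * y)"
    and norm_scaleC: "norm (c *\<^sub>C x) = cmod c * norm x"
    and star_add: "star (x + y) = star x + star y"
    and star_scaleC: "star (c *\<^sub>C x) = cnj c *\<^sub>C star x"
    and star_mult: "star (x * y) = star y * star x"
    and star_star: "star (star x) = x"
    and cstar_identity: "norm (star x * x) = (norm x)\<^sup>2"

definition positive_elements :: "'a::cstar_algebra set" where
  "positive_elements = {a. \<exists>b. a = star b * b}"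

definition tracial_state :: "('a::cstar_algebra \<Rightarrow> complex) \<Rightarrow> bool" where
  "tracial_state \<tau> \<longleftrightarrow>
     bounded_linear \<tau> \<and>
     (\<forall>c a. \<tau> (c *\<^sub>C a) = c * \<tau> a) \<and>
     (\<forall>a\<in>positive_elements. \<tau> a \<in> \<real> \<and> 0 \<le> Re (\<tau> a)) \<and>
     onorm \<tau> = 1 \<and>
     (\<forall>a b. \<tau> (a * b) = \<tau> (b * a))"

section \<open>C*-correspondences\<close>

text \<open>
  A correspondence is carried by a complex subspace \<open>car\<close> of a type \<open>'x\<close>, so that finite sums are
  those of \<open>'x\<close>. In a family of correspondences the fibres are subspaces of one type. This loses no
  generality, as every family of vector spaces embeds in its direct sum; nothing relates distinct
  fibres inside \<open>'x\<close>, and all the other operations are given fibrewise. Operators on a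
  correspondence are functions on \<open>'x\<close> whose values outside \<open>car\<close> are irrelevant.
\<close>

record ('x, 'a) corr =
  car :: "'x set"
  ract :: "'x \<Rightarrow> 'a \<Rightarrow> 'x"
  inn :: "'x \<Rightarrow> 'x \<Rightarrow> 'a"
  lact :: "'a \<Rightarrow> 'x \<Rightarrow> 'x"

definition hnorm :: "('x::complex_vector, 'a::cstar_algebra) corr \<Rightarrow> 'x \<Rightarrow> real" where
  "hnorm Y \<xi> = sqrt (norm (inn Y \<xi> \<xi>))"

definition hilbert_module :: "('x::complex_vector, 'a::cstar_algebra) corr \<Rightarrow> bool" where
  "hilbert_module Y \<longleftrightarrow>
     0 \<in> car Y \<and>
     (\<forall>\<xi>\<in>car Y. \<forall>\<eta>\<in>car Y. \<xi> + \<eta> \<in> car Y) \<and>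
     (\<forall>c. \<forall>\<xi>\<in>car Y. c *\<^sub>C \<xi> \<in> car Y) \<and>
     (\<forall>\<xi>\<in>car Y. \<forall>a. ract Y \<xi> a \<in> car Y) \<and>
     (\<forall>\<xi>\<in>car Y. \<forall>\<eta>\<in>car Y. \<forall>a. ract Y (\<xi> + \<eta>) a = ract Y \<xi> a + ract Y \<eta> a) \<and>
     (\<forall>\<xi>\<in>car Y. \<forall>a b. ract Y \<xi> (a + b) = ract Y \<xi> a + ract Y \<xi> b) \<and>
     (\<forall>\<xi>\<in>car Y. \<forall>a b. ract Y \<xi> (a * b) = ract Y (ract Y \<xi> a) b) \<and>
     (\<forall>\<xi>\<in>car Y. \<forall>a c. ract Y (c *\<^sub>C \<xi>) a = c *\<^sub>C ract Y \<xi> a) \<and>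
     (\<forall>\<xi>\<in>car Y. \<forall>a c. ract Y \<xi> (c *\<^sub>C a) = c *\<^sub>C ract Y \<xi> a) \<and>
     (\<forall>\<xi>\<in>car Y. \<forall>\<eta>\<in>car Y. \<forall>\<zeta>\<in>car Y. inn Y \<xi> (\<eta> + \<zeta>) = inn Y \<xi> \<eta> + inn Y \<xi> \<zeta>) \<and>
     (\<forall>\<xi>\<in>car Y. \<forall>\<eta>\<in>car Y. \<forall>c. inn Y \<xi> (c *\<^sub>C \<eta>) = c *\<^sub>C inn Y \<xi> \<eta>) \<and>
     (\<forall>\<xi>\<in>car Y. \<forall>\<eta>\<in>car Y. \<forall>a. inn Y \<xi> (ract Y \<eta> a) = inn Y \<xi> \<eta> * a) \<and>
     (\<forall>\<xi>\<in>car Y. \<forall>\<eta>\<in>car Y. inn Y \<eta> \<xi> = star (inn Y \<xi> \<eta>)) \<and>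
     (\<forall>\<xi>\<in>car Y. inn Y \<xi> \<xi> \<in> positive_elements) \<and>
     (\<forall>\<xi>\<in>car Y. inn Y \<xi> \<xi> = 0 \<longrightarrow> \<xi> = 0) \<and>
     (\<forall>s. (\<forall>n::nat. s n \<in> car Y) \<and>
          (\<forall>\<epsilon>>0. \<exists>M. \<forall>m\<ge>M. \<forall>n\<ge>M. hnorm Y (s m - s n) < \<epsilon>) \<longrightarrow>
          (\<exists>l\<in>car Y. (\<lambda>n. hnorm Y (s n - l)) \<longlonglongrightarrow> 0))"

definition adjoint_pair ::
  "('x::complex_vector, 'a::cstar_algebra) corr \<Rightarrow> ('x \<Rightarrow> 'x) \<Rightarrow> ('x \<Rightarrow> 'x) \<Rightarrow> bool" where
  "adjoint_pair Y S S' \<longleftrightarrow>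
     S \<in> car Y \<rightarrow> car Y \<and> S' \<in> car Y \<rightarrow> car Y \<and>
     (\<forall>\<xi>\<in>car Y. \<forall>\<eta>\<in>car Y. inn Y (S \<xi>) \<eta> = inn Y \<xi> (S' \<eta>))"

definition adjointables :: "('x::complex_vector, 'a::cstar_algebra) corr \<Rightarrow> ('x \<Rightarrow> 'x) set" where
  "adjointables Y = {S. \<exists>S'. adjoint_pair Y S S'}"

definition positive_operators ::
  "('x::complex_vector, 'a::cstar_algebra) corr \<Rightarrow> ('x \<Rightarrow> 'x) set" where
  "positive_operators Y =
     {T \<in> adjointables Y. \<exists>S S'. adjoint_pair Y S S' \<and> (\<forall>\<xi>\<in>car Y. T \<xi> = S' (S \<xi>))}"

definition theta :: "('x::complex_vector, 'a::cstar_algebra) corr \<Rightarrow> 'x \<Rightarrow> 'x \<Rightarrow> 'x \<Rightarrow> 'x" where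
  "theta Y \<xi> \<zeta> \<eta> = ract Y \<xi> (inn Y \<zeta> \<eta>)"

text \<open>
  The closed linear span of the operators \<open>theta Y \<xi> \<zeta>\<close> in the operator norm; scalars can be absorbed
  in \<open>\<xi>\<close>.
\<close>

definition compacts :: "('x::complex_vector, 'a::cstar_algebra) corr \<Rightarrow> ('x \<Rightarrow> 'x) set" where
  "compacts Y =
     {T \<in> adjointables Y. \<forall>\<epsilon>>0. \<exists>ps. set ps \<subseteq> car Y \<times> car Y \<and>
        (\<forall>\<eta>\<in>car Y. hnorm Y (T \<eta> - (\<Sum>(\<xi>, \<zeta>)\<leftarrow>ps. theta Y \<xi> \<zeta> \<eta>)) \<le> \<epsilon> * hnorm Y \<eta>)}"

definition correspondence :: "('x::complex_vector, 'a::cstar_algebra) corr \<Rightarrow> bool" where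
  "correspondence Y \<longleftrightarrow>
     hilbert_module Y \<and>
     (\<forall>a. adjoint_pair Y (lact Y a) (lact Y (star a))) \<and>
     (\<forall>\<xi>\<in>car Y. \<forall>a b. lact Y (a + b) \<xi> = lact Y a \<xi> + lact Y b \<xi>) \<and>
     (\<forall>\<xi>\<in>car Y. \<forall>c a. lact Y (c *\<^sub>C a) \<xi> = c *\<^sub>C lact Y a \<xi>) \<and>
     (\<forall>\<xi>\<in>car Y. \<forall>a b. lact Y (a * b) \<xi> = lact Y a (lact Y b \<xi>))"

definition essential :: "('x::complex_vector, 'a::cstar_algebra) corr \<Rightarrow> bool" where
  "essential Y \<longleftrightarrow>
     (\<forall>\<eta>\<in>car Y. \<forall>\<epsilon>>0. \<exists>ps. set ps \<subseteq> UNIV \<times> car Y \<and>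
        hnorm Y (\<eta> - (\<Sum>(a, \<xi>)\<leftarrow>ps. lact Y a \<xi>)) < \<epsilon>)"

text \<open>\<open>induced_trace Y \<tau> T\<close> is meant for positive operators \<open>T\<close>, where all the summands are nonnegative.\<close>

definition induced_trace ::
  "('x::complex_vector, 'a::cstar_algebra) corr \<Rightarrow> ('a \<Rightarrow> complex) \<Rightarrow> ('x \<Rightarrow> 'x) \<Rightarrow> ennreal" where
  "induced_trace Y \<tau> T =
     (SUP H\<in>{H. finite H \<and> H \<subseteq> car Y \<and>
                (\<lambda>\<eta>. \<eta> - (\<Sum>\<xi>\<in>H. theta Y \<xi> \<xi> \<eta>)) \<in> positive_operators Y}.
        \<Sum>\<xi>\<in>H. ennreal (Re (\<tau> (inn Y \<xi> (T \<xi>)))))"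

text \<open>
  A list of pairs \<open>(\<xi>, \<zeta>)\<close> stands for the element \<open>\<Sum> \<xi> \<otimes> \<zeta>\<close> of the algebraic tensor product, and
  \<open>tensor_inner\<close> is the usual semi-inner product, whose separated completion is the interior tensor
  product of \<open>Y\<close> and \<open>Z\<close>. Hence \<open>\<xi> \<otimes> \<zeta> \<mapsto> m \<xi> \<zeta>\<close> extends to an isometric isomorphism onto \<open>W\<close> iff the
  map induced on formal sums preserves inner products and has dense range; it is then automatically
  well defined, since a formal sum representing zero has length zero.
\<close>

definition tensor_inner ::
  "('x::complex_vector, 'a::cstar_algebra) corr \<Rightarrow> ('x, 'a) corr \<Rightarrow> ('x \<times> 'x) list \<Rightarrow> ('x \<times> 'x) list \<Rightarrow> 'a"
  where
  "tensor_inner Y Z ts us =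
     (\<Sum>(\<xi>, \<zeta>)\<leftarrow>ts. \<Sum>(\<xi>', \<zeta>')\<leftarrow>us. inn Z \<zeta> (lact Z (inn Y \<xi> \<xi>') \<zeta>'))"

definition tensor_eval :: "('x \<Rightarrow> 'x \<Rightarrow> 'x::complex_vector) \<Rightarrow> ('x \<times> 'x) list \<Rightarrow> 'x" where
  "tensor_eval m ts = (\<Sum>(\<xi>, \<zeta>)\<leftarrow>ts. m \<xi> \<zeta>)"

definition extends_to_tensor_iso ::
  "('x::complex_vector, 'a::cstar_algebra) corr \<Rightarrow> ('x, 'a) corr \<Rightarrow> ('x, 'a) corr \<Rightarrow>
   ('x \<Rightarrow> 'x \<Rightarrow> 'x) \<Rightarrow> bool" where
  "extends_to_tensor_iso Y Z W m \<longleftrightarrow>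
     (\<forall>ts us. set ts \<subseteq> car Y \<times> car Z \<and> set us \<subseteq> car Y \<times> car Z \<longrightarrow>
        inn W (tensor_eval m ts) (tensor_eval m us) = tensor_inner Y Z ts us) \<and>
     (\<forall>\<eta>\<in>car W. \<forall>\<epsilon>>0. \<exists>ts. set ts \<subseteq> car Y \<times> car Z \<and> hnorm W (\<eta> - tensor_eval m ts) < \<epsilon>)"

section \<open>Weak quasi-lattice ordered groups\<close>

definition weak_quasi_lattice_ordered :: "('g, 'z) monoid_scheme \<Rightarrow> 'g set \<Rightarrow> bool" where
  "weak_quasi_lattice_ordered G P \<longleftrightarrow>
     group G \<and> submonoid P G \<and>
     P \<inter> (\<lambda>p. inv\<^bsub>G\<^esub> p) ` P = {\<one>\<^bsub>G\<^esub>} \<and>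
     (\<forall>p\<in>P. \<forall>q\<in>P. (p <#\<^bsub>G\<^esub> P) \<inter> (q <#\<^bsub>G\<^esub> P) \<noteq> {} \<longrightarrow>
        (\<exists>!r. r \<in> P \<and> (p <#\<^bsub>G\<^esub> P) \<inter> (q <#\<^bsub>G\<^esub> P) = r <#\<^bsub>G\<^esub> P))"

text \<open>\<open>join G P K\<close> is \<open>\<Or>K\<close> for finite nonempty \<open>K \<subseteq> P\<close>, with \<open>None\<close> in place of \<open>\<infinity>\<close>.\<close>

definition join :: "('g, 'z) monoid_scheme \<Rightarrow> 'g set \<Rightarrow> 'g set \<Rightarrow> 'g option" where
  "join G P K =
     (if (\<Inter>k\<in>K. k <#\<^bsub>G\<^esub> P) = {} then None
      else Some (THE r. r \<in> P \<and> (\<Inter>k\<in>K. k <#\<^bsub>G\<^esub> P) = r <#\<^bsub>G\<^esub> P))"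

definition atoms :: "('g, 'z) monoid_scheme \<Rightarrow> 'g set \<Rightarrow> 'g set" where
  "atoms G P =
     {s \<in> P - {\<one>\<^bsub>G\<^esub>}. \<not> (\<exists>p\<in>P - {\<one>\<^bsub>G\<^esub>}. \<exists>q\<in>P - {\<one>\<^bsub>G\<^esub>}. s = p \<otimes>\<^bsub>G\<^esub> q)}"

definition Omega :: "('g, 'z) monoid_scheme \<Rightarrow> 'g set \<Rightarrow> 'g set \<Rightarrow> 'g set" where
  "Omega G P K = {x \<in> P. \<forall>k\<in>K. x \<in> P - (k <#\<^bsub>G\<^esub> P)}"

definition atom_collection :: "('g, 'z) monoid_scheme \<Rightarrow> 'g set \<Rightarrow> 'g set set" where
  "atom_collection G P =
     {E. \<exists>(n::nat) p K.
        (\<forall>j<n. p j \<in> P \<and> finite (K j) \<and> K j \<subseteq> atoms G P) \<and>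
        disjoint_family_on (\<lambda>j. p j <#\<^bsub>G\<^esub> Omega G P (K j)) {..<n} \<and>
        E = (\<Union>j<n. p j <#\<^bsub>G\<^esub> Omega G P (K j))}"

definition ideal_algebra :: "('g, 'z) monoid_scheme \<Rightarrow> 'g set \<Rightarrow> 'g set set" where
  "ideal_algebra G P =
     \<Inter>{M. Sigma_Algebra.algebra P M \<and> (\<lambda>p. p <#\<^bsub>G\<^esub> P) ` P \<subseteq> M}"

section \<open>Product systems\<close>

text \<open>
  \<open>pmul S p q\<close> is the product on \<open>fib S p \<times> fib S q\<close>, so that the disjoint union of the fibres carries
  an associative multiplication. For essential fibres it has a unit precisely when the coefficient
  algebra is unital, hence no unit is demanded. The map \<open>emb S\<close> identifies the coefficient algebra with the fibre at the
  identity.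
\<close>

record ('g, 'x, 'a) psystem =
  fib :: "'g \<Rightarrow> ('x, 'a) corr"
  pmul :: "'g \<Rightarrow> 'g \<Rightarrow> 'x \<Rightarrow> 'x \<Rightarrow> 'x"
  emb :: "'a \<Rightarrow> 'x"

definition coefficient_fibre ::
  "('x::complex_vector, 'a::cstar_algebra) corr \<Rightarrow> ('a \<Rightarrow> 'x) \<Rightarrow> bool" where
  "coefficient_fibre Y i \<longleftrightarrow>
     bij_betw i UNIV (car Y) \<and>
     (\<forall>a b. i (a + b) = i a + i b) \<and>
     (\<forall>c a. i (c *\<^sub>C a) = c *\<^sub>C i a) \<and>
     (\<forall>a b. ract Y (i a) b = i (a * b)) \<and>
     (\<forall>a b. lact Y a (i b) = i (a * b)) \<and>
     (\<forall>a b. inn Y (i a) (i b) = star a * b)"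

definition product_system ::
  "('g, 'z) monoid_scheme \<Rightarrow> 'g set \<Rightarrow> ('g, 'x::complex_vector, 'a::cstar_algebra) psystem \<Rightarrow> bool"
  where
  "product_system G P S \<longleftrightarrow>
     (\<forall>p\<in>P. correspondence (fib S p)) \<and>
     (\<forall>p\<in>P. \<forall>q\<in>P. \<forall>\<xi>\<in>car (fib S p). \<forall>\<zeta>\<in>car (fib S q).
        pmul S p q \<xi> \<zeta> \<in> car (fib S (p \<otimes>\<^bsub>G\<^esub> q))) \<and>
     (\<forall>p\<in>P. \<forall>q\<in>P. \<forall>r\<in>P.
        \<forall>\<xi>\<in>car (fib S p). \<forall>\<zeta>\<in>car (fib S q). \<forall>\<eta>\<in>car (fib S r).
        pmul S (p \<otimes>\<^bsub>G\<^esub> q) r (pmul S p q \<xi> \<zeta>) \<eta> = pmul S p (q \<otimes>\<^bsub>G\<^esub> r) \<xi> (pmul S q r \<zeta> \<eta>)) \<and>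
     (\<forall>p\<in>P - {\<one>\<^bsub>G\<^esub>}. \<forall>q\<in>P.
        extends_to_tensor_iso (fib S p) (fib S q) (fib S (p \<otimes>\<^bsub>G\<^esub> q)) (pmul S p q)) \<and>
     coefficient_fibre (fib S \<one>\<^bsub>G\<^esub>) (emb S) \<and>
     (\<forall>p\<in>P. \<forall>\<xi>\<in>car (fib S p). \<forall>a.
        pmul S \<one>\<^bsub>G\<^esub> p (emb S a) \<xi> = lact (fib S p) a \<xi> \<and>
        pmul S p \<one>\<^bsub>G\<^esub> \<xi> (emb S a) = ract (fib S p) \<xi> a)"

text \<open>
  For \<open>r \<in> pP\<close>, the operator \<open>T \<otimes> I\<close> on the fibre at \<open>r\<close>. It is determined there by its values on
  products, whose span is dense (for \<open>p\<close> the identity because the fibres are essential).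
\<close>

definition iota ::
  "('g, 'z) monoid_scheme \<Rightarrow> ('g, 'x::complex_vector, 'a::cstar_algebra) psystem \<Rightarrow>
   'g \<Rightarrow> 'g \<Rightarrow> ('x \<Rightarrow> 'x) \<Rightarrow> 'x \<Rightarrow> 'x" where
  "iota G S p r T =
     (SOME R. R \<in> adjointables (fib S r) \<and>
        (let q = inv\<^bsub>G\<^esub> p \<otimes>\<^bsub>G\<^esub> r in
         \<forall>\<xi>\<in>car (fib S p). \<forall>\<zeta>\<in>car (fib S q). R (pmul S p q \<xi> \<zeta>) = pmul S p q (T \<xi>) \<zeta>))"

definition compactly_aligned ::
  "('g, 'z) monoid_scheme \<Rightarrow> 'g set \<Rightarrow> ('g, 'x::complex_vector, 'a::cstar_algebra) psystem \<Rightarrow> bool"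
  where
  "compactly_aligned G P S \<longleftrightarrow>
     (\<forall>p\<in>P. \<forall>q\<in>P. \<forall>r\<in>P. (p <#\<^bsub>G\<^esub> P) \<inter> (q <#\<^bsub>G\<^esub> P) = r <#\<^bsub>G\<^esub> P \<longrightarrow>
        (\<forall>T\<in>compacts (fib S p). \<forall>U\<in>compacts (fib S q).
           iota G S p r T \<circ> iota G S q r U \<in> compacts (fib S r)))"

section \<open>The positivity condition\<close>

definition fibre_trace ::
  "('g, 'x::complex_vector, 'a::cstar_algebra) psystem \<Rightarrow> ('a \<Rightarrow> complex) \<Rightarrow> 'g \<Rightarrow> 'a \<Rightarrow> ennreal" where
  "fibre_trace S \<tau> p a = induced_trace (fib S p) \<tau> (lact (fib S p) a)"

text \<open>
  The alternating sum is meaningful only if no infinite terms of opposite sign occur, so the inequality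
  is understood to include that all the traces in it are finite. For \<open>J = {q}\<close> this agrees with the
  reading in extended reals, where the inequality forces the trace at \<open>q\<close> to be finite. The value
  \<open>\<tau> a\<close> is real for positive \<open>a\<close>.
\<close>

definition positivity_inequality ::
  "('g, 'z) monoid_scheme \<Rightarrow> 'g set \<Rightarrow> ('g, 'x::complex_vector, 'a::cstar_algebra) psystem \<Rightarrow>
   ('g \<Rightarrow> real) \<Rightarrow> real \<Rightarrow> ('a \<Rightarrow> complex) \<Rightarrow> 'g set \<Rightarrow> 'a \<Rightarrow> bool" where
  "positivity_inequality G P S N \<beta> \<tau> J a \<longleftrightarrow>
     (\<forall>K r. K \<noteq> {} \<and> K \<subseteq> J \<and> join G P K = Some r \<longrightarrow> fibre_trace S \<tau> r a < \<infinity>) \<and>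
     Re (\<tau> a) +
       (\<Sum>K\<in>{K. K \<noteq> {} \<and> K \<subseteq> J}.
          case join G P K of
            None \<Rightarrow> 0
          | Some r \<Rightarrow> (- 1) ^ card K * N r powr (- \<beta>) * enn2real (fibre_trace S \<tau> r a)) \<ge> 0"

end

theory Submission
  imports Defs "HOL-Analysis.Elementary_Metric_Spaces"
begin

text \<open>
  Fix a positive \<open>a\<close> and give the ideal \<open>pP\<close> the weight \<open>N(p)\<^sup>-\<^sup>\<beta> Tr\<^sub>\<tau>\<^sup>p(a)\<close>. By inclusion-exclusion
  the positivity inequality for \<open>J\<close> says that the linear extension of this weight is nonnegative on
  the indicator function of \<open>\<Omega>\<^sub>J\<close>. The indicator functions of the sets \<open>pP\<close> are linearly
  independent (\<open>indicators_independent\<close>), so a partition of \<open>\<Omega>\<^sub>J\<close> into sets \<open>p\<^sub>j\<Omega>\<^sub>K\<close> with \<open>K\<close> a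
  finite set of atoms yields an identity between weights, and it remains to see that each
  \<open>p\<Omega>\<^sub>K\<close> has nonnegative weight. Up to the factor \<open>N(p)\<^sup>-\<^sup>\<beta>\<close> this weight is the value at \<open>a\<close> of the trace
  which \<open>X\<^sub>p\<close> induces from the trace \<open>\<Sum>\<^sub>L (-1)\<^sup>|\<^sup>L\<^sup>| N(\<Or>L)\<^sup>-\<^sup>\<beta> Tr\<^sub>\<tau>\<^sup>\<Or>\<^sup>L\<close>, with \<open>L\<close> running over the subsets of \<open>K\<close>;
  the latter is positive by the inequality for \<open>K\<close>.

  Two points need work. The first is that inducing in two steps gives the
  same trace as inducing along the product, simultaneously for finitely many fibres, so that
  inequalities between linear combinations survive (\<open>combination_nonneg\<close>). The trace on a product
  fibre is compared with the values on one common family \<open>L\<close> of vectors with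
  \<open>\<Sum> \<theta>\<^sub>\<xi>\<^sub>,\<^sub>\<xi> \<le> 1\<close>: such families approximate the identity on finitely many vectors
  (\<open>dominated_approximates\<close>), the trace property turns an estimate for \<open>a = b\<^sup>*b\<close> on any such
  family into one for \<open>bb\<^sup>*\<close> on an approximating family (\<open>trace_comparison\<close>), and products of
  approximating families approximate in the tensor product (\<open>product_trace_lower\<close>,
  \<open>product_trace_upper\<close>). Everything is measured in the seminorms given by positive functionals,
  and the operators needed are built from fixed points of contractions in the C*-algebra.

  The second point is that all the traces \<open>Tr\<^sub>\<tau>\<^sup>q\<close> are finite, although the hypothesis on atoms
  speaks only of joins of atoms. Here \<open>P \<setminus> qP\<close> is partitioned into sets \<open>p\<^sub>j\<Omega>\<^sub>K\<close> and coefficients of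
  indicator functions are compared. Those of an ideal other than \<open>P\<close> add up to \<open>0\<close> or \<open>-1\<close>, so an
  ideal that occurs at all occurs with a negative coefficient in some piece. A negative coefficient
  bounds the trace by traces at strictly smaller elements, and an induction along the order concludes
  (\<open>propagation\<close>, \<open>combination_finite\<close>).
\<close>

section \<open>Fixed points and approximate units in C*-algebras\<close>

lemma scaleC_zero_left [simp]: "0 *\<^sub>C (x::'x::complex_vector) = 0"
  using scaleC_add_left[of 0 0 x] by simp

lemma scaleC_zero_right [simp]: "c *\<^sub>C (0::'x::complex_vector) = 0"
  using scaleC_add_right[of c 0 "0::'x"] by simp

lemma scaleC_minus_left: "(- c) *\<^sub>C (x::'x::complex_vector) = - (c *\<^sub>C x)"
  using scaleC_add_left[of c "-c" x] by (simp add: eq_neg_iff_add_eq_0 add.commute)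

lemma scaleC_minus_right: "c *\<^sub>C (- x::'x::complex_vector) = - (c *\<^sub>C x)"
  using scaleC_add_right[of c x "-x"] by (simp add: eq_neg_iff_add_eq_0 add.commute)

lemma minus_eq_scaleC: "- (x::'x::complex_vector) = (- 1) *\<^sub>C x"
  by (simp add: scaleC_minus_left scaleC_one)

lemma scaleC_diff_right: "c *\<^sub>C (x - y::'x::complex_vector) = c *\<^sub>C x - c *\<^sub>C y"
  by (simp only: diff_conv_add_uminus scaleC_add_right scaleC_minus_right)

lemma star_zero [simp]: "star (0::'a::cstar_algebra) = 0"
  using star_add[of 0 "0::'a"] by simp

lemma star_minus: "star (- a) = - star (a::'a::cstar_algebra)"
  using star_add[of a "-a"] by (simp add: eq_neg_iff_add_eq_0 add.commute)

lemma star_diff: "star (a - b) = star a - star (b::'a::cstar_algebra)"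
  by (simp only: diff_conv_add_uminus star_add star_minus)

lemma star_scaleR: "star (r *\<^sub>R a) = r *\<^sub>R star (a::'a::cstar_algebra)"
  by (simp add: scaleR_scaleC star_scaleC)

lemma norm_star [simp]: "norm (star a) = norm (a::'a::cstar_algebra)"
proof -
  have le: "norm b \<le> norm (star b)" for b :: 'a
  proof (cases "b = 0")
    case False
    have "norm b * norm b = norm (star b * b)"
      by (simp add: cstar_identity power2_eq_square)
    also have "\<dots> \<le> norm (star b) * norm b" by (rule norm_mult_ineq)
    finally show ?thesis using False by simp
  qed simp
  show ?thesis using le[of a] le[of "star a"] by (simp add: star_star)
qed

lemma norm_mult_star: "norm (a * star a) = (norm (a::'a::cstar_algebra))\<^sup>2"
  using cstar_identity[of "star a"] by (simp add: star_star)

lemma norm_scaleC_of_real: "norm (complex_of_real r *\<^sub>C (a::'a::cstar_algebra)) = \<bar>r\<bar> * norm a"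
  by (simp add: norm_scaleC)

text \<open>
  Roots of elements close to the unit of the unitization are found as fixed points. Uniqueness in the
  ball makes the fixed point of a star-preserving contraction selfadjoint.
\<close>

lemma selfadjoint_fixpoint:
  fixes f :: "'a::cstar_algebra \<Rightarrow> 'a"
  assumes ball: "\<And>y. norm y \<le> 1/2 \<Longrightarrow> norm (f y) \<le> 1/2"
    and lip: "\<And>y z. norm y \<le> 1/2 \<Longrightarrow> norm z \<le> 1/2 \<Longrightarrow> norm (f y - f z) \<le> 1/2 * norm (y - z)"
    and st: "\<And>y. star (f y) = f (star y)"
  shows "\<exists>y. star y = y \<and> f y = y"
proof -
  have "\<exists>!y. y \<in> cball 0 (1/2) \<and> f y = y"
  proof (rule Banach_fix[where c="1/2"])
    show "complete (cball (0::'a) (1/2))" by (simp add: complete_eq_closed)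
    show "f ` cball 0 (1/2) \<subseteq> cball 0 (1/2)" using ball by auto
    show "\<And>x y. x \<in> cball 0 (1/2) \<Longrightarrow> y \<in> cball 0 (1/2) \<Longrightarrow> dist (f x) (f y) \<le> 1/2 * dist x y"
      using lip by (auto simp: dist_norm)
  qed auto
  then obtain y where y: "norm y \<le> 1/2" "f y = y"
    and uniq: "\<And>z. norm z \<le> 1/2 \<and> f z = z \<Longrightarrow> z = y"
    by (auto simp only: Ex1_def mem_cball dist_0_norm)
  have "star y = y" using uniq[of "star y"] y(1) st[of y, unfolded y(2)] by simp
  then show ?thesis using y by blast
qed

text \<open>
  In the unitization the equation reads \<open>(1 - y)\<^sup>2 = 1 - h\<close>.
\<close>

lemma sqrt_one_minus:
  fixes h :: "'a::cstar_algebra"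
  assumes h: "star h = h" "norm h \<le> 1/2"
  shows "\<exists>y. star y = y \<and> (1/2) *\<^sub>R (h + y * y) = y"
proof (rule selfadjoint_fixpoint)
  fix y :: 'a assume y: "norm y \<le> 1/2"
  have "norm (y * y) \<le> 1/2 * (1/2)" by (rule order_trans[OF norm_mult_ineq]) (use y in \<open>intro mult_mono; simp\<close>)
  then show "norm ((1/2) *\<^sub>R (h + y * y)) \<le> 1/2"
    using h norm_triangle_ineq[of h "y*y"] by simp
next
  fix y z :: 'a assume y: "norm y \<le> 1/2" and z: "norm z \<le> 1/2"
  have e: "y * y - z * z = y * (y - z) + (y - z) * z" by (simp add: algebra_simps)
  have "norm (y * (y - z)) \<le> 1/2 * norm (y - z)"
    by (rule order_trans[OF norm_mult_ineq]) (use y in \<open>intro mult_right_mono; simp\<close>)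
  moreover have "norm ((y - z) * z) \<le> 1/2 * norm (y - z)"
    by (rule order_trans[OF norm_mult_ineq]) (use mult_left_mono[OF z, of "norm (y-z)"] in simp)
  ultimately have "norm (y * y - z * z) \<le> norm (y - z)"
    unfolding e using norm_triangle_ineq[of "y * (y - z)" "(y - z) * z"] by linarith
  moreover have "(1/2) *\<^sub>R (h + y * y) - (1/2) *\<^sub>R (h + z * z) = (1/2) *\<^sub>R (y * y - z * z)"
    by (simp add: algebra_simps)
  ultimately show "norm ((1/2) *\<^sub>R (h + y * y) - (1/2) *\<^sub>R (h + z * z)) \<le> 1/2 * norm (y - z)" by simp
next
  fix y :: 'a
  show "star ((1/2) *\<^sub>R (h + y * y)) = (1/2) *\<^sub>R (h + star y * star y)"
    by (simp add: star_scaleR star_add star_mult h)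
qed

text \<open>
  With \<open>c = 1/2 + y\<close> in the unitization the equation reads \<open>2c - cxc = 1\<close>. If \<open>x = \<langle>\<zeta>,\<zeta>\<rangle>\<close> in a Hilbert
  module, then \<open>\<eta> \<mapsto> \<eta> - \<zeta>c\<langle>\<zeta>,\<eta>\<rangle>\<close> is a selfadjoint square root of \<open>1 - \<theta>\<^sub>\<zeta>\<^sub>,\<^sub>\<zeta>\<close>.
\<close>

lemma root_of_rank_one:
  fixes x :: "'a::cstar_algebra"
  assumes x: "star x = x" "norm x \<le> 1/4"
  shows "\<exists>y. star y = y \<and> (1/8) *\<^sub>R x + (1/4) *\<^sub>R (x * y + y * x) + (1/2) *\<^sub>R (y * x * y) = y"
proof (rule selfadjoint_fixpoint)
  define g where "g a b d = (1/8) *\<^sub>R a + (1/4) *\<^sub>R b + (1/2) *\<^sub>R d" for a b d :: 'a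
  have norm_g: "norm (g a b d) \<le> 1/8 * norm a + 1/4 * norm b + 1/2 * norm d" for a b d
  proof -
    have tri: "norm (p + q + r) \<le> norm p + norm q + norm r" for p q r :: 'a
      by (rule order_trans[OF norm_triangle_ineq]) (simp add: norm_triangle_ineq)
    show ?thesis unfolding g_def
      by (rule order_trans[OF tri]) simp
  qed
  have g_diff: "g a b d - g a b' d' = g 0 (b - b') (d - d')" for a b b' d d'
    unfolding g_def scaleR_right_diff_distrib by simp
  have xy: "norm (x * y) \<le> 1/4 * norm y" for y
    by (rule order_trans[OF norm_mult_ineq]) (use x in \<open>intro mult_right_mono; simp\<close>)
  have yx: "norm (y * x) \<le> 1/4 * norm y" for y
    by (rule order_trans[OF norm_mult_ineq]) (use mult_left_mono[OF x(2), of "norm y"] in simp)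
  have yxz: "norm (y * x * z) \<le> 1/4 * norm y * norm z" for y z
    by (rule order_trans[OF norm_mult_ineq]) (use yx[of y] in \<open>intro mult_right_mono; simp\<close>)
  have add: "norm (x * y + y * x) \<le> 1/2 * norm y" for y
    using norm_triangle_ineq[of "x * y" "y * x"] xy[of y] yx[of y] by linarith
  { fix y :: 'a assume y: "norm y \<le> 1/2"
    have "norm y * norm y \<le> 1/2 * (1/2)" using y by (intro mult_mono) auto
    then have "norm (y * x * y) \<le> 1/16" using yxz[of y y] by simp
    then have "norm (g x (x * y + y * x) (y * x * y)) \<le> 1/2"
      using norm_g[of x "x * y + y * x" "y * x * y"] add[of y] y x(2) by linarith
    then show "norm ((1/8) *\<^sub>R x + (1/4) *\<^sub>R (x * y + y * x) + (1/2) *\<^sub>R (y * x * y)) \<le> 1/2"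
      unfolding g_def . }
  { fix y z :: 'a assume y: "norm y \<le> 1/2" and z: "norm z \<le> 1/2"
    let ?d = "y - z"
    have e1: "(x * y + y * x) - (x * z + z * x) = x * ?d + ?d * x" by (simp add: algebra_simps)
    have e2: "y * x * y - z * x * z = y * x * ?d + ?d * x * z" by (simp add: algebra_simps)
    have "norm (y * x * ?d) \<le> 1/4 * norm y * norm ?d" by (rule yxz)
    also have "\<dots> \<le> 1/8 * norm ?d" using mult_right_mono[OF y, of "norm ?d"] by simp
    finally have 1: "norm (y * x * ?d) \<le> 1/8 * norm ?d" .
    have "norm (?d * x * z) \<le> 1/4 * norm ?d * norm z" by (rule yxz)
    also have "\<dots> \<le> 1/8 * norm ?d" using mult_left_mono[OF z, of "norm ?d"] by (simp add: mult.commute)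
    finally have 2: "norm (?d * x * z) \<le> 1/8 * norm ?d" .
    have 3: "norm (y * x * ?d + ?d * x * z) \<le> 1/4 * norm ?d"
      using norm_triangle_ineq[of "y * x * ?d" "?d * x * z"] 1 2 by linarith
    have "norm (g 0 (x * ?d + ?d * x) (y * x * ?d + ?d * x * z)) \<le> 1/2 * norm ?d"
      using norm_g[of 0 "x * ?d + ?d * x" "y * x * ?d + ?d * x * z"] add[of ?d] 3
        norm_zero[where 'a='a] norm_ge_zero[of ?d] by linarith
    then have "norm (g x (x * y + y * x) (y * x * y) - g x (x * z + z * x) (z * x * z)) \<le> 1/2 * norm ?d"
      unfolding g_diff e1 e2 .
    then show "norm (((1/8) *\<^sub>R x + (1/4) *\<^sub>R (x * y + y * x) + (1/2) *\<^sub>R (y * x * y))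
      - ((1/8) *\<^sub>R x + (1/4) *\<^sub>R (x * z + z * x) + (1/2) *\<^sub>R (z * x * z))) \<le> 1/2 * norm (y - z)"
      unfolding g_def . }
  { fix y :: 'a
    show "star ((1/8) *\<^sub>R x + (1/4) *\<^sub>R (x * y + y * x) + (1/2) *\<^sub>R (y * x * y)) =
     (1/8) *\<^sub>R x + (1/4) *\<^sub>R (x * star y + star y * x) + (1/2) *\<^sub>R (star y * x * star y)"
      by (simp add: star_scaleR star_add star_mult x mult.assoc add.commute) }
qed

text \<open>
  In the unitization \<open>1 - p\<close> is the inverse of \<open>1 + kx\<close>. The commutator of \<open>x\<close> and \<open>p\<close> vanishes because
  it reproduces itself up to a factor of norm less than one.
\<close>

lemma resolvent:
  fixes x :: "'a::cstar_algebra"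
  assumes k: "cmod k * norm x < 1"
  shows "\<exists>p. p = k *\<^sub>C x - k *\<^sub>C (x * p) \<and> x * p = p * x"
proof -
  have c: "norm (k *\<^sub>C (x * z)) \<le> cmod k * norm x * norm z" for z
    using mult_left_mono[OF norm_mult_ineq[of x z], of "cmod k"] by (simp add: norm_scaleC mult.assoc)
  have "\<exists>!p. p \<in> UNIV \<and> k *\<^sub>C x - k *\<^sub>C (x * p) = p"
  proof (rule Banach_fix[where c="cmod k * norm x"])
    show "complete (UNIV::'a set)" by (rule complete_UNIV)
    fix y z :: 'a
    have "(k *\<^sub>C x - k *\<^sub>C (x * y)) - (k *\<^sub>C x - k *\<^sub>C (x * z)) = k *\<^sub>C (x * (z - y))"
      by (simp add: scaleC_diff_right right_diff_distrib)
    then show "dist (k *\<^sub>C x - k *\<^sub>C (x * y)) (k *\<^sub>C x - k *\<^sub>C (x * z)) \<le> cmod k * norm x * dist y z"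
      using c[of "z - y"] by (simp add: dist_norm norm_minus_commute)
  qed (use k in auto)
  then obtain p where p: "k *\<^sub>C x - k *\<^sub>C (x * p) = p" by auto
  let ?d = "x * p - p * x"
  have "?d = - (k *\<^sub>C (x * ?d))"
  proof -
    have 1: "x * p = k *\<^sub>C (x * x) - k *\<^sub>C (x * (x * p))"
      using arg_cong[OF p, of "\<lambda>t. x * t"] by (simp add: right_diff_distrib scaleC_mult_right)
    have 2: "p * x = k *\<^sub>C (x * x) - k *\<^sub>C (x * (p * x))"
      using arg_cong[OF p, of "\<lambda>t. t * x"] by (simp add: left_diff_distrib scaleC_mult_left mult.assoc)
    have "?d = (k *\<^sub>C (x * x) - k *\<^sub>C (x * (x * p))) - (k *\<^sub>C (x * x) - k *\<^sub>C (x * (p * x)))"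
      by (rule arg_cong2[OF 1 2])
    also have "\<dots> = - (k *\<^sub>C (x * ?d))" by (simp add: right_diff_distrib scaleC_diff_right)
    finally show ?thesis .
  qed
  then have "norm ?d \<le> cmod k * norm x * norm ?d" using c[of ?d] by (metis norm_minus_cancel)
  then have "norm ?d * (1 - cmod k * norm x) \<le> 0" by (simp add: algebra_simps)
  then have "norm ?d \<le> 0" using k by (simp add: mult_le_0_iff)
  then have "x * p = p * x" by simp
  then show ?thesis using p[symmetric] by blast
qed

text \<open>
  For a vector \<open>\<zeta>\<close> with \<open>\<langle>\<zeta>,\<zeta>\<rangle> = x\<close> the norm below is the square of \<open>\<parallel>\<zeta> - \<zeta>v\<parallel>\<close>. The Cayley transform
  \<open>V = (1 - isx)(1 + isx)\<^sup>-\<^sup>1\<close> is unitary, so the Cesaro means \<open>W\<close> of its powers satisfy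
  \<open>\<parallel>(1 - V)W\<parallel> \<le> 2/n\<close>. Since \<open>2isx = (1 + isx)(1 - V)\<close>, also \<open>xW\<close> is small, and \<open>v = 1 - W\<close> lies in
  the algebra.
\<close>

lemma cstar_approximate_right_unit:
  fixes x :: "'a::cstar_algebra"
  assumes x: "star x = x" and e: "0 < e"
  shows "\<exists>v. norm (x - x * v - star v * x + star v * x * v) < e"
proof -
  \<comment> \<open>The factor \<open>s\<close> makes the norm of \<open>isx\<close> less than one.\<close>
  define s where "s = 1 / (norm x + 1)"
  have np: "norm x + 1 > 0" using norm_ge_zero[of x] by linarith
  have s: "s > 0" "s * norm x < 1" unfolding s_def using np by (simp_all add: field_simps)
  define k where "k = \<i> * complex_of_real s"
  have k: "cmod k = s" "cnj k = - k" using s by (simp_all add: k_def norm_mult)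
  obtain p where p: "p = k *\<^sub>C x - k *\<^sub>C (x * p)" and comm: "x * p = p * x"
    using resolvent[of k x] s k by auto
  have sp: "star p = - (k *\<^sub>C x) + k *\<^sub>C (star p * x)"
  proof -
    have "star p = star (k *\<^sub>C x - k *\<^sub>C (x * p))" using p by simp
    also have "\<dots> = - (k *\<^sub>C x) + k *\<^sub>C (star p * x)"
      by (simp add: star_diff star_scaleC k star_mult x scaleC_minus_left)
    finally show ?thesis .
  qed
  \<comment> \<open>Equivalently \<open>(1 - 2p)\<^sup>*(1 - 2p) = 1\<close>.\<close>
  have unitary: "star p * p + star p * p = p + star p"
  proof -
    have 1: "star p * p = k *\<^sub>C (star p * x) - k *\<^sub>C (star p * x * p)"
      using arg_cong[OF p, of "\<lambda>t. star p * t"]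
      by (simp add: right_diff_distrib scaleC_mult_right mult.assoc)
    have 2: "star p * p = - (k *\<^sub>C (x * p)) + k *\<^sub>C (star p * x * p)"
      using arg_cong[OF sp, of "\<lambda>t. t * p"]
      by (simp only: distrib_right minus_mult_left[symmetric] scaleC_mult_left)
    have "star p * p + star p * p = (k *\<^sub>C (star p * x) - k *\<^sub>C (star p * x * p)) + (- (k *\<^sub>C (x * p)) + k *\<^sub>C (star p * x * p))"
      by (rule arg_cong2[OF 1 2])
    also have "\<dots> = k *\<^sub>C (star p * x) - k *\<^sub>C (x * p)" by simp
    also have "k *\<^sub>C (star p * x) = star p + k *\<^sub>C x" using sp by (metis add.commute add_diff_cancel diff_conv_add_uminus minus_minus)
    also have "k *\<^sub>C (x * p) = k *\<^sub>C x - p" using p by (metis add_diff_cancel_left' diff_add_cancel)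
    finally show ?thesis by simp
  qed
  define V where "V z = z - (p * z + p * z)" for z
  have V_norm: "norm (V z) = norm z" for z
  proof -
    have "star (V z) * V z = star z * z - star z * (p + star p) * z - star z * (p + star p) * z
       + (star z * (star p * p + star p * p) * z + star z * (star p * p + star p * p) * z)"
      unfolding V_def star_diff star_add star_mult by (simp add: algebra_simps)
    then have "star (V z) * V z = star z * z" unfolding unitary by simp
    then have "(norm (V z))\<^sup>2 = (norm z)\<^sup>2" by (metis cstar_identity)
    then show ?thesis by simp
  qed
  \<comment> \<open>\<open>c n\<close> stands for \<open>1 - V\<^sup>n\<close>, which lies in the algebra.\<close>
  define c where "c = rec_nat 0 (\<lambda>_ d. d + (p + p) - (p * d + p * d))"
  have c0: "c 0 = 0" and cS: "c (Suc n) = c n + (p + p) - (p * c n + p * c n)" for n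
    by (simp_all add: c_def)
  have iso: "norm (z - c n * z) = norm z" for n z
  proof (induction n)
    case (Suc n)
    have "z - c (Suc n) * z = V (z - c n * z)" by (simp add: cS V_def algebra_simps)
    then show ?case using Suc V_norm by simp
  qed (simp add: c0)
  have c_bound: "norm (c n) \<le> 2" for n
  proof (cases "c n = 0")
    case False
    have "(norm (c n))\<^sup>2 = norm (c n * star (c n))" by (simp add: norm_mult_star)
    also have "c n * star (c n) = star (c n) - (star (c n) - c n * star (c n))" by simp
    also have "norm \<dots> \<le> norm (star (c n)) + norm (star (c n) - c n * star (c n))"
      by (rule norm_triangle_ineq4)
    also have "\<dots> = 2 * norm (c n)" by (simp only: iso norm_star)
    finally show ?thesis using False by (simp add: power2_eq_square)
  qed simp
  \<comment> \<open>The telescoping sum \<open>2isx(1 + V + \<dots> + V\<^sup>n\<^sup>-\<^sup>1) = (1 + isx)(1 - V\<^sup>n)\<close>.\<close>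
  have tele: "k *\<^sub>C (\<Sum>j<n. x - x * c j) + k *\<^sub>C (\<Sum>j<n. x - x * c j) = c n + k *\<^sub>C (x * c n)" for n
  proof (induction n)
    case (Suc n)
    have kx: "k *\<^sub>C x = p + k *\<^sub>C (x * p)" using p by (metis diff_add_cancel)
    have "k *\<^sub>C (x * c n) = p * c n + k *\<^sub>C (x * (p * c n))"
      using arg_cong[OF kx, of "\<lambda>t. t * c n"] by (simp add: scaleC_mult_left distrib_right mult.assoc)
    then have "k *\<^sub>C (x - x * c n) = p + k *\<^sub>C (x * p) - (p * c n + k *\<^sub>C (x * (p * c n)))"
      using kx by (simp only: scaleC_diff_right)
    then have "k *\<^sub>C (\<Sum>j<Suc n. x - x * c j) + k *\<^sub>C (\<Sum>j<Suc n. x - x * c j)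
      = (c n + k *\<^sub>C (x * c n)) + ((p + k *\<^sub>C (x * p) - (p * c n + k *\<^sub>C (x * (p * c n))))
        + (p + k *\<^sub>C (x * p) - (p * c n + k *\<^sub>C (x * (p * c n)))))"
      using Suc by (simp only: sum.lessThan_Suc scaleC_add_right) (simp add: algebra_simps)
    also have "\<dots> = c (Suc n) + k *\<^sub>C (x * c (Suc n))"
      unfolding cS by (simp add: algebra_simps scaleC_add_right scaleC_diff_right)
    finally show ?case .
  qed (simp add: c0)
  obtain n :: nat where n: "6 / (e * s) < real n" using reals_Archimedean2 by blast
  have n0: "0 < real n" using n e s by (smt (verit) divide_pos_pos mult_pos_pos)
  define v where "v = (1 / real n) *\<^sub>R (\<Sum>j<n. c j)"
  have v_norm: "norm v \<le> 2"
  proof -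
    have "norm (\<Sum>j<n. c j) \<le> (\<Sum>j<n. 2)" by (rule sum_norm_le) (rule c_bound)
    then show ?thesis using n0 by (simp add: v_def field_simps)
  qed
  let ?d = "x - x * v"
  have "(\<Sum>j<n. x - x * c j) = real n *\<^sub>R ?d"
    using n0 by (simp add: v_def sum_subtractf sum_distrib_left scaleR_diff_right sum_constant_scaleR)
  then have "k *\<^sub>C (real n *\<^sub>R ?d) + k *\<^sub>C (real n *\<^sub>R ?d) = c n + k *\<^sub>C (x * c n)" using tele[of n] by simp
  then have "(2 * k * complex_of_real (real n)) *\<^sub>C ?d = c n + k *\<^sub>C (x * c n)"
    by (simp add: scaleR_scaleC scaleC_scaleC scaleC_add_left[symmetric] mult.assoc)
  then have "norm ((2 * k * complex_of_real (real n)) *\<^sub>C ?d) = norm (c n + k *\<^sub>C (x * c n))"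
    by (rule arg_cong)
  also have "\<dots> \<le> norm (c n) + norm (k *\<^sub>C (x * c n))" by (rule norm_triangle_ineq)
  also have "norm (k *\<^sub>C (x * c n)) \<le> s * norm x * norm (c n)"
    using mult_left_mono[OF norm_mult_ineq[of x "c n"], of s] s by (simp add: norm_scaleC k mult.assoc)
  also have "s * norm x * norm (c n) \<le> 1 * norm (c n)" using s by (intro mult_right_mono) auto
  also have "norm (c n) + 1 * norm (c n) \<le> 4" using c_bound[of n] by simp
  finally have "2 * s * real n * norm ?d \<le> 4" by (simp add: norm_scaleC norm_mult k)
  then have d: "norm ?d \<le> 2 / (s * real n)" using s n0 by (simp add: field_simps)
  have "x - x * v - star v * x + star v * x * v = ?d - star v * ?d" by (simp add: algebra_simps)
  then have "norm (x - x * v - star v * x + star v * x * v) \<le> norm ?d + norm (star v * ?d)"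
    using norm_triangle_ineq4 by metis
  also have "norm (star v * ?d) \<le> 2 * norm ?d"
    by (rule order_trans[OF norm_mult_ineq]) (use v_norm in \<open>intro mult_right_mono; simp\<close>)
  also have "norm ?d + 2 * norm ?d \<le> 6 / (s * real n)" using d by simp
  also have "\<dots> < e" using n e s n0 by (simp add: field_simps)
  finally have "norm (x - x * v - star v * x + star v * x * v) < e" by simp
  then show ?thesis by blast
qed

section \<open>Semi-inner products\<close>

text \<open>
  The forms of interest are \<open>\<sigma>\<langle>\<xi>,\<eta>\<rangle>\<close> and \<open>\<sigma>(a\<^sup>*b)\<close> for a positive functional \<open>\<sigma>\<close>, and what remains of the
  former when a Bessel sum is subtracted. They are degenerate in general.
\<close>

locale semi_inner =
  fixes V :: "'x::complex_vector set" and s :: "'x \<Rightarrow> 'x \<Rightarrow> complex"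
  assumes add_mem: "u \<in> V \<Longrightarrow> v \<in> V \<Longrightarrow> u + v \<in> V"
    and scale_mem: "u \<in> V \<Longrightarrow> c *\<^sub>C u \<in> V"
    and add_left: "u \<in> V \<Longrightarrow> v \<in> V \<Longrightarrow> w \<in> V \<Longrightarrow> s (u + v) w = s u w + s v w"
    and add_right: "u \<in> V \<Longrightarrow> v \<in> V \<Longrightarrow> w \<in> V \<Longrightarrow> s u (v + w) = s u v + s u w"
    and scale_left: "u \<in> V \<Longrightarrow> v \<in> V \<Longrightarrow> s (c *\<^sub>C u) v = cnj c * s u v"
    and scale_right: "u \<in> V \<Longrightarrow> v \<in> V \<Longrightarrow> s u (c *\<^sub>C v) = c * s u v"
    and diag_real: "u \<in> V \<Longrightarrow> s u u \<in> \<real>"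
    and diag_nonneg: "u \<in> V \<Longrightarrow> 0 \<le> Re (s u u)"
begin

definition nrm :: "'x \<Rightarrow> real" where "nrm u = sqrt (Re (s u u))"

lemma diff_mem: "u \<in> V \<Longrightarrow> v \<in> V \<Longrightarrow> u - v \<in> V"
  using add_mem[of u "(-1) *\<^sub>C v"] scale_mem[of v "-1"] by (simp add: minus_eq_scaleC[symmetric])

lemma nrm_nonneg: "u \<in> V \<Longrightarrow> 0 \<le> nrm u" by (simp add: nrm_def diag_nonneg)

lemma nrm_power2: "u \<in> V \<Longrightarrow> (nrm u)\<^sup>2 = Re (s u u)" by (simp add: nrm_def diag_nonneg)

lemma expand:
  assumes "u \<in> V" "v \<in> V"
  shows "s (u + c *\<^sub>C v) (u + c *\<^sub>C v) = s u u + c * s u v + cnj c * s v u + c * cnj c * s v v"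
  using assms by (simp add: add_left add_right scale_left scale_right scale_mem add_mem algebra_simps)

lemma hermitian:
  assumes u: "u \<in> V" and v: "v \<in> V"
  shows "s v u = cnj (s u v)"
proof -
  have r: "Im (c * s u v + cnj c * s v u) = 0" for c
  proof -
    have "Im (s (u + c *\<^sub>C v) (u + c *\<^sub>C v)) = 0"
      using diag_real[of "u + c *\<^sub>C v"] u v by (auto simp: add_mem scale_mem complex_is_Real_iff)
    moreover have "Im (s u u) = 0" "Im (s v v) = 0"
      using diag_real u v by (auto simp: complex_is_Real_iff)
    ultimately show ?thesis unfolding expand[OF u v] by (simp add: algebra_simps)
  qed
  show ?thesis using r[of 1] r[of \<i>] by (simp add: complex_eq_iff)
qed

lemma Re_expand:
  assumes "u \<in> V" "v \<in> V"
  shows "Re (s (u + c *\<^sub>C v) (u + c *\<^sub>C v)) = Re (s u u) + 2 * Re (c * s u v) + (cmod c)\<^sup>2 * Re (s v v)"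
proof -
  have "c * s u v + cnj c * s v u = c * s u v + cnj (c * s u v)"
    using hermitian[OF assms] by simp
  moreover have "c * cnj c * s v v = complex_of_real ((cmod c)\<^sup>2) * s v v"
    by (simp only: complex_norm_square)
  ultimately show ?thesis unfolding expand[OF assms]
    by (smt (verit) Re_complex_of_real Im_complex_of_real add.assoc complex_add_cnj mult_eq_0_iff
        of_real_mult plus_complex.sel(1) times_complex.sel(1) mult_zero_left)
qed

lemma Cauchy_Schwarz:
  assumes u: "u \<in> V" and v: "v \<in> V"
  shows "cmod (s u v) \<le> nrm u * nrm v"
proof -
  let ?a = "Re (s u u)" and ?b = "s u v" and ?c = "Re (s v v)"
  have *: "0 \<le> ?a - 2 * t * (cmod ?b)\<^sup>2 + t\<^sup>2 * (cmod ?b)\<^sup>2 * ?c" for t :: real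
  proof -
    \<comment> \<open>Only the phase of the multiplier matters at first; its size \<open>t\<close> is chosen below.\<close>
    let ?l = "- (complex_of_real t * cnj ?b)"
    have "0 \<le> Re (s (u + ?l *\<^sub>C v) (u + ?l *\<^sub>C v))"
      by (rule diag_nonneg) (use u v in \<open>simp add: add_mem scale_mem\<close>)
    moreover have "Re (?l * ?b) = - (t * (cmod ?b)\<^sup>2)"
      unfolding cmod_power2 by (simp add: power2_eq_square algebra_simps)
    moreover have "(cmod ?l)\<^sup>2 = t\<^sup>2 * (cmod ?b)\<^sup>2" by (simp add: norm_mult power_mult_distrib)
    ultimately show ?thesis unfolding Re_expand[OF u v] by simp
  qed
  have c: "0 \<le> ?c" and a: "0 \<le> ?a" using diag_nonneg u v by auto
  have "(cmod ?b)\<^sup>2 \<le> ?a * ?c"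
  proof (cases "?c = 0")
    case True
    have "cmod ?b = 0"
    proof (rule ccontr)
      assume nb: "cmod ?b \<noteq> 0"
      obtain t where t: "t * (cmod ?b)\<^sup>2 = ?a + 1"
        using nb by (metis nonzero_eq_divide_eq power_not_zero)
      show False using *[of t] True a by (simp add: mult.assoc t)
    qed
    then show ?thesis using True by simp
  next
    case False
    then have "0 < ?c" using c by simp
    then show ?thesis using *[of "1 / ?c"] by (simp add: field_simps power2_eq_square)
  qed
  then have "(cmod ?b)\<^sup>2 \<le> (nrm u * nrm v)\<^sup>2" by (simp add: power_mult_distrib nrm_power2 u v)
  then show ?thesis by (rule power2_le_imp_le) (use u v in \<open>simp add: nrm_nonneg\<close>)
qed

lemma nrm_triangle:
  assumes u: "u \<in> V" and v: "v \<in> V"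
  shows "nrm (u + v) \<le> nrm u + nrm v"
proof (rule power2_le_imp_le)
  have "(nrm (u + v))\<^sup>2 = (nrm u)\<^sup>2 + 2 * Re (s u v) + (nrm v)\<^sup>2"
    using Re_expand[OF u v, of 1] by (simp add: nrm_power2 u v add_mem scaleC_one)
  also have "\<dots> \<le> (nrm u)\<^sup>2 + 2 * (nrm u * nrm v) + (nrm v)\<^sup>2"
    using Cauchy_Schwarz[OF u v] complex_Re_le_cmod[of "s u v"] by simp
  finally show "(nrm (u + v))\<^sup>2 \<le> (nrm u + nrm v)\<^sup>2" by (simp add: power2_sum)
qed (use u v in \<open>simp add: nrm_nonneg\<close>)

lemma nrm_sum_list:
  assumes "set us \<subseteq> V" "0 \<in> V" "s 0 0 = 0"
  shows "sum_list us \<in> V \<and> nrm (sum_list us) \<le> (\<Sum>u\<leftarrow>us. nrm u)"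
  using assms(1)
proof (induction us)
  case (Cons u us)
  then have IH: "sum_list us \<in> V" "nrm (sum_list us) \<le> (\<Sum>u\<leftarrow>us. nrm u)" and u: "u \<in> V" by auto
  then show ?case using nrm_triangle[OF u IH(1)] by (simp add: add_mem)
qed (use assms in \<open>simp add: nrm_def\<close>)

end

section \<open>Positive functionals\<close>

text \<open>
  The bound is asked for on one side and on selfadjoint elements, since this is what a square root of
  \<open>1 - h\<close> gives for the functionals \<open>a \<mapsto> \<tau>\<langle>\<beta>,a\<beta>\<rangle>\<close>.
\<close>

definition positive_functional :: "('a::cstar_algebra \<Rightarrow> complex) \<Rightarrow> bool" where
  "positive_functional \<sigma> \<longleftrightarrow>
     (\<forall>a b. \<sigma> (a + b) = \<sigma> a + \<sigma> b) \<and> (\<forall>c a. \<sigma> (c *\<^sub>C a) = c * \<sigma> a) \<and>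
     (\<forall>a\<in>positive_elements. \<sigma> a \<in> \<real> \<and> 0 \<le> Re (\<sigma> a)) \<and>
     (\<exists>C. \<forall>h. star h = h \<longrightarrow> Re (\<sigma> h) \<le> C * norm h)"

lemma positive_functionalD:
  assumes "positive_functional \<sigma>"
  shows "\<sigma> (a + b) = \<sigma> a + \<sigma> b" "\<sigma> (c *\<^sub>C a) = c * \<sigma> a" "\<sigma> 0 = 0" "\<sigma> (- a) = - \<sigma> a"
    "\<sigma> (a - b) = \<sigma> a - \<sigma> b"
    "a \<in> positive_elements \<Longrightarrow> \<sigma> a \<in> \<real>" "a \<in> positive_elements \<Longrightarrow> 0 \<le> Re (\<sigma> a)"
proof -
  have add: "\<And>a b. \<sigma> (a + b) = \<sigma> a + \<sigma> b" and sc: "\<And>c a. \<sigma> (c *\<^sub>C a) = c * \<sigma> a"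
    using assms unfolding positive_functional_def by auto
  show "\<sigma> (a + b) = \<sigma> a + \<sigma> b" "\<sigma> (c *\<^sub>C a) = c * \<sigma> a" by (rule add, rule sc)
  show "\<sigma> 0 = 0" using add[of 0 0] by simp
  have m: "\<sigma> (- a) = - \<sigma> a" for a using sc[of "-1" a] by (simp add: minus_eq_scaleC[symmetric])
  show "\<sigma> (- a) = - \<sigma> a" by (rule m)
  show "\<sigma> (a - b) = \<sigma> a - \<sigma> b" using add[of a "-b"] m[of b] by simp
  show "a \<in> positive_elements \<Longrightarrow> \<sigma> a \<in> \<real>" "a \<in> positive_elements \<Longrightarrow> 0 \<le> Re (\<sigma> a)"
    using assms unfolding positive_functional_def by auto
qed

lemma Re_sum_list: "Re (\<Sum>x\<leftarrow>xs. f x) = (\<Sum>x\<leftarrow>xs. Re (f x))"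
  by (induction xs) simp_all

lemma positive_functional_sum_list:
  assumes "positive_functional \<sigma>"
  shows "Re (\<sigma> (\<Sum>x\<leftarrow>xs. f x)) = (\<Sum>x\<leftarrow>xs. Re (\<sigma> (f x)))"
  by (induction xs) (simp_all add: positive_functionalD[OF assms])

lemma star_mult_self_positive: "star a * a \<in> positive_elements"
  unfolding positive_elements_def by blast

lemma positive_functional_semi_inner:
  assumes "positive_functional \<sigma>"
  shows "semi_inner UNIV (\<lambda>a b. \<sigma> (star a * b))"
  by unfold_locales
    (auto simp: positive_functionalD[OF assms] star_add star_scaleC distrib_left distrib_right
      scaleC_mult_left scaleC_mult_right intro!: positive_functionalD[OF assms] star_mult_self_positive)

lemma tracial_state_positive_functional:
  assumes "tracial_state \<tau>" shows "positive_functional \<tau>"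
proof -
  have bl: "bounded_linear \<tau>" using assms unfolding tracial_state_def by simp
  have "Re (\<tau> h) \<le> onorm \<tau> * norm h" for h
    using onorm[OF bl, of h] complex_Re_le_cmod[of "\<tau> h"] by linarith
  then have "\<exists>C. \<forall>h. star h = h \<longrightarrow> Re (\<tau> h) \<le> C * norm h" by blast
  then show ?thesis
    using assms unfolding tracial_state_def positive_functional_def
    by (auto simp: linear_add[OF bounded_linear.linear[OF bl]])
qed

lemma tracial_state_commute: "tracial_state \<tau> \<Longrightarrow> \<tau> (a * b) = \<tau> (b * a)"
  unfolding tracial_state_def by blast

section \<open>Hilbert modules and families dominated by the identity\<close>

locale hmod =
  fixes Y :: "('x::complex_vector, 'a::cstar_algebra) corr"
  assumes hm: "hilbert_module Y"
begin

abbreviation sqnorm :: "('a \<Rightarrow> complex) \<Rightarrow> 'x \<Rightarrow> real" where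
  "sqnorm \<sigma> \<omega> \<equiv> Re (\<sigma> (inn Y \<omega> \<omega>))"

abbreviation sqcoeff :: "('a \<Rightarrow> complex) \<Rightarrow> 'x \<Rightarrow> 'x \<Rightarrow> real" where
  "sqcoeff \<sigma> \<omega> \<xi> \<equiv> Re (\<sigma> (inn Y \<omega> \<xi> * inn Y \<xi> \<omega>))"

lemma zero_mem: "0 \<in> car Y"
  and add_mem: "\<xi> \<in> car Y \<Longrightarrow> \<eta> \<in> car Y \<Longrightarrow> \<xi> + \<eta> \<in> car Y"
  and scale_mem: "\<xi> \<in> car Y \<Longrightarrow> c *\<^sub>C \<xi> \<in> car Y"
  and ract_mem: "\<xi> \<in> car Y \<Longrightarrow> ract Y \<xi> a \<in> car Y"
  and inn_add_right: "\<xi> \<in> car Y \<Longrightarrow> \<eta> \<in> car Y \<Longrightarrow> \<zeta> \<in> car Y \<Longrightarrow> inn Y \<xi> (\<eta> + \<zeta>) = inn Y \<xi> \<eta> + inn Y \<xi> \<zeta>"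
  and inn_scale_right: "\<xi> \<in> car Y \<Longrightarrow> \<eta> \<in> car Y \<Longrightarrow> inn Y \<xi> (c *\<^sub>C \<eta>) = c *\<^sub>C inn Y \<xi> \<eta>"
  and inn_ract_right: "\<xi> \<in> car Y \<Longrightarrow> \<eta> \<in> car Y \<Longrightarrow> inn Y \<xi> (ract Y \<eta> a) = inn Y \<xi> \<eta> * a"
  and inn_star: "\<xi> \<in> car Y \<Longrightarrow> \<eta> \<in> car Y \<Longrightarrow> star (inn Y \<xi> \<eta>) = inn Y \<eta> \<xi>"
  and inn_pos: "\<xi> \<in> car Y \<Longrightarrow> inn Y \<xi> \<xi> \<in> positive_elements"
  and inn_definite: "\<xi> \<in> car Y \<Longrightarrow> inn Y \<xi> \<xi> = 0 \<Longrightarrow> \<xi> = 0"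
  by (insert hm; unfold hilbert_module_def; metis)+

lemma minus_mem: "\<xi> \<in> car Y \<Longrightarrow> - \<xi> \<in> car Y"
  using scale_mem[of \<xi> "-1"] by (simp add: minus_eq_scaleC[symmetric])

lemma diff_mem: "\<xi> \<in> car Y \<Longrightarrow> \<eta> \<in> car Y \<Longrightarrow> \<xi> - \<eta> \<in> car Y"
  using add_mem[of \<xi> "- \<eta>"] minus_mem by simp

lemma inn_add_left:
  assumes "\<xi> \<in> car Y" "\<eta> \<in> car Y" "\<zeta> \<in> car Y"
  shows "inn Y (\<xi> + \<eta>) \<zeta> = inn Y \<xi> \<zeta> + inn Y \<eta> \<zeta>"
  using inn_add_right[of \<zeta> \<xi> \<eta>] inn_star assms by (metis add_mem star_add)

lemma inn_scale_left:
  assumes "\<xi> \<in> car Y" "\<eta> \<in> car Y"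
  shows "inn Y (c *\<^sub>C \<xi>) \<eta> = cnj c *\<^sub>C inn Y \<xi> \<eta>"
  using inn_scale_right[of \<eta> \<xi> c] inn_star assms by (metis scale_mem star_scaleC)

lemma inn_ract_left:
  assumes "\<xi> \<in> car Y" "\<eta> \<in> car Y"
  shows "inn Y (ract Y \<xi> a) \<eta> = star a * inn Y \<xi> \<eta>"
  using inn_ract_right[of \<eta> \<xi> a] inn_star assms by (metis ract_mem star_mult)

lemma inn_minus_right: "\<xi> \<in> car Y \<Longrightarrow> \<eta> \<in> car Y \<Longrightarrow> inn Y \<xi> (- \<eta>) = - inn Y \<xi> \<eta>"
  using inn_scale_right[of \<xi> \<eta> "-1"] by (simp add: minus_eq_scaleC[symmetric])

lemma inn_diff_right:
  assumes "\<xi> \<in> car Y" "\<eta> \<in> car Y" "\<zeta> \<in> car Y"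
  shows "inn Y \<xi> (\<eta> - \<zeta>) = inn Y \<xi> \<eta> - inn Y \<xi> \<zeta>"
  using inn_add_right[of \<xi> \<eta> "- \<zeta>"] inn_minus_right[of \<xi> \<zeta>] assms minus_mem by simp

lemma inn_diff_left:
  assumes "\<xi> \<in> car Y" "\<eta> \<in> car Y" "\<zeta> \<in> car Y"
  shows "inn Y (\<xi> - \<eta>) \<zeta> = inn Y \<xi> \<zeta> - inn Y \<eta> \<zeta>"
  using inn_diff_right[of \<zeta> \<xi> \<eta>] inn_star assms by (metis diff_mem star_diff)

lemma inn_zero_right: "\<xi> \<in> car Y \<Longrightarrow> inn Y \<xi> 0 = 0"
  using inn_scale_right[of \<xi> 0 0] zero_mem by simp

lemma inn_zero_left: "\<xi> \<in> car Y \<Longrightarrow> inn Y 0 \<xi> = 0"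
  using inn_scale_left[of 0 \<xi> 0] zero_mem by simp

lemma sum_list_mem: "set \<xi>s \<subseteq> car Y \<Longrightarrow> sum_list \<xi>s \<in> car Y"
  by (induction \<xi>s) (auto simp: zero_mem add_mem)

lemma inn_sum_list_right:
  "\<xi> \<in> car Y \<Longrightarrow> set \<eta>s \<subseteq> car Y \<Longrightarrow> inn Y \<xi> (sum_list \<eta>s) = (\<Sum>\<eta>\<leftarrow>\<eta>s. inn Y \<xi> \<eta>)"
  by (induction \<eta>s) (auto simp: inn_zero_right inn_add_right sum_list_mem)

lemma inn_eqI:
  assumes "\<alpha> \<in> car Y" "\<beta> \<in> car Y" "\<And>\<omega>. \<omega> \<in> car Y \<Longrightarrow> inn Y \<omega> \<alpha> = inn Y \<omega> \<beta>"
  shows "\<alpha> = \<beta>"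
proof -
  have "inn Y (\<alpha> - \<beta>) (\<alpha> - \<beta>) = 0" using assms by (simp add: inn_diff_right diff_mem)
  then show ?thesis using inn_definite[of "\<alpha> - \<beta>"] assms by (simp add: diff_mem)
qed

lemma semi_inner_functional:
  assumes "positive_functional \<sigma>"
  shows "semi_inner (car Y) (\<lambda>\<xi> \<eta>. \<sigma> (inn Y \<xi> \<eta>))"
  by unfold_locales
    (auto simp: add_mem scale_mem inn_add_left inn_add_right inn_scale_left inn_scale_right inn_pos
      positive_functionalD[OF assms])

text \<open>
  This says \<open>1 - \<Sum>\<^sub>L \<theta>\<^sub>\<xi>\<^sub>,\<^sub>\<xi> = S'S\<close>, expressed by inner products. The operator \<open>S\<close> is kept because \<open>\<sigma>\<langle>S\<eta>,S\<eta>\<rangle>\<close> is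
  the error in approximating \<open>\<eta>\<close> by the family.
\<close>

definition dominated :: "'x list \<Rightarrow> ('x \<Rightarrow> 'x) \<Rightarrow> ('x \<Rightarrow> 'x) \<Rightarrow> bool" where
  "dominated L S S' \<longleftrightarrow> set L \<subseteq> car Y \<and> adjoint_pair Y S S' \<and>
     (\<forall>\<eta>\<in>car Y. \<forall>\<omega>\<in>car Y. inn Y (S \<eta>) (S \<omega>) = inn Y \<eta> \<omega> - (\<Sum>\<xi>\<leftarrow>L. inn Y \<eta> \<xi> * inn Y \<xi> \<omega>))"

lemma dominatedD:
  assumes "dominated L S S'"
  shows "set L \<subseteq> car Y" "\<eta> \<in> car Y \<Longrightarrow> S \<eta> \<in> car Y" "\<eta> \<in> car Y \<Longrightarrow> S' \<eta> \<in> car Y"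
    "\<eta> \<in> car Y \<Longrightarrow> \<omega> \<in> car Y \<Longrightarrow> inn Y (S \<eta>) \<omega> = inn Y \<eta> (S' \<omega>)"
    "\<eta> \<in> car Y \<Longrightarrow> \<omega> \<in> car Y \<Longrightarrow> inn Y (S \<eta>) (S \<omega>) = inn Y \<eta> \<omega> - (\<Sum>\<xi>\<leftarrow>L. inn Y \<eta> \<xi> * inn Y \<xi> \<omega>)"
  using assms unfolding dominated_def adjoint_pair_def by auto

text \<open>
  If \<open>1 - \<Sum>\<^sub>L \<theta>\<^sub>\<xi>\<^sub>,\<^sub>\<xi> = S'S\<close> and \<open>1 - \<Sum>\<^sub>M \<theta>\<^sub>\<xi>\<^sub>,\<^sub>\<xi> = T'T\<close>, then removing \<open>S'(\<Sum>\<^sub>M \<theta>\<^sub>\<xi>\<^sub>,\<^sub>\<xi>)S = \<Sum>\<^sub>M \<theta>\<^sub>S\<^sub>'\<^sub>\<xi>\<^sub>,\<^sub>S\<^sub>'\<^sub>\<xi>\<close> from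
  \<open>S'S\<close> leaves \<open>S'T'TS\<close>. Families adapted to different vectors are glued in this way.
\<close>

lemma dominated_compose:
  assumes 1: "dominated L S S'" and 2: "dominated M T T'"
  shows "dominated (L @ map S' M) (T \<circ> S) (S' \<circ> T')"
proof -
  note d = dominatedD[OF 1] dominatedD[OF 2]
  have flip: "inn Y \<xi> (S \<omega>) = inn Y (S' \<xi>) \<omega>" if "\<xi> \<in> car Y" "\<omega> \<in> car Y" for \<xi> \<omega>
    using d(4)[OF that(2,1)] inn_star that d by metis
  have eq: "inn Y ((T \<circ> S) \<eta>) ((T \<circ> S) \<omega>) = inn Y \<eta> \<omega> - (\<Sum>\<xi>\<leftarrow>L @ map S' M. inn Y \<eta> \<xi> * inn Y \<xi> \<omega>)"
    if "\<eta> \<in> car Y" "\<omega> \<in> car Y" for \<eta> \<omega>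
  proof -
    have "(\<Sum>\<xi>\<leftarrow>M. inn Y (S \<eta>) \<xi> * inn Y \<xi> (S \<omega>)) = (\<Sum>\<xi>\<leftarrow>M. inn Y \<eta> (S' \<xi>) * inn Y (S' \<xi>) \<omega>)"
      by (rule arg_cong[where f=sum_list], rule map_cong) (use d that flip in auto)
    then show ?thesis using d that by (simp add: o_def)
  qed
  show ?thesis unfolding dominated_def adjoint_pair_def
  proof (intro conjI ballI)
    show "set (L @ map S' M) \<subseteq> car Y" using d by auto
    show "inn Y ((T \<circ> S) \<eta>) ((T \<circ> S) \<omega>) = inn Y \<eta> \<omega> - (\<Sum>\<xi>\<leftarrow>L @ map S' M. inn Y \<eta> \<xi> * inn Y \<xi> \<omega>)"
      if "\<eta> \<in> car Y" "\<omega> \<in> car Y" for \<eta> \<omega> using that by (rule eq)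
    show "inn Y ((T \<circ> S) \<eta>) \<omega> = inn Y \<eta> ((S' \<circ> T') \<omega>)"
      if "\<eta> \<in> car Y" "\<omega> \<in> car Y" for \<eta> \<omega> using that d(2,3,4,7,8,9) by simp
  qed (use d(2,3,7,8) in auto)
qed

lemma dominated_Nil: "dominated [] id id"
  unfolding dominated_def adjoint_pair_def by auto

lemma dominated_singleton:
  assumes \<zeta>: "\<zeta> \<in> car Y" and small: "norm (inn Y \<zeta> \<zeta>) \<le> 1/4"
  shows "\<exists>B. dominated [\<zeta>] B B"
proof -
  define x where "x = inn Y \<zeta> \<zeta>"
  have "star x = x" "norm x \<le> 1/4" using \<zeta> small by (simp_all add: x_def inn_star)
  then obtain y where y: "star y = y"
    and eq: "(1/8) *\<^sub>R x + (1/4) *\<^sub>R (x * y + y * x) + (1/2) *\<^sub>R (y * x * y) = y"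
    using root_of_rank_one by blast
  have eq2: "y + y = (1/4) *\<^sub>R x + (1/2) *\<^sub>R (x * y + y * x) + y * x * y"
  proof -
    have "y + y = 2 *\<^sub>R ((1/8) *\<^sub>R x + (1/4) *\<^sub>R (x * y + y * x) + (1/2) *\<^sub>R (y * x * y))"
      unfolding eq by (simp add: scaleR_2)
    then show ?thesis by (simp add: scaleR_add_right)
  qed
  define m where "m b = (1/2) *\<^sub>R b + y * b" for b
  define B where "B \<eta> = \<eta> - ract Y \<zeta> (m (inn Y \<zeta> \<eta>))" for \<eta>
  have B_mem: "B \<eta> \<in> car Y" if "\<eta> \<in> car Y" for \<eta>
    using that \<zeta> by (simp add: B_def diff_mem ract_mem)
  have inn_B: "inn Y \<omega> (B \<eta>) = inn Y \<omega> \<eta> - inn Y \<omega> \<zeta> * m (inn Y \<zeta> \<eta>)"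
    if "\<omega> \<in> car Y" "\<eta> \<in> car Y" for \<omega> \<eta>
    using that \<zeta> by (simp add: B_def inn_diff_right ract_mem inn_ract_right)
  have self: "inn Y (B \<omega>) \<eta> = inn Y \<omega> (B \<eta>)" if "\<omega> \<in> car Y" "\<eta> \<in> car Y" for \<omega> \<eta>
  proof -
    have "inn Y (B \<omega>) \<eta> = star (inn Y \<eta> (B \<omega>))" using that by (simp add: inn_star B_mem)
    also have "\<dots> = inn Y \<omega> \<eta> - star (m (inn Y \<zeta> \<omega>)) * inn Y \<zeta> \<eta>"
      using that \<zeta> by (simp add: inn_B star_diff star_mult inn_star)
    also have "star (m (inn Y \<zeta> \<omega>)) * inn Y \<zeta> \<eta> = inn Y \<omega> \<zeta> * m (inn Y \<zeta> \<eta>)"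
      using that \<zeta> by (simp add: m_def star_add star_scaleR star_mult inn_star y distrib_left distrib_right mult.assoc)
    finally show ?thesis using that \<zeta> by (simp add: inn_B)
  qed
  have "inn Y (B \<eta>) (B \<omega>) = inn Y \<eta> \<omega> - inn Y \<eta> \<zeta> * inn Y \<zeta> \<omega>" if "\<eta> \<in> car Y" "\<omega> \<in> car Y" for \<eta> \<omega>
  proof -
    define a b where "a = inn Y \<eta> \<zeta>" and "b = inn Y \<zeta> \<omega>"
    have *: "m b + m (b - x * m b) = b"
    proof -
      have "m b + m (b - x * m b) = b + (y + y - ((1/4) *\<^sub>R x + (1/2) *\<^sub>R (x * y + y * x) + y * x * y)) * b"
        unfolding m_def
        by (simp add: scaleR_right_diff_distrib scaleR_add_right distrib_left distrib_right
            right_diff_distrib left_diff_distrib mult.assoc add.assoc[symmetric]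
            scaleR_half_double[symmetric])
          (simp add: algebra_simps scaleR_add_left[symmetric])
      then show ?thesis by (simp only: eq2[symmetric]) simp
    qed
    have "inn Y (B \<eta>) (B \<omega>) = inn Y \<eta> \<omega> - (a * m b + a * m (b - x * m b))"
      using self[of \<eta> "B \<omega>"] inn_B[of \<eta> "B \<omega>"] inn_B[of \<eta> \<omega>] inn_B[of \<zeta> \<omega>] that \<zeta> B_mem
      by (simp add: x_def a_def b_def)
    also have "\<dots> = inn Y \<eta> \<omega> - a * b" by (simp only: distrib_left[symmetric] *)
    finally show ?thesis by (simp add: a_def b_def)
  qed
  then have "dominated [\<zeta>] B B"
    unfolding dominated_def adjoint_pair_def using \<zeta> B_mem self by auto
  then show ?thesis by blast
qed

lemma dominated_scaled:
  assumes \<zeta>: "\<zeta> \<in> car Y"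
  shows "\<exists>t>0. \<exists>B. dominated [complex_of_real t *\<^sub>C \<zeta>] B B"
proof -
  define n where "n = norm (inn Y \<zeta> \<zeta>)"
  have n: "n \<ge> 0" by (simp add: n_def)
  define t where "t = 1 / (2 * (n + 1))"
  have t: "t > 0" using n by (simp add: t_def)
  have "norm (inn Y (complex_of_real t *\<^sub>C \<zeta>) (complex_of_real t *\<^sub>C \<zeta>)) = t * (t * n)"
    using \<zeta> t by (simp add: inn_scale_left inn_scale_right scale_mem norm_scaleC_of_real n_def)
  also have "t * n \<le> 1/2" using n by (simp add: t_def field_simps)
  then have "t * (t * n) \<le> 1/2 * (1/2)" using n t by (intro mult_mono) (auto simp: t_def field_simps)
  finally show ?thesis using dominated_singleton[OF scale_mem[OF \<zeta>]] t by auto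
qed

text \<open>
  The sum telescopes: \<open>\<Sum>\<^sub>k B\<^sup>k(1 - B\<^sup>2)B\<^sup>k = 1 - B\<^sup>2\<^sup>n\<close>.
\<close>

lemma dominated_powers:
  assumes B: "dominated [\<zeta>] B B"
  shows "dominated (map (\<lambda>k. (B ^^ k) \<zeta>) [0..<n]) (B ^^ n) (B ^^ n)"
proof (induction n)
  case (Suc n)
  then show ?case
    using dominated_compose[OF Suc B] by (simp add: funpow_Suc_right o_assoc) (simp add: funpow_swap1 o_def)
qed (simp add: dominated_Nil[unfolded id_def] id_def)

lemma dominated_bessel:
  assumes \<sigma>: "positive_functional \<sigma>" and L: "dominated L S S'" and \<omega>: "\<omega> \<in> car Y"
  shows "(\<Sum>\<xi>\<leftarrow>L. sqcoeff \<sigma> \<omega> \<xi>) = sqnorm \<sigma> \<omega> - sqnorm \<sigma> (S \<omega>)"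
    and "0 \<le> sqnorm \<sigma> (S \<omega>)"
proof -
  note sum = positive_functional_sum_list[OF \<sigma>]
  show "(\<Sum>\<xi>\<leftarrow>L. sqcoeff \<sigma> \<omega> \<xi>) = sqnorm \<sigma> \<omega> - sqnorm \<sigma> (S \<omega>)"
    unfolding dominatedD(5)[OF L \<omega> \<omega>] positive_functionalD[OF \<sigma>] by (simp add: sum)
  show "0 \<le> sqnorm \<sigma> (S \<omega>)"
    by (rule positive_functionalD[OF \<sigma>], rule inn_pos, rule dominatedD[OF L], rule \<omega>)
qed

lemma inn_mult_swap_pos:
  assumes "\<xi> \<in> car Y" "\<omega> \<in> car Y"
  shows "inn Y \<omega> \<xi> * inn Y \<xi> \<omega> \<in> positive_elements"
  using star_mult_self_positive[of "inn Y \<xi> \<omega>"] assms by (simp add: inn_star)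

lemma dominated_contraction:
  assumes \<sigma>: "positive_functional \<sigma>" and L: "dominated L S S'" and \<omega>: "\<omega> \<in> car Y"
  shows "sqnorm \<sigma> (S \<omega>) \<le> sqnorm \<sigma> \<omega>"
proof -
  have "0 \<le> (\<Sum>\<xi>\<leftarrow>L. sqcoeff \<sigma> \<omega> \<xi>)"
    by (rule sum_list_nonneg)
      (use inn_mult_swap_pos \<omega> dominatedD(1)[OF L] positive_functionalD(7)[OF \<sigma>] in auto)
  then show ?thesis using dominated_bessel(1)[OF \<sigma> L \<omega>] by simp
qed

text \<open>
  A small multiple of \<open>\<theta>\<^sub>\<zeta>\<^sub>,\<^sub>\<zeta>\<close> is at most the identity.
\<close>

lemma coefficient_bounded:
  assumes \<sigma>: "positive_functional \<sigma>" and \<zeta>: "\<zeta> \<in> car Y"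
  shows "\<exists>C\<ge>0. \<forall>d\<in>car Y. sqcoeff \<sigma> d \<zeta> \<le> C * sqnorm \<sigma> d"
proof -
  obtain t B where t: "t > 0" and B: "dominated [complex_of_real t *\<^sub>C \<zeta>] B B"
    using dominated_scaled[OF \<zeta>] by blast
  have "sqcoeff \<sigma> d \<zeta> \<le> (1 / t\<^sup>2) * sqnorm \<sigma> d" if d: "d \<in> car Y" for d
  proof -
    have "t\<^sup>2 * sqcoeff \<sigma> d \<zeta> \<le> sqnorm \<sigma> d"
      using dominated_bessel[OF \<sigma> B d] d \<zeta>
      by (simp add: inn_scale_left inn_scale_right scaleC_mult_left scaleC_mult_right
          positive_functionalD[OF \<sigma>] power2_eq_square)
    then show ?thesis using t by (simp add: field_simps)
  qed
  then show ?thesis using t by (intro exI[of _ "1 / t\<^sup>2"]) auto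
qed

text \<open>
  Let \<open>B\<^sup>2 = 1 - t\<^sup>2\<theta>\<^sub>\<zeta>\<^sub>,\<^sub>\<zeta>\<close>. The families of \<open>dominated_powers\<close> are dominated by the identity for all \<open>n\<close>, so
  the numbers \<open>\<sigma>(|\<langle>\<zeta>,B\<^sup>k\<zeta>\<rangle>|\<^sup>2)\<close> are summable and tend to zero. This forces \<open>\<sigma>\<langle>\<zeta>,B\<^sup>2\<^sup>n\<zeta>\<rangle> \<rightarrow> 0\<close>: replace \<open>\<zeta>\<close> on the
  right by \<open>\<zeta>v\<close> with \<open>v\<close> in the algebra and apply the Cauchy-Schwarz inequality of \<open>\<sigma>\<close>.
\<close>

lemma dominated_approximates_vector:
  assumes \<sigma>: "positive_functional \<sigma>" and \<zeta>: "\<zeta> \<in> car Y" and e: "0 < e"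
  shows "\<exists>L S S'. dominated L S S' \<and> sqnorm \<sigma> (S \<zeta>) < e"
proof -
  interpret sY: semi_inner "car Y" "\<lambda>\<xi> \<eta>. \<sigma> (inn Y \<xi> \<eta>)" by (rule semi_inner_functional[OF \<sigma>])
  interpret sA: semi_inner UNIV "\<lambda>a b. \<sigma> (star a * b)" by (rule positive_functional_semi_inner[OF \<sigma>])
  obtain t B where t: "t > 0" and B: "dominated [complex_of_real t *\<^sub>C \<zeta>] B B"
    using dominated_scaled[OF \<zeta>] by blast
  note BD = dominatedD[OF dominated_powers[OF B]]
  define x where "x = inn Y \<zeta> \<zeta>"
  obtain C where C: "\<And>h. star h = h \<Longrightarrow> Re (\<sigma> h) \<le> C * norm h"
    using \<sigma> unfolding positive_functional_def by blast
  define M where "M = sY.nrm \<zeta>"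
  have M: "M \<ge> 0" using sY.nrm_nonneg \<zeta> by (simp add: M_def)
  define r where "r = (e / (2 * (M + 1)))\<^sup>2 / (\<bar>C\<bar> + 1)"
  have r: "r > 0" using e M by (simp add: r_def add_nonneg_pos)
  have "star x = x" using \<zeta> by (simp add: x_def inn_star)
  then obtain v where v: "norm (x - x * v - star v * x + star v * x * v) < r"
    using cstar_approximate_right_unit r by blast
  \<comment> \<open>The part of \<open>\<zeta>\<close> that \<open>\<zeta>v\<close> misses, small in the seminorm of \<open>\<sigma>\<close>.\<close>
  define d where "d = \<zeta> - ract Y \<zeta> v"
  have d: "d \<in> car Y" using \<zeta> by (simp add: d_def diff_mem ract_mem)
  have dd: "inn Y d d = x - x * v - star v * x + star v * x * v"
    using \<zeta> by (simp add: d_def inn_diff_left inn_diff_right ract_mem diff_mem inn_ract_left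
        inn_ract_right x_def algebra_simps)
  have d_small: "M * sY.nrm d \<le> e / 2"
  proof -
    have "sqnorm \<sigma> d \<le> C * norm (inn Y d d)" by (rule C) (simp add: inn_star d)
    also have "\<dots> \<le> (\<bar>C\<bar> + 1) * r" unfolding dd using v by (intro mult_mono) auto
    also have "\<dots> = (e / (2 * (M + 1)))\<^sup>2" by (simp add: r_def)
    finally have "(sY.nrm d)\<^sup>2 \<le> (e / (2 * (M + 1)))\<^sup>2" by (simp add: sY.nrm_power2 d)
    then have "sY.nrm d \<le> e / (2 * (M + 1))"
      by (rule power2_le_imp_le) (use e M in simp)
    then have "M * sY.nrm d \<le> M * (e / (2 * (M + 1)))" using M by (intro mult_left_mono) auto
    also have "\<dots> \<le> e / 2" using M e by (simp add: field_simps)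
    finally show ?thesis .
  qed
  define g where "g k = inn Y ((B ^^ k) \<zeta>) \<zeta>" for k
  have g_star: "star (g k) = inn Y \<zeta> ((B ^^ k) \<zeta>)" for k using \<zeta> BD by (simp add: g_def inn_star)
  define q where "q k = Re (\<sigma> (g k * star (g k)))" for k
  have q_nonneg: "q k \<ge> 0" for k
    using star_mult_self_positive[of "star (g k)"] positive_functionalD[OF \<sigma>] by (simp add: q_def star_star)
  have q_bound: "(\<Sum>k<n. q k) \<le> Re (\<sigma> x) / t\<^sup>2" for n
  proof -
    have coeff: "sqcoeff \<sigma> \<zeta> ((B ^^ k) (complex_of_real t *\<^sub>C \<zeta>)) = t\<^sup>2 * q k" for k
    proof -
      have 1: "inn Y \<zeta> ((B ^^ k) (complex_of_real t *\<^sub>C \<zeta>)) = complex_of_real t *\<^sub>C g k"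
        using BD(4)[of \<zeta> "complex_of_real t *\<^sub>C \<zeta>" k] \<zeta> BD by (simp add: scale_mem inn_scale_right g_def)
      have 2: "inn Y ((B ^^ k) (complex_of_real t *\<^sub>C \<zeta>)) \<zeta> = complex_of_real t *\<^sub>C star (g k)"
        using BD(4)[of "complex_of_real t *\<^sub>C \<zeta>" \<zeta> k] \<zeta> BD by (simp add: scale_mem inn_scale_left g_star)
      show ?thesis unfolding 1 2
        by (simp add: scaleC_mult_left scaleC_mult_right positive_functionalD[OF \<sigma>] q_def power2_eq_square)
    qed
    have "t\<^sup>2 * (\<Sum>k<n. q k) = (\<Sum>k<n. t\<^sup>2 * q k)" by (simp add: sum_distrib_left)
    also have "\<dots> \<le> Re (\<sigma> x)"
      using dominated_bessel[OF \<sigma> dominated_powers[OF B, of n] \<zeta>]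
      by (simp add: o_def coeff sum_list_sum_nth atLeast0LessThan x_def)
    finally show ?thesis using t by (simp add: field_simps)
  qed
  have "summable q" by (rule summableI_nonneg_bounded[OF q_nonneg q_bound])
  then have "q \<longlonglongrightarrow> 0" by (rule summable_LIMSEQ_zero)
  moreover define w where "w = sA.nrm v"
  have w: "w \<ge> 0" using sA.nrm_nonneg by (simp add: w_def)
  define \<delta> where "\<delta> = (e / (2 * (w + 1)))\<^sup>2"
  have \<delta>: "\<delta> > 0" using e w by (simp add: \<delta>_def add_nonneg_pos)
  ultimately obtain N where N: "\<And>n. n \<ge> N \<Longrightarrow> q n < \<delta>"
    using order_tendstoD(2)[of q 0 sequentially \<delta>] by (auto simp: eventually_sequentially)
  \<comment> \<open>An even exponent, so that \<open>\<langle>B\<^sup>k\<zeta>,\<zeta>\<rangle> = \<langle>B\<^sup>N\<zeta>,B\<^sup>N\<zeta>\<rangle>\<close>.\<close>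
  define k where "k = N + N"
  have qk: "q k < \<delta>" using N[of k] by (simp add: k_def)
  let ?S = "B ^^ N"
  have "inn Y (?S \<zeta>) (?S \<zeta>) = inn Y ((B ^^ k) \<zeta>) \<zeta>"
  proof -
    have "inn Y ((B ^^ k) \<zeta>) \<zeta> = inn Y (?S (?S \<zeta>)) \<zeta>" by (simp add: k_def funpow_add)
    also have "\<dots> = inn Y (?S \<zeta>) (?S \<zeta>)" using BD \<zeta> by blast
    finally show ?thesis by simp
  qed
  also have "\<dots> = inn Y ((B ^^ k) \<zeta>) d + g k * v"
  proof -
    have "inn Y ((B ^^ k) \<zeta>) d = g k - g k * v"
      using \<zeta> BD by (simp add: d_def inn_diff_right ract_mem inn_ract_right g_def)
    then show ?thesis by (simp add: g_def)
  qed
  finally have "sqnorm \<sigma> (?S \<zeta>) \<le> cmod (\<sigma> (inn Y ((B ^^ k) \<zeta>) d)) + cmod (\<sigma> (g k * v))"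
    by (simp add: positive_functionalD[OF \<sigma>] add_mono complex_Re_le_cmod)
  also have "cmod (\<sigma> (inn Y ((B ^^ k) \<zeta>) d)) \<le> sY.nrm ((B ^^ k) \<zeta>) * sY.nrm d"
    by (rule sY.Cauchy_Schwarz) (use BD \<zeta> d in auto)
  also have "\<dots> \<le> M * sY.nrm d"
  proof (rule mult_right_mono)
    have "sqnorm \<sigma> ((B ^^ k) \<zeta>) \<le> sqnorm \<sigma> \<zeta>"
      by (rule dominated_contraction[OF \<sigma> dominated_powers[OF B] \<zeta>])
    then show "sY.nrm ((B ^^ k) \<zeta>) \<le> M" by (simp add: M_def sY.nrm_def)
  qed (rule sY.nrm_nonneg[OF d])
  also note d_small
  also have "cmod (\<sigma> (g k * v)) \<le> sA.nrm (star (g k)) * sA.nrm v"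
    using sA.Cauchy_Schwarz[of "star (g k)" v] by (simp add: star_star)
  also have "sA.nrm (star (g k)) = sqrt (q k)" by (simp add: sA.nrm_def q_def star_star)
  also have "sqrt (q k) * sA.nrm v < e / 2"
  proof -
    have "sqrt (q k) < sqrt \<delta>" using qk by simp
    then have "sqrt (q k) < e / (2 * (w + 1))" using e w by (simp add: \<delta>_def)
    then have "sqrt (q k) * w \<le> (e / (2 * (w + 1))) * w" using w by (intro mult_right_mono) auto
    also have "\<dots> < e / 2" using w e by (simp add: field_simps)
    finally show ?thesis by (simp add: w_def)
  qed
  finally have "sqnorm \<sigma> (?S \<zeta>) < e" by simp
  then show ?thesis using dominated_powers[OF B] by blast
qed

text \<open>
  The vectors are treated one after the other; the operators \<open>S\<close> found later contract the seminorm
  of \<open>\<sigma>\<close>, so the earlier estimates persist.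
\<close>

lemma dominated_approximates:
  assumes e: "0 < e"
    and ps: "\<And>\<sigma> \<zeta>. (\<sigma>, \<zeta>) \<in> set ps \<Longrightarrow> positive_functional \<sigma> \<and> \<zeta> \<in> car Y"
  shows "\<exists>L S S'. dominated L S S' \<and> (\<forall>(\<sigma>, \<zeta>)\<in>set ps. sqnorm \<sigma> (S \<zeta>) < e)"
  using ps
proof (induction ps)
  case Nil
  then show ?case using dominated_Nil by auto
next
  case (Cons p ps)
  obtain \<sigma> \<zeta> where p: "p = (\<sigma>, \<zeta>)" by fastforce
  obtain L S S' where L: "dominated L S S'" and small: "\<And>\<sigma> \<zeta>. (\<sigma>, \<zeta>) \<in> set ps \<Longrightarrow> sqnorm \<sigma> (S \<zeta>) < e"
    using Cons by fastforce
  have \<sigma>: "positive_functional \<sigma>" and \<zeta>: "\<zeta> \<in> car Y" using Cons.prems p by auto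
  obtain M T T' where M: "dominated M T T'" and T: "sqnorm \<sigma> (T (S \<zeta>)) < e"
    using dominated_approximates_vector[OF \<sigma> _ e] dominatedD[OF L] \<zeta> by blast
  have "sqnorm \<sigma>' (T (S \<zeta>')) < e" if m: "(\<sigma>', \<zeta>') \<in> set ps" for \<sigma>' \<zeta>'
  proof -
    have \<sigma>': "positive_functional \<sigma>'" and \<zeta>': "\<zeta>' \<in> car Y" using Cons.prems m by auto
    have S\<zeta>: "S \<zeta>' \<in> car Y" using dominatedD[OF L] \<zeta>' by auto
    show ?thesis using dominated_contraction[OF \<sigma>' M S\<zeta>] small[OF m] by simp
  qed
  then show ?case using dominated_compose[OF L M] T p by (intro exI) (auto simp: o_def)
qed

end

section \<open>Induced traces\<close>

text \<open>
  A vector listed twice may be replaced by its multiple with the factor \<open>\<surd>2\<close>, which preserves the sums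
  of all quadratic expressions. So families given by lists and by sets have the same suprema.
\<close>

lemma distinct_rescaling:
  fixes L :: "'x::complex_vector list"
  assumes "set L \<subseteq> V" and V: "\<And>c v. v \<in> V \<Longrightarrow> c *\<^sub>C v \<in> V"
  shows "\<exists>M. distinct M \<and> set M \<subseteq> V \<and>
    (\<forall>q::'x \<Rightarrow> 'c::comm_monoid_add. (\<forall>v\<in>V. q (complex_of_real (sqrt 2) *\<^sub>C v) = q v + q v) \<longrightarrow> sum_list (map q M) = sum_list (map q L)) \<and>
    (\<forall>q::'x \<Rightarrow> 'd::comm_monoid_add. (\<forall>v\<in>V. q (complex_of_real (sqrt 2) *\<^sub>C v) = q v + q v) \<longrightarrow> sum_list (map q M) = sum_list (map q L))"
  using assms(1)
proof (induction "length L" arbitrary: L rule: less_induct)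
  case less
  show ?case
  proof (cases "distinct L")
    case True
    then show ?thesis using less.prems by (intro exI[of _ L]) simp
  next
    case False
    then obtain xs ys zs v where L: "L = xs @ [v] @ ys @ [v] @ zs" using not_distinct_decomp by blast
    let ?L = "(complex_of_real (sqrt 2) *\<^sub>C v) # xs @ ys @ zs"
    have v: "v \<in> V" and "set ?L \<subseteq> V" "length ?L < length L" using less.prems L V by auto
    then obtain M where M: "distinct M" "set M \<subseteq> V"
      "\<And>q::'x \<Rightarrow> 'c. (\<forall>v\<in>V. q (complex_of_real (sqrt 2) *\<^sub>C v) = q v + q v) \<Longrightarrow> sum_list (map q M) = sum_list (map q ?L)"
      "\<And>q::'x \<Rightarrow> 'd. (\<forall>v\<in>V. q (complex_of_real (sqrt 2) *\<^sub>C v) = q v + q v) \<Longrightarrow> sum_list (map q M) = sum_list (map q ?L)"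
      using less.hyps[of ?L] by (auto simp only:)
    show ?thesis by (rule exI[of _ M]) (use M v in \<open>auto simp: L ac_simps\<close>)
  qed
qed

lemma sum_list_swap:
  fixes f :: "'b \<Rightarrow> 'c \<Rightarrow> 'd::comm_monoid_add"
  shows "(\<Sum>x\<leftarrow>xs. \<Sum>y\<leftarrow>ys. f x y) = (\<Sum>y\<leftarrow>ys. \<Sum>x\<leftarrow>xs. f x y)"
  by (induction xs) (simp_all add: sum_list_addf)

lemma sum_list_ennreal:
  "(\<And>x. x \<in> set xs \<Longrightarrow> 0 \<le> f x) \<Longrightarrow> (\<Sum>x\<leftarrow>xs. ennreal (f x)) = ennreal (\<Sum>x\<leftarrow>xs. f x)"
proof (induction xs)
  case (Cons a xs)
  have "0 \<le> f a" "0 \<le> (\<Sum>x\<leftarrow>xs. f x)" using Cons.prems by (auto intro!: sum_list_nonneg)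
  then show ?case using Cons by (simp add: ennreal_plus)
qed simp

locale corresp =
  fixes Y :: "('x::complex_vector, 'a::cstar_algebra) corr"
  assumes corr: "correspondence Y"
begin

sublocale hmod Y using corr by unfold_locales (simp add: correspondence_def)

lemma lact_mem: "\<xi> \<in> car Y \<Longrightarrow> lact Y a \<xi> \<in> car Y"
  and inn_lact: "\<xi> \<in> car Y \<Longrightarrow> \<eta> \<in> car Y \<Longrightarrow> inn Y (lact Y a \<xi>) \<eta> = inn Y \<xi> (lact Y (star a) \<eta>)"
  and lact_mult: "\<xi> \<in> car Y \<Longrightarrow> lact Y (a * b) \<xi> = lact Y a (lact Y b \<xi>)"
  and lact_add: "\<xi> \<in> car Y \<Longrightarrow> lact Y (a + b) \<xi> = lact Y a \<xi> + lact Y b \<xi>"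
  and lact_scale: "\<xi> \<in> car Y \<Longrightarrow> lact Y (c *\<^sub>C a) \<xi> = c *\<^sub>C lact Y a \<xi>"
  using corr unfolding correspondence_def adjoint_pair_def by auto

lemma inn_lact_square:
  "\<xi> \<in> car Y \<Longrightarrow> inn Y \<xi> (lact Y (star b * b) \<xi>) = inn Y (lact Y b \<xi>) (lact Y b \<xi>)"
  by (simp add: inn_lact lact_mem lact_mult)

lemma lact_scale_vector:
  assumes "\<xi> \<in> car Y" shows "lact Y a (c *\<^sub>C \<xi>) = c *\<^sub>C lact Y a \<xi>"
proof (rule inn_eqI)
  fix \<omega> assume \<omega>: "\<omega> \<in> car Y"
  have "inn Y \<omega> (lact Y a \<eta>) = inn Y (lact Y (star a) \<omega>) \<eta>" if "\<eta> \<in> car Y" for \<eta>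
    using that \<omega> by (simp add: inn_lact star_star)
  then show "inn Y \<omega> (lact Y a (c *\<^sub>C \<xi>)) = inn Y \<omega> (c *\<^sub>C lact Y a \<xi>)"
    using assms \<omega> by (simp add: scale_mem inn_scale_right lact_mem)
qed (use assms in \<open>simp_all add: lact_mem scale_mem\<close>)

text \<open>
  The induced trace at \<open>b\<^sup>*b\<close>, with lists in place of sets, since concatenations and images of
  lists make sense without regard to coincidences among the vectors.
\<close>

definition ltrace :: "('a \<Rightarrow> complex) \<Rightarrow> 'a \<Rightarrow> ennreal" where
  "ltrace \<tau> b = (SUP L\<in>{L. \<exists>S S'. dominated L S S'}.
      \<Sum>\<xi>\<leftarrow>L. ennreal (sqnorm \<tau> (lact Y b \<xi>)))"

lemma dominated_le_ltrace:
  assumes "dominated L S S'"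
  shows "(\<Sum>\<xi>\<leftarrow>L. ennreal (sqnorm \<tau> (lact Y b \<xi>))) \<le> ltrace \<tau> b"
  unfolding ltrace_def by (rule SUP_upper) (use assms in auto)

lemma theta_sum_inn:
  assumes "set L \<subseteq> car Y" "\<eta> \<in> car Y" "\<omega> \<in> car Y"
  shows "(\<Sum>\<xi>\<leftarrow>L. theta Y \<xi> \<xi> \<eta>) \<in> car Y"
    and "inn Y \<omega> (\<Sum>\<xi>\<leftarrow>L. theta Y \<xi> \<xi> \<eta>) = (\<Sum>\<xi>\<leftarrow>L. inn Y \<omega> \<xi> * inn Y \<xi> \<eta>)"
proof -
  show *: "(\<Sum>\<xi>\<leftarrow>L. theta Y \<xi> \<xi> \<eta>) \<in> car Y"
    by (rule sum_list_mem) (use assms in \<open>auto simp: theta_def ract_mem\<close>)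
  show "inn Y \<omega> (\<Sum>\<xi>\<leftarrow>L. theta Y \<xi> \<xi> \<eta>) = (\<Sum>\<xi>\<leftarrow>L. inn Y \<omega> \<xi> * inn Y \<xi> \<eta>)"
    using assms by (subst inn_sum_list_right)
      (auto simp: theta_def ract_mem inn_ract_right o_def intro!: arg_cong[where f=sum_list] map_cong)
qed

lemma dominated_iff_positive_operator:
  assumes L: "set L \<subseteq> car Y"
  shows "(\<exists>S S'. dominated L S S') \<longleftrightarrow> (\<lambda>\<eta>. \<eta> - (\<Sum>\<xi>\<leftarrow>L. theta Y \<xi> \<xi> \<eta>)) \<in> positive_operators Y"
    (is "_ \<longleftrightarrow> ?T \<in> _")
proof -
  have T_mem: "?T \<eta> \<in> car Y" if "\<eta> \<in> car Y" for \<eta>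
    using theta_sum_inn[OF L that that] that by (simp add: diff_mem)
  have inn_T: "inn Y \<omega> (?T \<eta>) = inn Y \<omega> \<eta> - (\<Sum>\<xi>\<leftarrow>L. inn Y \<omega> \<xi> * inn Y \<xi> \<eta>)" if "\<eta> \<in> car Y" "\<omega> \<in> car Y" for \<eta> \<omega>
    using theta_sum_inn[OF L that] that by (simp add: inn_diff_right)
  have star_sum: "star (\<Sum>\<xi>\<leftarrow>M. f \<xi>) = (\<Sum>\<xi>\<leftarrow>M. star (f \<xi>))" for M and f :: "'x \<Rightarrow> 'a"
    by (induction M) (simp_all add: star_add)
  have "inn Y (?T \<omega>) \<eta> = inn Y \<omega> (?T \<eta>)" if "\<eta> \<in> car Y" "\<omega> \<in> car Y" for \<eta> \<omega>
  proof -
    have "inn Y (?T \<omega>) \<eta> = star (inn Y \<eta> (?T \<omega>))" using that T_mem by (simp add: inn_star)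
    also have "\<dots> = inn Y \<omega> \<eta> - (\<Sum>\<xi>\<leftarrow>L. star (inn Y \<eta> \<xi> * inn Y \<xi> \<omega>))"
      using that by (simp add: inn_T star_diff star_sum inn_star)
    also have "(\<Sum>\<xi>\<leftarrow>L. star (inn Y \<eta> \<xi> * inn Y \<xi> \<omega>)) = (\<Sum>\<xi>\<leftarrow>L. inn Y \<omega> \<xi> * inn Y \<xi> \<eta>)"
      by (rule arg_cong[where f=sum_list], rule map_cong) (use that L in \<open>auto simp: star_mult inn_star\<close>)
    finally show ?thesis using that by (simp add: inn_T)
  qed
  then have "adjoint_pair Y ?T ?T"
    unfolding adjoint_pair_def using T_mem by (intro conjI ballI funcsetI)
  then have adj: "?T \<in> adjointables Y"
    unfolding adjointables_def by (intro CollectI exI)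
  have iff: "dominated L S S' \<longleftrightarrow> adjoint_pair Y S S' \<and> (\<forall>\<eta>\<in>car Y. ?T \<eta> = S' (S \<eta>))" for S S'
  proof (cases "adjoint_pair Y S S'")
    case True
    then have S: "\<And>\<eta>. \<eta> \<in> car Y \<Longrightarrow> S \<eta> \<in> car Y" "\<And>\<eta>. \<eta> \<in> car Y \<Longrightarrow> S' \<eta> \<in> car Y"
      "\<And>\<eta> \<omega>. \<eta> \<in> car Y \<Longrightarrow> \<omega> \<in> car Y \<Longrightarrow> inn Y (S \<eta>) \<omega> = inn Y \<eta> (S' \<omega>)"
      unfolding adjoint_pair_def by auto
    have "?T \<omega> = S' (S \<omega>)" if d: "dominated L S S'" and \<omega>: "\<omega> \<in> car Y" for \<omega>
    proof (rule inn_eqI)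
      show "inn Y \<eta> (?T \<omega>) = inn Y \<eta> (S' (S \<omega>))" if "\<eta> \<in> car Y" for \<eta>
        using dominatedD(5)[OF d that \<omega>] S(3)[OF that S(1)[OF \<omega>]] inn_T[OF \<omega> that] by simp
    qed (use T_mem \<omega> S in auto)
    moreover have "dominated L S S'" if eq: "\<forall>\<eta>\<in>car Y. ?T \<eta> = S' (S \<eta>)"
      unfolding dominated_def
    proof (intro conjI ballI)
      fix \<eta> \<omega> assume \<eta>: "\<eta> \<in> car Y" and \<omega>: "\<omega> \<in> car Y"
      show "inn Y (S \<eta>) (S \<omega>) = inn Y \<eta> \<omega> - (\<Sum>\<xi>\<leftarrow>L. inn Y \<eta> \<xi> * inn Y \<xi> \<omega>)"
        using S(3)[OF \<eta> S(1)[OF \<omega>]] inn_T[OF \<omega> \<eta>] eq \<omega> by simp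
    qed (use L True in auto)
    ultimately show ?thesis using True by blast
  qed (simp add: dominated_def)
  show ?thesis unfolding iff positive_operators_def using adj by simp
qed

lemma induced_trace_eq_ltrace:
  assumes \<tau>: "positive_functional \<tau>"
  shows "induced_trace Y \<tau> (lact Y (star b * b)) = ltrace \<tau> b"
proof (rule antisym)
  define q where "q \<xi> = Re (\<tau> (inn Y \<xi> (lact Y (star b * b) \<xi>)))" for \<xi>
  have q: "q \<xi> = sqnorm \<tau> (lact Y b \<xi>)" if "\<xi> \<in> car Y" for \<xi>
    using that by (simp add: q_def inn_lact_square)
  have qL: "(\<Sum>\<xi>\<leftarrow>L. ennreal (q \<xi>)) = (\<Sum>\<xi>\<leftarrow>L. ennreal (sqnorm \<tau> (lact Y b \<xi>)))"
    if "set L \<subseteq> car Y" for L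
    by (rule arg_cong[where f=sum_list], rule map_cong) (use that q in auto)
  show "induced_trace Y \<tau> (lact Y (star b * b)) \<le> ltrace \<tau> b"
    unfolding induced_trace_def
  proof (rule SUP_least)
    fix H assume H: "H \<in> {H. finite H \<and> H \<subseteq> car Y \<and> (\<lambda>\<eta>. \<eta> - (\<Sum>\<xi>\<in>H. theta Y \<xi> \<xi> \<eta>)) \<in> positive_operators Y}"
    then obtain L where L: "set L = H" "distinct L" using finite_distinct_list by blast
    have "(\<lambda>\<eta>. \<eta> - (\<Sum>\<xi>\<leftarrow>L. theta Y \<xi> \<xi> \<eta>)) \<in> positive_operators Y"
      using H L by (simp add: sum_list_distinct_conv_sum_set)
    then obtain S S' where "dominated L S S'" using dominated_iff_positive_operator[of L] H L by auto
    then have "(\<Sum>\<xi>\<leftarrow>L. ennreal (q \<xi>)) \<le> ltrace \<tau> b"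
      using dominated_le_ltrace qL H L by auto
    then show "(\<Sum>\<xi>\<in>H. ennreal (Re (\<tau> (inn Y \<xi> (lact Y (star b * b) \<xi>))))) \<le> ltrace \<tau> b"
      using L by (simp add: sum_list_distinct_conv_sum_set q_def)
  qed
  show "ltrace \<tau> b \<le> induced_trace Y \<tau> (lact Y (star b * b))"
    unfolding ltrace_def
  proof (rule SUP_least)
    fix L assume "L \<in> {L. \<exists>S S'. dominated L S S'}"
    then obtain S S' where d: "dominated L S S'" by blast
    have L: "set L \<subseteq> car Y" using dominatedD[OF d] by simp
    obtain M where M: "distinct M" "set M \<subseteq> car Y"
      and sa: "\<And>q::'x \<Rightarrow> 'a. (\<forall>v\<in>car Y. q (complex_of_real (sqrt 2) *\<^sub>C v) = q v + q v) \<Longrightarrow> sum_list (map q M) = sum_list (map q L)"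
      and se: "\<And>q::'x \<Rightarrow> ennreal. (\<forall>v\<in>car Y. q (complex_of_real (sqrt 2) *\<^sub>C v) = q v + q v) \<Longrightarrow> sum_list (map q M) = sum_list (map q L)"
      using distinct_rescaling[OF L scale_mem] by blast
    have two: "complex_of_real (sqrt 2) * complex_of_real (sqrt 2) = 2"
      by (simp flip: of_real_mult)
    have double: "2 *\<^sub>C w = w + w" for w :: 'a
      using scaleC_add_left[of 1 1 w] by (simp add: scaleC_one)
    have "(\<Sum>\<xi>\<leftarrow>M. inn Y \<eta> \<xi> * inn Y \<xi> \<omega>) = (\<Sum>\<xi>\<leftarrow>L. inn Y \<eta> \<xi> * inn Y \<xi> \<omega>)"
      if "\<eta> \<in> car Y" "\<omega> \<in> car Y" for \<eta> \<omega>
      by (rule sa) (use that in \<open>simp add: inn_scale_left inn_scale_right scaleC_mult_left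
          scaleC_mult_right scaleC_scaleC two double\<close>)
    then have "dominated M S S'" using d M unfolding dominated_def by auto
    then have "(\<lambda>\<eta>. \<eta> - (\<Sum>\<xi>\<in>set M. theta Y \<xi> \<xi> \<eta>)) \<in> positive_operators Y"
      using dominated_iff_positive_operator[OF M(2)] M by (auto simp: sum_list_distinct_conv_sum_set)
    moreover have "(\<Sum>\<xi>\<leftarrow>M. ennreal (q \<xi>)) = (\<Sum>\<xi>\<leftarrow>L. ennreal (q \<xi>))"
    proof (rule se, rule ballI)
      fix v assume v: "v \<in> car Y"
      have "q (complex_of_real (sqrt 2) *\<^sub>C v) = q v + q v"
        using v by (simp add: q_def lact_scale_vector inn_scale_left inn_scale_right lact_mem scale_mem
            scaleC_scaleC two positive_functionalD[OF \<tau>])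
      moreover have "0 \<le> q v" using v positive_functionalD[OF \<tau>] by (simp add: q inn_pos lact_mem)
      ultimately show "ennreal (q (complex_of_real (sqrt 2) *\<^sub>C v)) = ennreal (q v) + ennreal (q v)"
        by (metis ennreal_plus)
    qed
    moreover have "(\<Sum>\<xi>\<leftarrow>M. ennreal (q \<xi>)) = (\<Sum>\<xi>\<in>set M. ennreal (Re (\<tau> (inn Y \<xi> (lact Y (star b * b) \<xi>)))))"
      using M(1) by (simp add: sum_list_distinct_conv_sum_set q_def)
    ultimately have "(\<Sum>\<xi>\<leftarrow>L. ennreal (q \<xi>)) \<le> induced_trace Y \<tau> (lact Y (star b * b))"
      unfolding induced_trace_def by (intro SUP_upper2[of "set M"]) (simp_all add: M(2))
    then show "(\<Sum>\<xi>\<leftarrow>L. ennreal (sqnorm \<tau> (lact Y b \<xi>))) \<le> induced_trace Y \<tau> (lact Y (star b * b))"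
      using qL[OF L] by simp
  qed
qed

definition bessel :: "('a \<Rightarrow> complex) \<Rightarrow> 'x list \<Rightarrow> bool" where
  "bessel \<tau> L \<longleftrightarrow> set L \<subseteq> car Y \<and>
     (\<forall>\<omega>\<in>car Y. (\<Sum>\<xi>\<leftarrow>L. sqcoeff \<tau> \<omega> \<xi>) \<le> sqnorm \<tau> \<omega>)"

lemma dominated_imp_bessel:
  assumes "positive_functional \<tau>" "dominated L S S'" shows "bessel \<tau> L"
  using dominated_bessel[OF assms] dominatedD(1)[OF assms(2)] unfolding bessel_def by fastforce

lemma inn_self_nonneg:
  "positive_functional \<tau> \<Longrightarrow> \<omega> \<in> car Y \<Longrightarrow> 0 \<le> sqnorm \<tau> \<omega>"
  by (simp add: positive_functionalD inn_pos)

text \<open>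
  If \<open>K\<close> is nearly an orthonormal basis for the vectors \<open>b\<xi>\<close>, expand \<open>\<langle>b\<xi>,b\<xi>\<rangle>\<close> along \<open>K\<close> and exchange the
  factors under the trace: \<open>\<tau>(\<langle>b\<xi>,\<kappa>\<rangle>\<langle>\<kappa>,b\<xi>\<rangle>) = \<tau>(\<langle>b\<^sup>*\<kappa>,\<xi>\<rangle>\<langle>\<xi>,b\<^sup>*\<kappa>\<rangle>)\<close>. The sum over \<open>\<xi>\<close> is then bounded by the
  Bessel inequality of \<open>L\<close>.
\<close>

lemma trace_comparison:
  assumes \<tau>: "tracial_state \<tau>" and L: "bessel \<tau> L" and K: "set K \<subseteq> car Y"
    and close: "\<And>\<xi>. \<xi> \<in> set L \<Longrightarrow> sqnorm \<tau> (lact Y b \<xi>)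
      \<le> (\<Sum>\<kappa>\<leftarrow>K. sqcoeff \<tau> (lact Y b \<xi>) \<kappa>) + e"
  shows "(\<Sum>\<xi>\<leftarrow>L. sqnorm \<tau> (lact Y b \<xi>))
    \<le> (\<Sum>\<kappa>\<leftarrow>K. sqnorm \<tau> (lact Y (star b) \<kappa>)) + real (length L) * e"
proof -
  have Lc: "set L \<subseteq> car Y" using L by (simp add: bessel_def)
  have swap: "sqcoeff \<tau> (lact Y b \<xi>) \<eta>
    = sqcoeff \<tau> (lact Y (star b) \<eta>) \<xi>"
    if "\<xi> \<in> set L" "\<eta> \<in> set K" for \<xi> \<eta>
    using that Lc K tracial_state_commute[OF \<tau>, of "inn Y (lact Y b \<xi>) \<eta>"]
    by (simp add: inn_lact lact_mem star_star subset_iff)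
  have "(\<Sum>\<xi>\<leftarrow>L. sqnorm \<tau> (lact Y b \<xi>))
    \<le> (\<Sum>\<xi>\<leftarrow>L. (\<Sum>\<eta>\<leftarrow>K. sqcoeff \<tau> (lact Y b \<xi>) \<eta>) + e)"
    by (rule sum_list_mono) (rule close)
  also have "\<dots> = (\<Sum>\<xi>\<leftarrow>L. \<Sum>\<eta>\<leftarrow>K. sqcoeff \<tau> (lact Y b \<xi>) \<eta>) + real (length L) * e"
    by (simp add: sum_list_addf sum_list_triv)
  also have "(\<Sum>\<xi>\<leftarrow>L. \<Sum>\<eta>\<leftarrow>K. sqcoeff \<tau> (lact Y b \<xi>) \<eta>)
    = (\<Sum>\<xi>\<leftarrow>L. \<Sum>\<eta>\<leftarrow>K. sqcoeff \<tau> (lact Y (star b) \<eta>) \<xi>)"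
    by (intro arg_cong[where f=sum_list] map_cong refl swap)
  also have "\<dots> = (\<Sum>\<eta>\<leftarrow>K. \<Sum>\<xi>\<leftarrow>L. sqcoeff \<tau> (lact Y (star b) \<eta>) \<xi>)"
    by (rule sum_list_swap)
  also have "\<dots> \<le> (\<Sum>\<eta>\<leftarrow>K. sqnorm \<tau> (lact Y (star b) \<eta>))"
    by (rule sum_list_mono) (use L K lact_mem in \<open>auto simp: bessel_def\<close>)
  finally show ?thesis by simp
qed

text \<open>
  Compare with a dominated family that approximates the vectors \<open>b\<xi>\<close>.
\<close>

lemma bessel_le_ltrace_star:
  assumes \<tau>: "tracial_state \<tau>" and L: "bessel \<tau> L"
  shows "(\<Sum>\<xi>\<leftarrow>L. ennreal (sqnorm \<tau> (lact Y b \<xi>))) \<le> ltrace \<tau> (star b)"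
proof -
  note pos = tracial_state_positive_functional[OF \<tau>]
  have Lc: "set L \<subseteq> car Y" using L by (simp add: bessel_def)
  have "ennreal (\<Sum>\<xi>\<leftarrow>L. sqnorm \<tau> (lact Y b \<xi>)) \<le> ltrace \<tau> (star b)"
  proof (rule ennreal_le_epsilon)
    fix e :: real assume e: "0 < e"
    define e' where "e' = e / (real (length L) + 1)"
    have e': "0 < e'" "real (length L) * e' \<le> e" using e by (auto simp: e'_def field_simps)
    obtain M S S' where M: "dominated M S S'"
      and small: "\<And>\<xi>. \<xi> \<in> set L \<Longrightarrow> sqnorm \<tau> (S (lact Y b \<xi>)) < e'"
      using dominated_approximates[OF e'(1), of "map (\<lambda>\<xi>. (\<tau>, lact Y b \<xi>)) L"] pos Lc lact_mem by force
    have Mc: "set M \<subseteq> car Y" using dominatedD[OF M] by simp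
    have nonneg_M: "0 \<le> sqnorm \<tau> (lact Y (star b) \<eta>)" if "\<eta> \<in> set M" for \<eta>
      by (rule inn_self_nonneg[OF pos], rule lact_mem) (use that Mc in auto)
    have "sqnorm \<tau> (lact Y b \<xi>)
      \<le> (\<Sum>\<eta>\<leftarrow>M. sqcoeff \<tau> (lact Y b \<xi>) \<eta>) + e'" if x: "\<xi> \<in> set L" for \<xi>
    proof -
      have "lact Y b \<xi> \<in> car Y" using Lc lact_mem x by auto
      from dominated_bessel(1)[OF pos M this] small[OF x] show ?thesis by simp
    qed
    from trace_comparison[OF \<tau> L Mc this]
    have "(\<Sum>\<xi>\<leftarrow>L. sqnorm \<tau> (lact Y b \<xi>))
      \<le> (\<Sum>\<eta>\<leftarrow>M. sqnorm \<tau> (lact Y (star b) \<eta>)) + e"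
      using e'(2) by simp
    then have "ennreal (\<Sum>\<xi>\<leftarrow>L. sqnorm \<tau> (lact Y b \<xi>))
      \<le> ennreal (\<Sum>\<eta>\<leftarrow>M. sqnorm \<tau> (lact Y (star b) \<eta>)) + ennreal e"
      using e by (subst ennreal_plus[symmetric]) (auto intro!: sum_list_nonneg ennreal_leI nonneg_M)
    also have "ennreal (\<Sum>\<eta>\<leftarrow>M. sqnorm \<tau> (lact Y (star b) \<eta>)) \<le> ltrace \<tau> (star b)"
      using dominated_le_ltrace[OF M, of \<tau> "star b"] sum_list_ennreal[of M, OF nonneg_M] by simp
    finally show "ennreal (\<Sum>\<xi>\<leftarrow>L. sqnorm \<tau> (lact Y b \<xi>)) \<le> ltrace \<tau> (star b) + ennreal e"
      by (simp add: add_right_mono)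
  qed
  moreover have "0 \<le> sqnorm \<tau> (lact Y b \<xi>)" if "\<xi> \<in> set L" for \<xi>
    by (rule inn_self_nonneg[OF pos], rule lact_mem) (use that Lc in auto)
  ultimately show ?thesis by (simp add: sum_list_ennreal)
qed

text \<open>
  The trace property of the induced trace: \<open>b\<^sup>*b\<close> and \<open>bb\<^sup>*\<close> have the same value.
\<close>

lemma ltrace_star:
  assumes \<tau>: "tracial_state \<tau>" shows "ltrace \<tau> (star b) = ltrace \<tau> b"
proof -
  have le: "ltrace \<tau> b \<le> ltrace \<tau> (star b)" for b
    unfolding ltrace_def[of \<tau> b]
    by (rule SUP_least)
      (use bessel_le_ltrace_star[OF \<tau>] dominated_imp_bessel[OF tracial_state_positive_functional[OF \<tau>]] in blast)
  show ?thesis using le[of b] le[of "star b"] by (simp add: star_star)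
qed

text \<open>
  The supremum that defines the induced trace does not grow when the families with
  \<open>\<Sum> \<theta>\<^sub>\<xi>\<^sub>,\<^sub>\<xi> \<le> 1\<close> are replaced by those satisfying the Bessel inequality only under \<open>\<tau>\<close>. The latter
  can be recognised on a dense subspace, which is how products of families are treated below.
\<close>

lemma bessel_le_ltrace:
  assumes \<tau>: "tracial_state \<tau>" and L: "bessel \<tau> L"
  shows "(\<Sum>\<xi>\<leftarrow>L. ennreal (sqnorm \<tau> (lact Y b \<xi>))) \<le> ltrace \<tau> b"
  using bessel_le_ltrace_star[OF assms] ltrace_star[OF \<tau>] by metis

text \<open>
  On the algebra itself, \<open>\<tau>((bh)\<^sup>*bh) = \<tau>(\<langle>b\<^sup>*,h\<rangle>\<langle>h,b\<^sup>*\<rangle>)\<close>, so the sum over a dominated family falls short of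
  \<open>\<tau>(bb\<^sup>*)\<close> by the error with which the family approximates the vector \<open>b\<^sup>*\<close>.
\<close>

lemma ltrace_coefficient_fibre:
  assumes \<tau>: "tracial_state \<tau>" and fib: "coefficient_fibre Y i"
  shows "ltrace \<tau> b = ennreal (Re (\<tau> (star b * b)))"
proof -
  note pos = tracial_state_positive_functional[OF \<tau>]
  have bij: "bij_betw i UNIV (car Y)" and la: "\<And>a c. lact Y a (i c) = i (a * c)"
    and inn: "\<And>a c. inn Y (i a) (i c) = star a * c"
    using fib unfolding coefficient_fibre_def by auto
  have i_mem: "i c \<in> car Y" for c using bij by (auto simp: bij_betw_def)
  let ?\<omega> = "i (star b)"
  have key: "(\<Sum>\<xi>\<leftarrow>L. ennreal (sqnorm \<tau> (lact Y b \<xi>)))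
    = ennreal (Re (\<tau> (star b * b)) - sqnorm \<tau> (S ?\<omega>))" if d: "dominated L S S'" for L S S'
  proof -
    have Lc: "set L \<subseteq> car Y" using dominatedD[OF d] by simp
    have eq: "sqnorm \<tau> (lact Y b \<xi>) = sqcoeff \<tau> ?\<omega> \<xi>" if "\<xi> \<in> set L" for \<xi>
    proof -
      have "\<xi> \<in> range i" using that Lc bij by (auto simp: bij_betw_def)
      then obtain h where h: "\<xi> = i h" by blast
      show ?thesis unfolding h la inn star_star star_mult
        using tracial_state_commute[OF \<tau>, of "b * h" "star h * star b"] by simp
    qed
    have "(\<Sum>\<xi>\<leftarrow>L. ennreal (sqnorm \<tau> (lact Y b \<xi>)))
      = ennreal (\<Sum>\<xi>\<leftarrow>L. sqnorm \<tau> (lact Y b \<xi>))"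
      by (rule sum_list_ennreal) (use Lc lact_mem inn_pos positive_functionalD[OF pos] in auto)
    also have "(\<Sum>\<xi>\<leftarrow>L. sqnorm \<tau> (lact Y b \<xi>)) = (\<Sum>\<xi>\<leftarrow>L. sqcoeff \<tau> ?\<omega> \<xi>)"
      by (intro arg_cong[where f=sum_list] map_cong refl eq)
    also have "\<dots> = Re (\<tau> (star b * b)) - sqnorm \<tau> (S ?\<omega>)"
      unfolding dominated_bessel(1)[OF pos d i_mem] inn star_star
      using tracial_state_commute[OF \<tau>, of b "star b"] by simp
    finally show ?thesis .
  qed
  show ?thesis
  proof (rule antisym)
    show "ltrace \<tau> b \<le> ennreal (Re (\<tau> (star b * b)))"
      unfolding ltrace_def
      by (rule SUP_least) (use key dominated_bessel(2)[OF pos _ i_mem] in \<open>auto intro!: ennreal_leI\<close>)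
    show "ennreal (Re (\<tau> (star b * b))) \<le> ltrace \<tau> b"
    proof (rule ennreal_le_epsilon)
      fix e :: real assume e: "0 < e"
      obtain L S S' where d: "dominated L S S'" and small: "sqnorm \<tau> (S ?\<omega>) < e"
        using dominated_approximates_vector[OF pos i_mem e] by blast
      have "ennreal (Re (\<tau> (star b * b))) \<le> ennreal ((Re (\<tau> (star b * b)) - sqnorm \<tau> (S ?\<omega>)) + e)"
        by (rule ennreal_leI) (use small in simp)
      also have "\<dots> \<le> ennreal (Re (\<tau> (star b * b)) - sqnorm \<tau> (S ?\<omega>)) + ennreal e"
        using e by (simp add: ennreal_plus_if)
      also have "\<dots> \<le> ltrace \<tau> b + ennreal e"
        using dominated_le_ltrace[OF d, of \<tau> b] key[OF d] by (simp add: add_right_mono)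
      finally show "ennreal (Re (\<tau> (star b * b))) \<le> ltrace \<tau> b + ennreal e" .
    qed
  qed
qed

end

lemma (in hmod) inn_sum_list_left:
  "\<xi> \<in> car Y \<Longrightarrow> set \<eta>s \<subseteq> car Y \<Longrightarrow> inn Y (sum_list \<eta>s) \<xi> = (\<Sum>\<eta>\<leftarrow>\<eta>s. inn Y \<eta> \<xi>)"
  by (induction \<eta>s) (auto simp: inn_zero_left inn_add_left sum_list_mem)

lemma semi_inner_add:
  assumes "semi_inner V s" "semi_inner V s'"
  shows "semi_inner V (\<lambda>u v. s u v + s' u v)"
proof -
  interpret a: semi_inner V s by fact
  interpret b: semi_inner V s' by fact
  show ?thesis
    by unfold_locales
      (simp_all add: a.add_mem a.scale_mem a.add_left a.add_right b.add_left b.add_right a.scale_left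
        a.scale_right b.scale_left b.scale_right a.diag_real b.diag_real a.diag_nonneg b.diag_nonneg
        distrib_left)
qed

lemma semi_inner_diff:
  assumes "semi_inner V s" "semi_inner V s'" "\<And>u. u \<in> V \<Longrightarrow> Re (s' u u) \<le> Re (s u u)"
  shows "semi_inner V (\<lambda>u v. s u v - s' u v)"
proof -
  interpret a: semi_inner V s by fact
  interpret b: semi_inner V s' by fact
  show ?thesis
    by unfold_locales
      (simp_all add: a.add_mem a.scale_mem a.add_left a.add_right b.add_left b.add_right a.scale_left
        a.scale_right b.scale_left b.scale_right a.diag_real b.diag_real a.diag_nonneg b.diag_nonneg
        right_diff_distrib assms(3))
qed

context hmod
begin

lemma semi_inner_coefficients:
  assumes \<tau>: "positive_functional \<tau>" and K: "set K \<subseteq> car Y"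
  shows "semi_inner (car Y) (\<lambda>\<omega> \<omega>'. \<Sum>\<kappa>\<leftarrow>K. \<tau> (inn Y \<omega> \<kappa> * inn Y \<kappa> \<omega>'))"
  using K
proof (induction K)
  case Nil
  show ?case by unfold_locales (simp_all add: add_mem scale_mem)
next
  case (Cons \<kappa> K)
  have "semi_inner (car Y) (\<lambda>\<omega> \<omega>'. \<tau> (inn Y \<omega> \<kappa> * inn Y \<kappa> \<omega>'))"
    by unfold_locales
      (use Cons.prems in \<open>auto simp: add_mem scale_mem inn_add_left inn_add_right inn_scale_left inn_scale_right
        scaleC_mult_left scaleC_mult_right distrib_left distrib_right positive_functionalD[OF \<tau>] inn_mult_swap_pos\<close>)
  from semi_inner_add[OF this Cons.IH] Cons.prems show ?case by simp
qed

lemma coefficients_bounded: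
  assumes \<tau>: "positive_functional \<tau>" and K: "set K \<subseteq> car Y"
  shows "\<exists>C\<ge>0. \<forall>d\<in>car Y. (\<Sum>\<kappa>\<leftarrow>K. sqcoeff \<tau> d \<kappa>) \<le> C * sqnorm \<tau> d"
  using K
proof (induction K)
  case (Cons \<kappa> K)
  obtain C where C: "C \<ge> 0" "\<And>d. d \<in> car Y \<Longrightarrow> (\<Sum>\<kappa>\<leftarrow>K. sqcoeff \<tau> d \<kappa>) \<le> C * sqnorm \<tau> d"
    using Cons by auto
  obtain D where D: "D \<ge> 0" "\<And>d. d \<in> car Y \<Longrightarrow> sqcoeff \<tau> d \<kappa> \<le> D * sqnorm \<tau> d"
    using coefficient_bounded[OF \<tau>, of \<kappa>] Cons.prems by auto
  show ?case
    by (rule exI[of _ "D + C"]) (use C D in \<open>auto simp: distrib_right intro: add_mono\<close>)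
qed auto

end

context corresp
begin

lemma induced_trace_eq_SUP:
  assumes \<tau>: "positive_functional \<tau>" and a: "a \<in> positive_elements"
  shows "induced_trace Y \<tau> (lact Y a) =
    (SUP L\<in>{L. \<exists>S S'. dominated L S S'}. \<Sum>\<xi>\<leftarrow>L. ennreal (Re (\<tau> (inn Y \<xi> (lact Y a \<xi>)))))"
proof -
  obtain b where b: "a = star b * b" using a unfolding positive_elements_def by blast
  show ?thesis unfolding b induced_trace_eq_ltrace[OF \<tau>] ltrace_def
  proof (rule SUP_cong[OF refl])
    fix L assume "L \<in> {L. \<exists>S S'. dominated L S S'}"
    then have "set L \<subseteq> car Y" using dominatedD(1) by blast
    then show "(\<Sum>\<xi>\<leftarrow>L. ennreal (sqnorm \<tau> (lact Y b \<xi>)))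
      = (\<Sum>\<xi>\<leftarrow>L. ennreal (Re (\<tau> (inn Y \<xi> (lact Y (star b * b) \<xi>)))))"
      by (intro arg_cong[where f=sum_list] map_cong refl) (auto simp: inn_lact_square)
  qed
qed

lemma inn_lact_zero: "\<beta> \<in> car Y \<Longrightarrow> \<gamma> \<in> car Y \<Longrightarrow> inn Y \<beta> (lact Y 0 \<gamma>) = 0"
  using lact_scale[of \<gamma> 0 0] by (simp add: inn_zero_right)

lemma inn_lact_add:
  "\<beta> \<in> car Y \<Longrightarrow> \<gamma> \<in> car Y \<Longrightarrow> inn Y \<beta> (lact Y (a + b) \<gamma>) = inn Y \<beta> (lact Y a \<gamma>) + inn Y \<beta> (lact Y b \<gamma>)"
  by (simp add: lact_add lact_mem inn_add_right)

lemma inn_lact_diff: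
  "\<beta> \<in> car Y \<Longrightarrow> \<gamma> \<in> car Y \<Longrightarrow> inn Y \<beta> (lact Y (a - b) \<gamma>) = inn Y \<beta> (lact Y a \<gamma>) - inn Y \<beta> (lact Y b \<gamma>)"
  using inn_lact_add[of \<beta> \<gamma> "a - b" b] by simp

lemma inn_lact_sum_list:
  "\<beta> \<in> car Y \<Longrightarrow> \<gamma> \<in> car Y \<Longrightarrow> inn Y \<beta> (lact Y (sum_list as) \<gamma>) = (\<Sum>a\<leftarrow>as. inn Y \<beta> (lact Y a \<gamma>))"
  by (induction as) (simp_all add: inn_lact_zero inn_lact_add)

text \<open>
  Boundedness comes from a square root: if \<open>(1 - y)\<^sup>2 = 1 - h\<close> then \<open>\<langle>\<beta>,\<beta>\<rangle> - \<langle>\<beta>,h\<beta>\<rangle>\<close> is the square of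
  \<open>\<beta> - y\<beta>\<close>.
\<close>

lemma vector_functional_positive:
  assumes \<tau>: "positive_functional \<tau>" and \<beta>: "\<beta> \<in> car Y"
  shows "positive_functional (\<lambda>a. \<tau> (inn Y \<beta> (lact Y a \<beta>)))"
proof -
  let ?\<sigma> = "\<lambda>a. \<tau> (inn Y \<beta> (lact Y a \<beta>))"
  note \<tau>D = positive_functionalD[OF \<tau>]
  have scale: "?\<sigma> (c *\<^sub>C a) = c * ?\<sigma> a" for c a
    using \<beta> by (simp add: lact_scale inn_scale_right lact_mem \<tau>D)
  define M where "M = sqnorm \<tau> \<beta>"
  have small: "Re (?\<sigma> h) \<le> M" if h: "star h = h" "norm h \<le> 1/2" for h
  proof -
    obtain y where y: "star y = y" "(1/2) *\<^sub>R (h + y * y) = y" using sqrt_one_minus[OF h] by blast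
    have "h + y * y = 2 *\<^sub>R ((1/2) *\<^sub>R (h + y * y))" by simp
    also have "\<dots> = y + y" unfolding y(2) by (simp add: scaleR_2)
    finally have hy: "h = y + y - y * y" by (simp add: algebra_simps)
    let ?v = "\<beta> - lact Y y \<beta>"
    have "inn Y ?v ?v = inn Y \<beta> \<beta> - inn Y \<beta> (lact Y h \<beta>)"
      unfolding hy using \<beta>
      by (simp add: inn_diff_left inn_diff_right lact_mem diff_mem inn_lact y inn_lact_diff inn_lact_add lact_mult)
    moreover have "0 \<le> sqnorm \<tau> ?v" using \<beta> by (intro \<tau>D inn_pos diff_mem lact_mem)
    ultimately show ?thesis by (simp add: \<tau>D M_def)
  qed
  have bound: "Re (?\<sigma> h) \<le> (2 * M) * norm h" if h: "star h = h" for h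
  proof (cases "h = 0")
    case True
    then show ?thesis using \<beta> by (simp add: inn_lact_zero \<tau>D)
  next
    case False
    let ?r = "1 / (2 * norm h)"
    have "norm (complex_of_real ?r *\<^sub>C h) \<le> 1/2"
      unfolding norm_scaleC_of_real using False by simp
    moreover have "star (complex_of_real ?r *\<^sub>C h) = complex_of_real ?r *\<^sub>C h"
      by (simp add: star_scaleC h)
    ultimately have "Re (?\<sigma> (complex_of_real ?r *\<^sub>C h)) \<le> M" by (intro small)
    then have "?r * Re (?\<sigma> h) \<le> M" unfolding scale by simp
    then show ?thesis using False by (simp add: field_simps)
  qed
  have pos: "?\<sigma> a \<in> \<real> \<and> 0 \<le> Re (?\<sigma> a)" if "a \<in> positive_elements" for a
  proof -
    obtain b where "a = star b * b" using \<open>a \<in> positive_elements\<close> unfolding positive_elements_def by blast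
    then show ?thesis using \<beta> by (simp add: inn_lact_square lact_mem inn_pos \<tau>D)
  qed
  show ?thesis unfolding positive_functional_def
    using scale bound pos \<beta> by (auto simp: inn_lact_add \<tau>D)
qed

end

text \<open>
  A sum of suprema is the supremum over independent choices in the summands. The summand \<open>c\<close> serves the
  induction.
\<close>

lemma sum_list_SUP_le:
  fixes f :: "'b \<Rightarrow> 'c \<Rightarrow> ennreal"
  assumes "D \<noteq> {}"
    and "\<And>ps. map fst ps = L \<Longrightarrow> snd ` set ps \<subseteq> D \<Longrightarrow> c + (\<Sum>(x, M)\<leftarrow>ps. f x M) \<le> B"
  shows "c + (\<Sum>x\<leftarrow>L. SUP M\<in>D. f x M) \<le> B"
  using assms(2)
proof (induction L arbitrary: c)
  case Nil
  then show ?case using Nil[of "[]"] by simp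
next
  case (Cons x L)
  have "(c + f x M) + (\<Sum>x\<leftarrow>L. SUP M\<in>D. f x M) \<le> B" if M: "M \<in> D" for M
  proof (rule Cons.IH)
    fix ps assume "map fst ps = L" "snd ` set ps \<subseteq> D"
    then show "c + f x M + (\<Sum>(x, M)\<leftarrow>ps. f x M) \<le> B"
      using Cons.prems[of "(x, M) # ps"] M by (simp add: add.assoc)
  qed
  then have "(SUP M\<in>D. (c + (\<Sum>x\<leftarrow>L. SUP M\<in>D. f x M)) + f x M) \<le> B"
    by (intro SUP_least) (simp add: ac_simps)
  then show ?case using ennreal_SUP_add_right[OF assms(1), of "c + (\<Sum>x\<leftarrow>L. SUP M\<in>D. f x M)" "f x"]
    by (simp add: ac_simps)
qed

section \<open>Traces on interior tensor products\<close>

locale tensor_fibres = Y: corresp Y + Z: corresp Z + W: corresp W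
  for Y Z W :: "('x::complex_vector, 'a::cstar_algebra) corr" +
  fixes m :: "'x \<Rightarrow> 'x \<Rightarrow> 'x"
  assumes m_mem: "\<xi> \<in> car Y \<Longrightarrow> \<eta> \<in> car Z \<Longrightarrow> m \<xi> \<eta> \<in> car W"
    and iso: "extends_to_tensor_iso Y Z W m"
    and lact_m: "\<xi> \<in> car Y \<Longrightarrow> \<eta> \<in> car Z \<Longrightarrow> lact W a (m \<xi> \<eta>) = m (lact Y a \<xi>) \<eta>"
begin

lemma inn_eval:
  "set ts \<subseteq> car Y \<times> car Z \<Longrightarrow> set us \<subseteq> car Y \<times> car Z \<Longrightarrow>
    inn W (tensor_eval m ts) (tensor_eval m us) = tensor_inner Y Z ts us"
  using iso unfolding extends_to_tensor_iso_def by blast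

lemma inn_m:
  assumes "\<xi> \<in> car Y" "\<eta> \<in> car Z" "\<xi>' \<in> car Y" "\<eta>' \<in> car Z"
  shows "inn W (m \<xi> \<eta>) (m \<xi>' \<eta>') = inn Z \<eta> (lact Z (inn Y \<xi> \<xi>') \<eta>')"
  using inn_eval[of "[(\<xi>, \<eta>)]" "[(\<xi>', \<eta>')]"] assms by (simp add: tensor_eval_def tensor_inner_def)

lemma eval_mem: "set ts \<subseteq> car Y \<times> car Z \<Longrightarrow> tensor_eval m ts \<in> car W"
  unfolding tensor_eval_def by (rule W.sum_list_mem) (auto intro!: m_mem)

text \<open>
  The image of a formal sum under the adjoint of \<open>\<eta> \<mapsto> \<xi> \<otimes> \<eta>\<close>.
\<close>

definition slice :: "'x \<Rightarrow> ('x \<times> 'x) list \<Rightarrow> 'x" where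
  "slice \<xi> ts = (\<Sum>(\<alpha>, \<beta>)\<leftarrow>ts. lact Z (inn Y \<xi> \<alpha>) \<beta>)"

lemma slice_mem: "set ts \<subseteq> car Y \<times> car Z \<Longrightarrow> slice \<xi> ts \<in> car Z"
  unfolding slice_def by (rule Z.sum_list_mem) (auto intro!: Z.lact_mem)

lemma inn_m_eval:
  assumes "\<xi> \<in> car Y" "\<eta> \<in> car Z" and ts: "set ts \<subseteq> car Y \<times> car Z"
  shows "inn W (m \<xi> \<eta>) (tensor_eval m ts) = inn Z \<eta> (slice \<xi> ts)"
proof -
  have "inn W (m \<xi> \<eta>) (tensor_eval m ts) = (\<Sum>(\<alpha>, \<beta>)\<leftarrow>ts. inn Z \<eta> (lact Z (inn Y \<xi> \<alpha>) \<beta>))"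
    using inn_eval[of "[(\<xi>, \<eta>)]" ts] assms by (simp add: tensor_eval_def tensor_inner_def)
  also have "\<dots> = inn Z \<eta> (slice \<xi> ts)"
    unfolding slice_def using assms
    by (subst Z.inn_sum_list_right) (auto simp: Z.lact_mem o_def case_prod_unfold intro!: Z.lact_mem)
  finally show ?thesis .
qed

lemma inn_eval_m:
  assumes "\<xi> \<in> car Y" "\<eta> \<in> car Z" and ts: "set ts \<subseteq> car Y \<times> car Z"
  shows "inn W (tensor_eval m ts) (m \<xi> \<eta>) = inn Z (slice \<xi> ts) \<eta>"
  using inn_m_eval[OF assms] W.inn_star[OF m_mem[OF assms(1,2)] eval_mem[OF ts]]
    Z.inn_star[OF assms(2) slice_mem[OF ts]] by simp

lemma slice_inn:
  assumes \<xi>: "\<xi> \<in> car Y" and ts: "set ts \<subseteq> car Y \<times> car Z"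
  shows "inn Z (slice \<xi> ts) (slice \<xi> ts)
    = (\<Sum>(\<alpha>, \<beta>)\<leftarrow>ts. \<Sum>(\<alpha>', \<beta>')\<leftarrow>ts. inn Z \<beta> (lact Z (inn Y \<alpha> \<xi> * inn Y \<xi> \<alpha>') \<beta>'))"
proof -
  have "inn Z (slice \<xi> ts) (slice \<xi> ts) = (\<Sum>p\<leftarrow>ts. inn Z (lact Z (inn Y \<xi> (fst p)) (snd p)) (slice \<xi> ts))"
    by (subst (1) slice_def, subst Z.inn_sum_list_left)
      (use ts slice_mem[OF ts] in \<open>auto simp: o_def case_prod_unfold intro!: Z.lact_mem\<close>)
  also have "\<dots> = (\<Sum>p\<leftarrow>ts. \<Sum>q\<leftarrow>ts. inn Z (snd p) (lact Z (inn Y (fst p) \<xi> * inn Y \<xi> (fst q)) (snd q)))"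
  proof (rule arg_cong[where f=sum_list], rule map_cong[OF refl])
    fix p assume p: "p \<in> set ts"
    then have pc: "fst p \<in> car Y" "snd p \<in> car Z" using ts by auto
    have "inn Z (lact Z (inn Y \<xi> (fst p)) (snd p)) (slice \<xi> ts)
      = (\<Sum>q\<leftarrow>ts. inn Z (lact Z (inn Y \<xi> (fst p)) (snd p)) (lact Z (inn Y \<xi> (fst q)) (snd q)))"
      by (subst slice_def, subst Z.inn_sum_list_right)
        (use ts pc in \<open>auto simp: o_def case_prod_unfold intro!: Z.lact_mem\<close>)
    also have "\<dots> = (\<Sum>q\<leftarrow>ts. inn Z (snd p) (lact Z (inn Y (fst p) \<xi> * inn Y \<xi> (fst q)) (snd q)))"
      by (rule arg_cong[where f=sum_list], rule map_cong[OF refl])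
        (use ts pc \<xi> in \<open>auto simp: Z.inn_lact Z.lact_mem Z.lact_mult Y.inn_star\<close>)
    finally show "inn Z (lact Z (inn Y \<xi> (fst p)) (snd p)) (slice \<xi> ts)
      = (\<Sum>q\<leftarrow>ts. inn Z (snd p) (lact Z (inn Y (fst p) \<xi> * inn Y \<xi> (fst q)) (snd q)))" .
  qed
  finally show ?thesis by (simp add: case_prod_unfold)
qed

text \<open>
  In the tensor product, the families \<open>\<xi> \<otimes> \<cdot>\<close> with \<open>\<xi>\<close> in \<open>L\<close> account for
  \<open>(\<Sum>\<^sub>L \<theta>\<^sub>\<xi>\<^sub>,\<^sub>\<xi>) \<otimes> 1 = 1 - S'S \<otimes> 1\<close>, and \<open>us\<close> represents the image of \<open>ts\<close> under \<open>S \<otimes> 1\<close>.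
\<close>

lemma sum_slices:
  assumes L: "Y.dominated L S S'" and ts: "set ts \<subseteq> car Y \<times> car Z"
  defines "us \<equiv> map (\<lambda>(\<alpha>, \<beta>). (S \<alpha>, \<beta>)) ts"
  shows "set us \<subseteq> car Y \<times> car Z"
    and "(\<Sum>\<xi>\<leftarrow>L. inn Z (slice \<xi> ts) (slice \<xi> ts))
      = inn W (tensor_eval m ts) (tensor_eval m ts) - inn W (tensor_eval m us) (tensor_eval m us)"
proof -
  note LD = Y.dominatedD[OF L]
  show us: "set us \<subseteq> car Y \<times> car Z" using ts LD unfolding us_def by auto
  have "(\<Sum>\<xi>\<leftarrow>L. inn Z (slice \<xi> ts) (slice \<xi> ts))
    = (\<Sum>\<xi>\<leftarrow>L. \<Sum>p\<leftarrow>ts. \<Sum>q\<leftarrow>ts. inn Z (snd p) (lact Z (inn Y (fst p) \<xi> * inn Y \<xi> (fst q)) (snd q)))"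
    by (rule arg_cong[where f=sum_list], rule map_cong[OF refl])
      (use LD(1) slice_inn[OF _ ts] in \<open>auto simp: case_prod_unfold\<close>)
  also have "\<dots> = (\<Sum>p\<leftarrow>ts. \<Sum>q\<leftarrow>ts. \<Sum>\<xi>\<leftarrow>L. inn Z (snd p) (lact Z (inn Y (fst p) \<xi> * inn Y \<xi> (fst q)) (snd q)))"
    by (rule trans[OF sum_list_swap], rule arg_cong[where f=sum_list], rule map_cong[OF refl], rule sum_list_swap)
  also have "\<dots> = (\<Sum>p\<leftarrow>ts. \<Sum>q\<leftarrow>ts. inn Z (snd p) (lact Z (inn Y (fst p) (fst q)) (snd q))
      - inn Z (snd p) (lact Z (inn Y (S (fst p)) (S (fst q))) (snd q)))"
  proof (intro arg_cong[where f=sum_list] map_cong refl)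
    fix p q assume "p \<in> set ts" "q \<in> set ts"
    then have c: "fst p \<in> car Y" "snd p \<in> car Z" "fst q \<in> car Y" "snd q \<in> car Z" using ts by auto
    have "(\<Sum>\<xi>\<leftarrow>L. inn Z (snd p) (lact Z (inn Y (fst p) \<xi> * inn Y \<xi> (fst q)) (snd q)))
      = inn Z (snd p) (lact Z (\<Sum>\<xi>\<leftarrow>L. inn Y (fst p) \<xi> * inn Y \<xi> (fst q)) (snd q))"
      by (subst Z.inn_lact_sum_list) (use c in \<open>auto simp: o_def\<close>)
    also have "(\<Sum>\<xi>\<leftarrow>L. inn Y (fst p) \<xi> * inn Y \<xi> (fst q)) = inn Y (fst p) (fst q) - inn Y (S (fst p)) (S (fst q))"
      using LD(5)[OF c(1,3)] by simp
    finally show "(\<Sum>\<xi>\<leftarrow>L. inn Z (snd p) (lact Z (inn Y (fst p) \<xi> * inn Y \<xi> (fst q)) (snd q)))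
      = inn Z (snd p) (lact Z (inn Y (fst p) (fst q)) (snd q))
      - inn Z (snd p) (lact Z (inn Y (S (fst p)) (S (fst q))) (snd q))"
      using c by (simp only: Z.inn_lact_diff)
  qed
  also have "\<dots> = tensor_inner Y Z ts ts - tensor_inner Y Z us us"
    unfolding tensor_inner_def us_def by (simp add: case_prod_unfold o_def sum_list_subtractf)
  finally show "(\<Sum>\<xi>\<leftarrow>L. inn Z (slice \<xi> ts) (slice \<xi> ts))
      = inn W (tensor_eval m ts) (tensor_eval m ts) - inn W (tensor_eval m us) (tensor_eval m us)"
    by (simp only: inn_eval[OF ts ts] inn_eval[OF us us])
qed

lemma eval_dense:
  assumes \<tau>: "positive_functional \<tau>" and \<omega>: "\<omega> \<in> car W" and e: "0 < e"
  shows "\<exists>ts. set ts \<subseteq> car Y \<times> car Z \<and> W.sqnorm \<tau> (\<omega> - tensor_eval m ts) < e"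
proof -
  obtain C where C: "\<And>h. star h = h \<Longrightarrow> Re (\<tau> h) \<le> C * norm h"
    using \<tau> unfolding positive_functional_def by blast
  define r where "r = sqrt (e / (\<bar>C\<bar> + 1))"
  have r: "r > 0" using e by (simp add: r_def add_nonneg_pos)
  obtain ts where ts: "set ts \<subseteq> car Y \<times> car Z" and small: "hnorm W (\<omega> - tensor_eval m ts) < r"
    using iso \<omega> r unfolding extends_to_tensor_iso_def by blast
  let ?d = "\<omega> - tensor_eval m ts"
  have d: "?d \<in> car W" using \<omega> eval_mem[OF ts] by (simp add: W.diff_mem)
  have "norm (inn W ?d ?d) < e / (\<bar>C\<bar> + 1)"
    using small by (simp add: hnorm_def r_def)
  then have "(\<bar>C\<bar> + 1) * norm (inn W ?d ?d) < e"
    by (simp add: field_simps add_nonneg_pos)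
  moreover have "W.sqnorm \<tau> ?d \<le> C * norm (inn W ?d ?d)" by (rule C) (simp add: W.inn_star d)
  moreover have "C * norm (inn W ?d ?d) \<le> (\<bar>C\<bar> + 1) * norm (inn W ?d ?d)" by (intro mult_right_mono) auto
  ultimately show ?thesis using ts by (intro exI[of _ ts]) auto
qed

text \<open>
  Each vector of the left factor comes with its own family in the right factor.
\<close>

definition products :: "('x \<times> 'x list) list \<Rightarrow> 'x list" where
  "products ps = concat (map (\<lambda>(\<xi>, M). map (m \<xi>) M) ps)"

lemma sum_list_products:
  "(\<Sum>\<kappa>\<leftarrow>products ps. f \<kappa>) = (\<Sum>(\<xi>, M)\<leftarrow>ps. \<Sum>\<eta>\<leftarrow>M. f (m \<xi> \<eta>))"
  for f :: "'x \<Rightarrow> 'c::comm_monoid_add"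
  unfolding products_def by (induction ps) (auto simp: o_def)

lemma products_mem:
  assumes "Y.dominated (map fst ps) S S'" "\<forall>p\<in>set ps. Z.bessel \<tau> (snd p)"
  shows "set (products ps) \<subseteq> car W"
  using assms Y.dominatedD(1)[OF assms(1)] unfolding products_def Z.bessel_def by (fastforce intro!: m_mem)

lemma coefficients_eval:
  assumes L: "Y.dominated (map fst ps) S S'" and M: "\<forall>p\<in>set ps. Z.bessel \<tau> (snd p)"
    and ts: "set ts \<subseteq> car Y \<times> car Z"
  shows "(\<Sum>\<kappa>\<leftarrow>products ps. W.sqcoeff \<tau> (tensor_eval m ts) \<kappa>)
    = (\<Sum>(\<xi>, M)\<leftarrow>ps. \<Sum>\<eta>\<leftarrow>M. Z.sqcoeff \<tau> (slice \<xi> ts) \<eta>)"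
proof -
  have "(\<Sum>\<eta>\<leftarrow>M'. W.sqcoeff \<tau> (tensor_eval m ts) (m \<xi> \<eta>))
    = (\<Sum>\<eta>\<leftarrow>M'. Z.sqcoeff \<tau> (slice \<xi> ts) \<eta>)" if "(\<xi>, M') \<in> set ps" for \<xi> M'
  proof (intro arg_cong[where f=sum_list] map_cong refl)
    fix \<eta> assume "\<eta> \<in> set M'"
    then have "\<xi> \<in> car Y" "\<eta> \<in> car Z"
      using that bspec[OF M that] Y.dominatedD(1)[OF L] unfolding Z.bessel_def by force+
    then show "W.sqcoeff \<tau> (tensor_eval m ts) (m \<xi> \<eta>)
      = Z.sqcoeff \<tau> (slice \<xi> ts) \<eta>"
      using ts by (simp add: inn_m_eval inn_eval_m)
  qed
  then show ?thesis unfolding sum_list_products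
    by (intro arg_cong[where f=sum_list] map_cong refl) auto
qed

text \<open>
  On sums of elementary tensors the inequality follows from those of the two factors. It extends
  to all vectors because both sides are continuous in the seminorm of \<open>\<tau>\<close>, the left one by
  \<open>coefficients_bounded\<close>.
\<close>

lemma bessel_products:
  assumes \<tau>: "positive_functional \<tau>"
    and L: "Y.dominated (map fst ps) S S'" and M: "\<forall>p\<in>set ps. Z.bessel \<tau> (snd p)"
  shows "W.bessel \<tau> (products ps)"
proof -
  let ?K = "products ps"
  have K: "set ?K \<subseteq> car W" by (rule products_mem[OF L M])
  interpret sW: semi_inner "car W" "\<lambda>\<omega> \<omega>'. \<tau> (inn W \<omega> \<omega>')" by (rule W.semi_inner_functional[OF \<tau>])
  interpret sK: semi_inner "car W" "\<lambda>\<omega> \<omega>'. \<Sum>\<kappa>\<leftarrow>?K. \<tau> (inn W \<omega> \<kappa> * inn W \<kappa> \<omega>')"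
    by (rule W.semi_inner_coefficients[OF \<tau> K])
  note Re_sum = Re_sum_list
  note Re_tau_sum = positive_functional_sum_list[OF \<tau>]
  have algebraic: "sK.nrm (tensor_eval m ts) \<le> sW.nrm (tensor_eval m ts)" if ts: "set ts \<subseteq> car Y \<times> car Z" for ts
  proof -
    define us where "us = map (\<lambda>(\<alpha>, \<beta>). (S \<alpha>, \<beta>)) ts"
    note sl = sum_slices[OF L ts, folded us_def]
    have "(\<Sum>(\<xi>, M)\<leftarrow>ps. \<Sum>\<eta>\<leftarrow>M. Z.sqcoeff \<tau> (slice \<xi> ts) \<eta>)
      \<le> (\<Sum>p\<leftarrow>ps. Z.sqnorm \<tau> (slice (fst p) ts))"
      by (rule sum_list_mono) (use M slice_mem[OF ts] in \<open>auto simp: Z.bessel_def\<close>)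
    also have "\<dots> = Re (\<tau> (\<Sum>\<xi>\<leftarrow>map fst ps. inn Z (slice \<xi> ts) (slice \<xi> ts)))"
      by (simp only: Re_tau_sum) (simp add: o_def)
    also have "\<dots> \<le> W.sqnorm \<tau> (tensor_eval m ts)"
      unfolding sl(2) using sW.diag_nonneg[OF eval_mem[OF sl(1)]] by (simp add: positive_functionalD[OF \<tau>])
    finally show ?thesis
      unfolding sK.nrm_def sW.nrm_def
      by (simp only: Re_sum coefficients_eval[OF L M ts, symmetric] real_sqrt_le_iff)
  qed
  obtain C where C: "C \<ge> 0"
    "\<And>d. d \<in> car W \<Longrightarrow> (\<Sum>\<kappa>\<leftarrow>?K. W.sqcoeff \<tau> d \<kappa>) \<le> C * W.sqnorm \<tau> d"
    using W.coefficients_bounded[OF \<tau> K] by blast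
  have cont: "sK.nrm d \<le> sqrt C * sW.nrm d" if "d \<in> car W" for d
    unfolding sK.nrm_def sW.nrm_def Re_sum real_sqrt_mult[symmetric] using C(2)[OF that] by simp
  have "sK.nrm \<omega> \<le> sW.nrm \<omega>" if \<omega>: "\<omega> \<in> car W" for \<omega>
  proof (rule field_le_epsilon)
    fix e :: real assume e: "0 < e"
    define r where "r = e / (2 + sqrt C)"
    have r: "r > 0" using e C by (simp add: r_def add_pos_nonneg)
    obtain ts where ts: "set ts \<subseteq> car Y \<times> car Z"
      and small: "W.sqnorm \<tau> (\<omega> - tensor_eval m ts) < r\<^sup>2"
      using eval_dense[OF \<tau> \<omega>, of "r\<^sup>2"] r by auto
    let ?\<omega> = "tensor_eval m ts" let ?d = "\<omega> - ?\<omega>"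
    have mem: "?\<omega> \<in> car W" "?d \<in> car W" "- ?d \<in> car W"
      using \<omega> eval_mem[OF ts] by (auto simp: W.diff_mem W.minus_mem)
    have d: "sW.nrm ?d \<le> r" using small r unfolding sW.nrm_def by (simp add: real_le_lsqrt)
    have neg: "sW.nrm (- ?d) = sW.nrm ?d"
      using mem(2) unfolding sW.nrm_def minus_eq_scaleC[of ?d]
      by (simp add: W.scale_mem W.inn_scale_left W.inn_scale_right scaleC_scaleC scaleC_one)
    have "sK.nrm \<omega> \<le> sK.nrm ?\<omega> + sK.nrm ?d" using sK.nrm_triangle[OF mem(1,2)] by simp
    also have "sK.nrm ?\<omega> \<le> sW.nrm ?\<omega>" by (rule algebraic[OF ts])
    also have "sW.nrm ?\<omega> \<le> sW.nrm \<omega> + sW.nrm ?d" using sW.nrm_triangle[OF \<omega> mem(3)] neg by simp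
    also have "sK.nrm ?d \<le> sqrt C * sW.nrm ?d" by (rule cont[OF mem(2)])
    finally have "sK.nrm \<omega> \<le> sW.nrm \<omega> + (1 + sqrt C) * sW.nrm ?d" by (simp add: algebra_simps)
    also have "(1 + sqrt C) * sW.nrm ?d \<le> (1 + sqrt C) * r" using d C by (intro mult_left_mono) auto
    also have "(1 + sqrt C) * r \<le> (2 + sqrt C) * r" using r by simp
    also have "\<dots> = e"
    proof -
      have "2 + sqrt C > 0" using real_sqrt_ge_zero[OF C(1)] by linarith
      then show ?thesis by (simp add: r_def)
    qed
    finally show "sK.nrm \<omega> \<le> sW.nrm \<omega> + e" by simp
  qed
  then show ?thesis
    unfolding W.bessel_def sK.nrm_def sW.nrm_def Re_sum using K by simp
qed

end

context tensor_fibres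
begin

lemma products_trace:
  assumes "Y.dominated (map fst ps) S S'" "\<forall>p\<in>set ps. Z.bessel \<tau> (snd p)"
  shows "(\<Sum>\<kappa>\<leftarrow>products ps. ennreal (W.sqnorm \<tau> (lact W b \<kappa>)))
    = (\<Sum>(\<xi>, M)\<leftarrow>ps. \<Sum>\<eta>\<leftarrow>M. ennreal (Re (\<tau> (inn Z \<eta> (lact Z (inn Y (lact Y b \<xi>) (lact Y b \<xi>)) \<eta>)))))"
  unfolding sum_list_products
proof (rule arg_cong[where f=sum_list], rule map_cong[OF refl], clarify)
  fix \<xi> M assume p: "(\<xi>, M) \<in> set ps"
  have "\<xi> \<in> car Y" using Y.dominatedD(1)[OF assms(1)] p by force
  moreover have "set M \<subseteq> car Z" using bspec[OF assms(2) p] by (simp add: Z.bessel_def)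
  ultimately show "(\<Sum>\<eta>\<leftarrow>M. ennreal (W.sqnorm \<tau> (lact W b (m \<xi> \<eta>))))
    = (\<Sum>\<eta>\<leftarrow>M. ennreal (Re (\<tau> (inn Z \<eta> (lact Z (inn Y (lact Y b \<xi>) (lact Y b \<xi>)) \<eta>)))))"
    by (intro arg_cong[where f=sum_list] map_cong refl) (auto simp: lact_m inn_m Y.lact_mem)
qed

text \<open>
  Near-optimal families for the inner traces, one for each \<open>\<xi>\<close>, combine to a Bessel family of products.
\<close>

lemma product_trace_lower:
  assumes \<tau>: "tracial_state \<tau>" and L: "Y.dominated L S S'"
  shows "(\<Sum>\<xi>\<leftarrow>L. induced_trace Z \<tau> (lact Z (inn Y (lact Y b \<xi>) (lact Y b \<xi>)))) \<le> W.ltrace \<tau> b"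
proof -
  note pos = tracial_state_positive_functional[OF \<tau>]
  define D where "D = {M. \<exists>S S'. Z.dominated M S S'}"
  define f where "f \<xi> M = (\<Sum>\<eta>\<leftarrow>M. ennreal (Re (\<tau> (inn Z \<eta> (lact Z (inn Y (lact Y b \<xi>) (lact Y b \<xi>)) \<eta>)))))" for \<xi> M
  have "(\<Sum>\<xi>\<leftarrow>L. induced_trace Z \<tau> (lact Z (inn Y (lact Y b \<xi>) (lact Y b \<xi>)))) = (\<Sum>\<xi>\<leftarrow>L. SUP M\<in>D. f \<xi> M)"
    unfolding D_def f_def
    by (rule arg_cong[where f=sum_list], rule map_cong[OF refl], rule Z.induced_trace_eq_SUP[OF pos])
      (use Y.dominatedD(1)[OF L] in \<open>auto intro!: Y.inn_pos Y.lact_mem\<close>)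
  also have "\<dots> = 0 + (\<Sum>\<xi>\<leftarrow>L. SUP M\<in>D. f \<xi> M)" by simp
  also have "\<dots> \<le> W.ltrace \<tau> b"
  proof (rule sum_list_SUP_le)
    show "D \<noteq> {}" using Z.dominated_Nil by (auto simp: D_def)
    fix ps assume ps: "map fst ps = L" "snd ` set ps \<subseteq> D"
    have L': "Y.dominated (map fst ps) S S'" using L ps by simp
    have M: "\<forall>p\<in>set ps. Z.bessel \<tau> (snd p)"
      using ps(2) Z.dominated_imp_bessel[OF pos] by (force simp: D_def)
    show "0 + (\<Sum>(\<xi>, M)\<leftarrow>ps. f \<xi> M) \<le> W.ltrace \<tau> b"
      using W.bessel_le_ltrace[OF \<tau> bessel_products[OF pos L' M], where b=b]
      unfolding products_trace[OF L' M] f_def by simp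
  qed
  finally show ?thesis .
qed

text \<open>
  The finitely many pairs \<open>(\<sigma>,\<alpha>)\<close> describe how well a family \<open>L\<close> on the left factor must approximate
  the identity for its value to nearly dominate the contribution of \<open>F\<close>. Being a finite list of
  conditions, they can be met for several right factors by a single \<open>L\<close>. The pairs come from
  writing the vectors \<open>b\<^sup>*\<zeta>\<close>, up to a small error, as sums of elementary tensors \<open>\<alpha> \<otimes> \<beta>\<close>; as
  \<open>\<parallel>S\<alpha> \<otimes> \<beta>\<parallel>\<^sup>2 = \<tau>\<langle>\<beta>,\<langle>S\<alpha>,S\<alpha>\<rangle>\<beta>\<rangle>\<close>, the functional to be used is \<open>\<sigma>(a) = \<tau>\<langle>\<beta>,a\<beta>\<rangle>\<close>.
\<close>

lemma product_trace_upper: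
  assumes \<tau>: "tracial_state \<tau>" and F: "W.dominated F T T'" and e: "0 < e"
  shows "\<exists>qs \<delta>. 0 < \<delta> \<and> (\<forall>(\<sigma>, \<alpha>)\<in>set qs. positive_functional \<sigma> \<and> \<alpha> \<in> car Y) \<and>
    (\<forall>L S S'. Y.dominated L S S' \<longrightarrow> (\<forall>(\<sigma>, \<alpha>)\<in>set qs. Y.sqnorm \<sigma> (S \<alpha>) < \<delta>) \<longrightarrow>
      (\<Sum>\<zeta>\<leftarrow>F. ennreal (W.sqnorm \<tau> (lact W (star b) \<zeta>)))
      \<le> (\<Sum>\<xi>\<leftarrow>L. induced_trace Z \<tau> (lact Z (inn Y (lact Y b \<xi>) (lact Y b \<xi>)))) + ennreal e)"
proof -
  note pos = tracial_state_positive_functional[OF \<tau>]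
  note \<tau>D = positive_functionalD[OF pos]
  interpret sW: semi_inner "car W" "\<lambda>\<omega> \<omega>'. \<tau> (inn W \<omega> \<omega>')" by (rule W.semi_inner_functional[OF pos])
  have Fc: "set F \<subseteq> car W" using W.dominatedD(1)[OF F] .
  define e1 where "e1 = e / (real (length F) + 1)"
  have e1: "0 < e1" "real (length F) * e1 \<le> e" using e by (auto simp: e1_def field_simps)
  define \<rho> where "\<rho> = sqrt e1 / 2"
  have \<rho>: "0 < \<rho>" using e1 by (simp add: \<rho>_def)
  let ?w = "\<lambda>\<zeta>. lact W (star b) \<zeta>"
  have w: "?w \<zeta> \<in> car W" if "\<zeta> \<in> set F" for \<zeta> using that Fc W.lact_mem by auto
  have "\<forall>\<zeta>\<in>set F. \<exists>ts. set ts \<subseteq> car Y \<times> car Z \<and>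
    W.sqnorm \<tau> (?w \<zeta> - tensor_eval m ts) < \<rho>\<^sup>2"
    using eval_dense[OF pos w] \<rho> by simp
  then obtain ts where ts: "\<And>\<zeta>. \<zeta> \<in> set F \<Longrightarrow> set (ts \<zeta>) \<subseteq> car Y \<times> car Z"
    and ts_close: "\<And>\<zeta>. \<zeta> \<in> set F \<Longrightarrow> W.sqnorm \<tau> (?w \<zeta> - tensor_eval m (ts \<zeta>)) < \<rho>\<^sup>2"
    by (metis (no_types, lifting) bchoice)
  define l where "l = (\<Sum>\<zeta>\<leftarrow>F. length (ts \<zeta>))"
  define r where "r = \<rho> / (2 * (real l + 1))"
  have r: "0 < r" using \<rho> by (simp add: r_def)
  define qs where "qs = concat (map (\<lambda>\<zeta>. map (\<lambda>(\<alpha>, \<beta>). (\<lambda>a. \<tau> (inn Z \<beta> (lact Z a \<beta>)), \<alpha>)) (ts \<zeta>)) F)"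
  have qs_pos: "\<forall>(\<sigma>, \<alpha>)\<in>set qs. positive_functional \<sigma> \<and> \<alpha> \<in> car Y"
    using ts unfolding qs_def by (force intro!: Z.vector_functional_positive[OF pos])
  have "(\<Sum>\<zeta>\<leftarrow>F. ennreal (W.sqnorm \<tau> (?w \<zeta>)))
      \<le> (\<Sum>\<xi>\<leftarrow>L. induced_trace Z \<tau> (lact Z (inn Y (lact Y b \<xi>) (lact Y b \<xi>)))) + ennreal e"
    if L: "Y.dominated L S S'" and small: "\<forall>(\<sigma>, \<alpha>)\<in>set qs. Y.sqnorm \<sigma> (S \<alpha>) < r\<^sup>2" for L S S'
  proof -
    note LD = Y.dominatedD[OF L]
    define e2 where "e2 = \<rho>\<^sup>2 / (2 * (real (length L) + 1))"
    have e2: "0 < e2" "real (length L) * e2 \<le> \<rho>\<^sup>2 / 2" using \<rho> by (auto simp: e2_def field_simps)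
    have ex: "\<forall>\<xi>. \<exists>M. (\<exists>R R'. Z.dominated M R R') \<and> (\<forall>\<zeta>\<in>set F. Z.sqnorm \<tau> (slice \<xi> (ts \<zeta>))
      \<le> (\<Sum>\<eta>\<leftarrow>M. Z.sqcoeff \<tau> (slice \<xi> (ts \<zeta>)) \<eta>) + e2)"
    proof
      fix \<xi>
      obtain M R R' where M: "Z.dominated M R R'"
        and R: "\<And>\<zeta>. \<zeta> \<in> set F \<Longrightarrow> Z.sqnorm \<tau> (R (slice \<xi> (ts \<zeta>))) < e2"
        using Z.dominated_approximates[OF e2(1), of "map (\<lambda>\<zeta>. (\<tau>, slice \<xi> (ts \<zeta>))) F"] pos slice_mem[OF ts]
        by force
      have "Z.sqnorm \<tau> (slice \<xi> (ts \<zeta>))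
        \<le> (\<Sum>\<eta>\<leftarrow>M. Z.sqcoeff \<tau> (slice \<xi> (ts \<zeta>)) \<eta>) + e2"
        if "\<zeta> \<in> set F" for \<zeta>
        using Z.dominated_bessel(1)[OF pos M slice_mem[OF ts[OF that], of \<xi>]] R[OF that] by simp
      then show "\<exists>M. (\<exists>R R'. Z.dominated M R R') \<and> (\<forall>\<zeta>\<in>set F. Z.sqnorm \<tau> (slice \<xi> (ts \<zeta>))
        \<le> (\<Sum>\<eta>\<leftarrow>M. Z.sqcoeff \<tau> (slice \<xi> (ts \<zeta>)) \<eta>) + e2)"
        using M by blast
    qed
    from choice[OF ex] obtain M where M: "\<And>\<xi>. \<exists>R R'. Z.dominated (M \<xi>) R R'"
      and M_close: "\<And>\<xi> \<zeta>. \<zeta> \<in> set F \<Longrightarrow> Z.sqnorm \<tau> (slice \<xi> (ts \<zeta>))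
      \<le> (\<Sum>\<eta>\<leftarrow>M \<xi>. Z.sqcoeff \<tau> (slice \<xi> (ts \<zeta>)) \<eta>) + e2"
      by blast
    define ps where "ps = map (\<lambda>\<xi>. (\<xi>, M \<xi>)) L"
    have L': "Y.dominated (map fst ps) S S'" using L by (simp add: ps_def o_def)
    have Mb: "\<forall>p\<in>set ps. Z.bessel \<tau> (snd p)"
      using M Z.dominated_imp_bessel[OF pos] by (auto simp: ps_def)
    have sum_ps: "(\<Sum>(\<xi>, M')\<leftarrow>ps. f \<xi> M') = (\<Sum>\<xi>\<leftarrow>L. f \<xi> (M \<xi>))" for f :: "'x \<Rightarrow> 'x list \<Rightarrow> real"
      by (simp add: ps_def o_def)
    let ?K = "products ps"
    note K = bessel_products[OF pos L' Mb]
    have Kc: "set ?K \<subseteq> car W" using K by (simp add: W.bessel_def)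
    note Re_sum = Re_sum_list
    note Re_tau_sum = positive_functional_sum_list[OF pos]
    \<comment> \<open>The seminorm of the part of a vector that the products miss.\<close>
    interpret sN: semi_inner "car W" "\<lambda>\<omega> \<omega>'. \<tau> (inn W \<omega> \<omega>') - (\<Sum>\<kappa>\<leftarrow>?K. \<tau> (inn W \<omega> \<kappa> * inn W \<kappa> \<omega>'))"
      by (rule semi_inner_diff[OF W.semi_inner_functional[OF pos] W.semi_inner_coefficients[OF pos Kc]])
        (use K in \<open>simp add: W.bessel_def Re_sum\<close>)
    have N_le: "sN.nrm d \<le> sW.nrm d" if "d \<in> car W" for d
    proof -
      have "0 \<le> (\<Sum>\<kappa>\<leftarrow>?K. W.sqcoeff \<tau> d \<kappa>)"
        by (rule sum_list_nonneg) (use W.inn_mult_swap_pos that Kc \<tau>D in auto)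
      then show ?thesis unfolding sN.nrm_def sW.nrm_def by (simp add: Re_sum)
    qed
    have close: "W.sqnorm \<tau> (?w \<zeta>)
      \<le> (\<Sum>\<kappa>\<leftarrow>?K. W.sqcoeff \<tau> (?w \<zeta>) \<kappa>) + e1" if \<zeta>: "\<zeta> \<in> set F" for \<zeta>
    proof -
      let ?t = "ts \<zeta>" let ?\<omega> = "tensor_eval m ?t" let ?d = "?w \<zeta> - ?\<omega>"
      note tz = ts[OF \<zeta>]
      have mem: "?\<omega> \<in> car W" "?d \<in> car W" using eval_mem[OF tz] w[OF \<zeta>] by (auto simp: W.diff_mem)
      define us where "us = map (\<lambda>(\<alpha>, \<beta>). (S \<alpha>, \<beta>)) ?t"
      note sl = sum_slices[OF L tz, folded us_def]
      have us_small: "sW.nrm (tensor_eval m us) \<le> \<rho> / 2"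
      proof -
        have each: "sW.nrm (m \<alpha> \<beta>) \<le> r \<and> m \<alpha> \<beta> \<in> car W" if ab: "(\<alpha>, \<beta>) \<in> set us" for \<alpha> \<beta>
        proof -
          obtain \<alpha>' where a: "(\<alpha>', \<beta>) \<in> set ?t" "\<alpha> = S \<alpha>'" using ab by (auto simp: us_def)
          have c: "\<alpha> \<in> car Y" "\<beta> \<in> car Z" using ab sl(1) by auto
          have "(\<lambda>a. \<tau> (inn Z \<beta> (lact Z a \<beta>)), \<alpha>') \<in> set qs"
            unfolding qs_def using a(1) \<zeta> by force
          then have "Re (\<tau> (inn Z \<beta> (lact Z (inn Y \<alpha> \<alpha>) \<beta>))) < r\<^sup>2" using small a(2) by fastforce
          then show ?thesis
            using c r unfolding sW.nrm_def by (simp add: inn_m m_mem real_le_lsqrt)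
        qed
        have "sW.nrm (tensor_eval m us) \<le> (\<Sum>u\<leftarrow>map (\<lambda>(\<alpha>, \<beta>). m \<alpha> \<beta>) us. sW.nrm u)"
          unfolding tensor_eval_def
          by (rule conjunct2[OF sW.nrm_sum_list])
            (use each W.zero_mem in \<open>auto simp: W.inn_zero_left \<tau>D\<close>)
        also have "\<dots> \<le> (\<Sum>u\<leftarrow>us. r)"
          unfolding map_map by (rule sum_list_mono) (use each in auto)
        also have "\<dots> = real (length ?t) * r" by (simp only: sum_list_triv) (simp add: us_def)
        also have "\<dots> \<le> real l * r"
        proof -
          have "length ?t \<le> l" unfolding l_def using \<zeta> by (intro member_le_sum_list) auto
          then show ?thesis using r by (intro mult_right_mono) auto
        qed
        also have "\<dots> \<le> \<rho> / 2" using \<rho> by (simp add: r_def field_simps)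
        finally show ?thesis .
      qed
      have "(sN.nrm ?\<omega>)\<^sup>2 = W.sqnorm \<tau> ?\<omega> - (\<Sum>\<xi>\<leftarrow>L. \<Sum>\<eta>\<leftarrow>M \<xi>. Z.sqcoeff \<tau> (slice \<xi> ?t) \<eta>)"
        unfolding sN.nrm_power2[OF mem(1)]
        by (simp add: Re_sum coefficients_eval[OF L' Mb tz] sum_ps)
      also have "\<dots> \<le> W.sqnorm \<tau> ?\<omega> - (\<Sum>\<xi>\<leftarrow>L. Z.sqnorm \<tau> (slice \<xi> ?t) - e2)"
      proof -
        have "(\<Sum>\<xi>\<leftarrow>L. Z.sqnorm \<tau> (slice \<xi> ?t) - e2)
          \<le> (\<Sum>\<xi>\<leftarrow>L. \<Sum>\<eta>\<leftarrow>M \<xi>. Z.sqcoeff \<tau> (slice \<xi> ?t) \<eta>)"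
          by (rule sum_list_mono) (use M_close[OF \<zeta>] in \<open>simp add: algebra_simps\<close>)
        then show ?thesis by simp
      qed
      also have "(\<Sum>\<xi>\<leftarrow>L. Z.sqnorm \<tau> (slice \<xi> ?t) - e2)
        = Re (\<tau> (\<Sum>\<xi>\<leftarrow>L. inn Z (slice \<xi> ?t) (slice \<xi> ?t))) - real (length L) * e2"
        by (simp add: sum_list_subtractf sum_list_triv Re_tau_sum)
      also have "W.sqnorm \<tau> ?\<omega> - (Re (\<tau> (\<Sum>\<xi>\<leftarrow>L. inn Z (slice \<xi> ?t) (slice \<xi> ?t))) - real (length L) * e2)
        = (sW.nrm (tensor_eval m us))\<^sup>2 + real (length L) * e2"
        unfolding sl(2) using eval_mem[OF sl(1)] by (simp add: \<tau>D sW.nrm_power2)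
      also have "\<dots> \<le> (\<rho> / 2)\<^sup>2 + \<rho>\<^sup>2 / 2"
        using us_small e2(2) sW.nrm_nonneg[OF eval_mem[OF sl(1)]] by (intro add_mono power_mono) auto
      also have "\<dots> \<le> \<rho>\<^sup>2" by (simp add: power2_eq_square)
      finally have "(sN.nrm ?\<omega>)\<^sup>2 \<le> \<rho>\<^sup>2" .
      then have "sN.nrm ?\<omega> \<le> \<rho>" by (rule power2_le_imp_le) (use \<rho> in simp)
      moreover have "sN.nrm ?d \<le> \<rho>"
      proof -
        have "sW.nrm ?d \<le> \<rho>" using ts_close[OF \<zeta>] \<rho> unfolding sW.nrm_def by (simp add: real_le_lsqrt)
        then show ?thesis using N_le[OF mem(2)] by simp
      qed
      moreover have "sN.nrm (?w \<zeta>) \<le> sN.nrm ?\<omega> + sN.nrm ?d" using sN.nrm_triangle[OF mem] by simp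
      ultimately have "sN.nrm (?w \<zeta>) \<le> sqrt e1" by (simp add: \<rho>_def)
      then have "(sN.nrm (?w \<zeta>))\<^sup>2 \<le> (sqrt e1)\<^sup>2" using sN.nrm_nonneg[OF w[OF \<zeta>]] by (intro power_mono)
      then show ?thesis using e1(1) w[OF \<zeta>] by (simp add: sN.nrm_power2 Re_sum)
    qed
    have nonneg: "0 \<le> W.sqnorm \<tau> (lact W c \<zeta>)" if "\<zeta> \<in> car W" for c \<zeta>
      using that by (intro W.inn_self_nonneg[OF pos] W.lact_mem)
    have "(\<Sum>\<zeta>\<leftarrow>F. W.sqnorm \<tau> (?w \<zeta>)) \<le> (\<Sum>\<kappa>\<leftarrow>?K. W.sqnorm \<tau> (lact W b \<kappa>)) + e"
      using W.trace_comparison[OF \<tau> W.dominated_imp_bessel[OF pos F] Kc close] e1(2) by (simp add: star_star)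
    then have "ennreal (\<Sum>\<zeta>\<leftarrow>F. W.sqnorm \<tau> (?w \<zeta>))
      \<le> ennreal (\<Sum>\<kappa>\<leftarrow>?K. W.sqnorm \<tau> (lact W b \<kappa>)) + ennreal e"
      using e Kc by (subst ennreal_plus[symmetric]) (auto intro!: sum_list_nonneg ennreal_leI nonneg)
    also have "ennreal (\<Sum>\<zeta>\<leftarrow>F. W.sqnorm \<tau> (?w \<zeta>)) = (\<Sum>\<zeta>\<leftarrow>F. ennreal (W.sqnorm \<tau> (?w \<zeta>)))"
      by (rule sum_list_ennreal[symmetric], rule nonneg) (use Fc in auto)
    also have "ennreal (\<Sum>\<kappa>\<leftarrow>?K. W.sqnorm \<tau> (lact W b \<kappa>))
      = (\<Sum>\<kappa>\<leftarrow>?K. ennreal (W.sqnorm \<tau> (lact W b \<kappa>)))"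
      by (rule sum_list_ennreal[symmetric], rule nonneg) (use Kc in auto)
    also have "\<dots> \<le> (\<Sum>\<xi>\<leftarrow>L. induced_trace Z \<tau> (lact Z (inn Y (lact Y b \<xi>) (lact Y b \<xi>))))"
    proof -
      have "(\<Sum>\<eta>\<leftarrow>M \<xi>. ennreal (Re (\<tau> (inn Z \<eta> (lact Z (inn Y (lact Y b \<xi>) (lact Y b \<xi>)) \<eta>)))))
        \<le> induced_trace Z \<tau> (lact Z (inn Y (lact Y b \<xi>) (lact Y b \<xi>)))" if "\<xi> \<in> set L" for \<xi>
      proof -
        have "inn Y (lact Y b \<xi>) (lact Y b \<xi>) \<in> positive_elements"
          using that LD(1) by (intro Y.inn_pos Y.lact_mem) auto
        from Z.induced_trace_eq_SUP[OF pos this] show ?thesis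
          using M[of \<xi>] by (auto intro!: SUP_upper)
      qed
      then show ?thesis unfolding products_trace[OF L' Mb] by (auto simp: ps_def o_def intro!: sum_list_mono)
    qed
    finally show ?thesis by (simp add: add_right_mono)
  qed
  then show ?thesis using qs_pos r by (intro exI[of _ qs] exI[of _ "r\<^sup>2"]) auto
qed

end

section \<open>Indicator functions of ideals\<close>

lemma sum_Pow_alternating:
  assumes "finite K"
  shows "(\<Sum>L\<in>Pow K. (- 1) ^ card L * of_bool (\<forall>k\<in>L. Q k)) = (of_bool (\<forall>k\<in>K. \<not> Q k) :: real)"
proof -
  have "(\<Prod>k\<in>K. - of_bool (Q k) + (1::real)) = (\<Sum>L\<in>Pow K. (\<Prod>k\<in>L. - of_bool (Q k)) * (\<Prod>k\<in>K - L. 1))"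
    by (rule prod_add[OF assms])
  moreover have "(\<Prod>k\<in>L. - of_bool (Q k)) * (\<Prod>k\<in>K - L. 1) = (- 1) ^ card L * (of_bool (\<forall>k\<in>L. Q k) :: real)"
    if "L \<in> Pow K" for L
  proof -
    have L: "finite L" using that assms finite_subset by auto
    have "(\<Prod>k\<in>L. - of_bool (Q k) :: real) = (- 1) ^ card L * (\<Prod>k\<in>L. of_bool (Q k))"
      using L by (induction L rule: finite_induct) auto
    moreover have "(\<Prod>k\<in>L. of_bool (Q k) :: real) = of_bool (\<forall>k\<in>L. Q k)"
      using L by (induction L rule: finite_induct) auto
    ultimately show ?thesis by simp
  qed
  moreover have "(\<Prod>k\<in>K. - of_bool (Q k) + (1::real)) = of_bool (\<forall>k\<in>K. \<not> Q k)"
    using assms by (induction K rule: finite_induct) auto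
  ultimately show ?thesis by simp
qed

locale wqlo =
  fixes G :: "('g, 'z) monoid_scheme" (structure) and P :: "'g set"
  assumes wq: "weak_quasi_lattice_ordered G P"
begin

sublocale group G using wq by (simp add: weak_quasi_lattice_ordered_def)

sublocale P: submonoid P G using wq by (simp add: weak_quasi_lattice_ordered_def)

lemma carr: "p \<in> P \<Longrightarrow> p \<in> carrier G" using P.subset by blast

lemma cancel: "p \<in> P \<Longrightarrow> x \<in> P \<Longrightarrow> y \<in> P \<Longrightarrow> p \<otimes> x = p \<otimes> y \<longleftrightarrow> x = y"
  using carr by simp

abbreviation ideal :: "'g \<Rightarrow> 'g set" where "ideal p \<equiv> p <# P"

lemma mem_ideal: "x \<in> ideal p \<longleftrightarrow> (\<exists>h\<in>P. x = p \<otimes> h)"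
  by (auto simp: l_coset_def)

lemma ideal_refl: "p \<in> P \<Longrightarrow> p \<in> ideal p"
  using carr by (auto simp: mem_ideal intro!: bexI[of _ "\<one>"])

lemma ideal_trans:
  assumes "p \<in> P" "q \<in> ideal p" "x \<in> ideal q" shows "x \<in> ideal p"
  using assms carr by (auto simp: mem_ideal m_assoc)

lemma ideal_mult: "h \<in> P \<Longrightarrow> p \<otimes> h \<in> ideal p"
  by (auto simp: mem_ideal)

lemma ideal_one: "ideal \<one> = P"
  using carr by (auto simp: mem_ideal)

lemma ideal_antisym:
  assumes p: "p \<in> P" and q: "q \<in> P" and "q \<in> ideal p" "p \<in> ideal q"
  shows "p = q"
proof -
  obtain h k where h: "h \<in> P" "q = p \<otimes> h" and k: "k \<in> P" "p = q \<otimes> k"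
    using assms(3,4) by (auto simp: mem_ideal)
  have "p \<otimes> h \<otimes> k = p" using h k by simp
  then have "p \<otimes> (h \<otimes> k) = p \<otimes> \<one>" using h(1) k(1) p carr by (simp add: m_assoc)
  then have hk: "h \<otimes> k = \<one>" using p h(1) k(1) by (simp only: cancel P.m_closed P.one_closed)
  have "h = inv k" using inv_equality[OF hk] h(1) k(1) carr by simp
  then have "h \<in> P \<inter> (\<lambda>p. inv p) ` P" using h(1) k(1) by auto
  moreover have "P \<inter> (\<lambda>p. inv p) ` P = {\<one>}"
    using wq unfolding weak_quasi_lattice_ordered_def by (elim conjE)
  ultimately have "h = \<one>" by simp
  then show ?thesis using h(2) p carr by simp
qed

lemma ideal_mult_cancel:
  assumes "p \<in> P" "x \<in> P" "y \<in> P"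
  shows "p \<otimes> y \<in> ideal (p \<otimes> x) \<longleftrightarrow> y \<in> ideal x"
proof -
  have "p \<otimes> y = p \<otimes> x \<otimes> h \<longleftrightarrow> y = x \<otimes> h" if "h \<in> P" for h
    using assms that carr by (simp add: m_assoc cancel)
  then show ?thesis by (auto simp: mem_ideal)
qed

lemma finite_join_exists:
  assumes "finite K" "K \<noteq> {}" "K \<subseteq> P" "(\<Inter>k\<in>K. ideal k) \<noteq> {}"
  shows "\<exists>r\<in>P. (\<Inter>k\<in>K. ideal k) = ideal r"
  using assms
proof (induction K rule: finite_ne_induct)
  case (insert k K)
  then obtain r where r: "r \<in> P" "(\<Inter>k\<in>K. ideal k) = ideal r" by auto
  then have "ideal k \<inter> ideal r \<noteq> {}" using insert.prems by auto
  then have "\<exists>!s. s \<in> P \<and> ideal k \<inter> ideal r = ideal s"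
    using wq r(1) insert.prems unfolding weak_quasi_lattice_ordered_def by simp
  then obtain s where "s \<in> P \<and> ideal k \<inter> ideal r = ideal s" by (elim ex1E)
  then show ?case using r by auto
qed auto

text \<open>The join of the empty set is the unit, so that one formula covers all finite sets.\<close>

definition join1 :: "'g set \<Rightarrow> 'g option" where
  "join1 K = (if K = {} then Some \<one> else join G P K)"

lemma join1_empty [simp]: "join1 {} = Some \<one>" by (simp add: join1_def)

lemma join1_Some:
  assumes K: "finite K" "K \<subseteq> P" and z: "join1 K = Some z"
  shows "z \<in> P" and "x \<in> P \<Longrightarrow> x \<in> ideal z \<longleftrightarrow> (\<forall>k\<in>K. x \<in> ideal k)"
proof -
  have "z \<in> P \<and> (x \<in> P \<longrightarrow> (x \<in> ideal z \<longleftrightarrow> (\<forall>k\<in>K. x \<in> ideal k)))" for x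
  proof (cases "K = {}")
    case True
    then show ?thesis using z by (auto simp: ideal_one)
  next
    case False
    then have ne: "(\<Inter>k\<in>K. ideal k) \<noteq> {}" and zt: "z = (THE r. r \<in> P \<and> (\<Inter>k\<in>K. ideal k) = ideal r)"
      using z by (auto simp: join1_def join_def split: if_splits)
    obtain r where r: "r \<in> P" "(\<Inter>k\<in>K. ideal k) = ideal r" using finite_join_exists[OF K(1) False K(2) ne] by blast
    have "z = r" unfolding zt
    proof (rule the_equality)
      fix r' assume "r' \<in> P \<and> (\<Inter>k\<in>K. ideal k) = ideal r'"
      then have "r' \<in> P" "ideal r' = ideal r" using r by auto
      then show "r' = r" using r ideal_antisym[of r' r] ideal_refl by auto
    qed (use r in auto)
    then show ?thesis using r by auto
  qed
  then show "z \<in> P" and "x \<in> P \<Longrightarrow> x \<in> ideal z \<longleftrightarrow> (\<forall>k\<in>K. x \<in> ideal k)" by auto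
qed

lemma join1_None:
  assumes "join1 K = None" shows "\<exists>k\<in>K. x \<notin> ideal k"
  using assms by (auto simp: join1_def join_def split: if_splits)

lemma join1_singleton:
  assumes p: "p \<in> P" shows "join1 {p} = Some p"
proof (cases "join1 {p}")
  case None
  then show ?thesis using join1_None[OF None, of p] ideal_refl[OF p] by auto
next
  case (Some z)
  have "z \<in> P" "\<And>x. x \<in> P \<Longrightarrow> x \<in> ideal z \<longleftrightarrow> x \<in> ideal p"
    using join1_Some[OF _ _ Some] p by auto
  then show ?thesis using Some p ideal_antisym[of z p] ideal_refl by auto
qed

text \<open>
  \<open>expansion p K\<close> extends a weight on principal ideals, \<open>f q\<close> being the weight of \<open>qP\<close>, to the set
  \<open>p\<Omega>\<^sub>K\<close>; \<open>coeff p K q\<close> is the coefficient of the indicator function of \<open>qP\<close> in that of \<open>p\<Omega>\<^sub>K\<close>.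
\<close>

definition expansion :: "'g \<Rightarrow> 'g set \<Rightarrow> ('g \<Rightarrow> real) \<Rightarrow> real" where
  "expansion p K f = (\<Sum>L\<in>Pow K. case join1 L of None \<Rightarrow> 0 | Some z \<Rightarrow> (- 1) ^ card L * f (p \<otimes> z))"

definition coeff :: "'g \<Rightarrow> 'g set \<Rightarrow> 'g \<Rightarrow> real" where
  "coeff p K q = expansion p K (\<lambda>x. of_bool (x = q))"

lemma expansion_indicator:
  assumes p: "p \<in> P" and K: "finite K" "K \<subseteq> P" and x: "x \<in> P"
  shows "expansion p K (\<lambda>q. of_bool (x \<in> ideal q)) = of_bool (x \<in> p <# Omega G P K)"
proof (cases "x \<in> ideal p")
  case False
  have "x \<notin> ideal (p \<otimes> z)" if "z \<in> P" for z
    using False ideal_trans[OF p ideal_mult[OF that]] by blast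
  then have "(case join1 L of None \<Rightarrow> 0 | Some z \<Rightarrow> (- 1) ^ card L * of_bool (x \<in> ideal (p \<otimes> z))) = (0::real)"
    if "L \<in> Pow K" for L
    using that K join1_Some(1)[of L] finite_subset[of L K] by (auto split: option.split)
  then have "expansion p K (\<lambda>q. of_bool (x \<in> ideal q)) = 0"
    unfolding expansion_def by (intro sum.neutral ballI)
  moreover have "x \<notin> p <# Omega G P K"
    using False by (auto simp: l_coset_def Omega_def)
  ultimately show ?thesis by simp
next
  case True
  then obtain y where y: "y \<in> P" "x = p \<otimes> y" by (auto simp: mem_ideal)
  have "(case join1 L of None \<Rightarrow> 0 | Some z \<Rightarrow> (- 1) ^ card L * of_bool (x \<in> ideal (p \<otimes> z)))
    = (- 1) ^ card L * (of_bool (\<forall>k\<in>L. y \<in> ideal k) :: real)" if "L \<in> Pow K" for L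
  proof -
    have L: "finite L" "L \<subseteq> P" using that K finite_subset by auto
    show ?thesis
    proof (cases "join1 L")
      case None
      then show ?thesis using join1_None[OF None, of y] by auto
    next
      case (Some z)
      then show ?thesis using join1_Some[OF L Some] y p by (simp add: ideal_mult_cancel)
    qed
  qed
  then have "expansion p K (\<lambda>q. of_bool (x \<in> ideal q)) = (\<Sum>L\<in>Pow K. (- 1) ^ card L * of_bool (\<forall>k\<in>L. y \<in> ideal k))"
    unfolding expansion_def by (rule sum.cong[OF refl])
  also have "\<dots> = of_bool (\<forall>k\<in>K. y \<notin> ideal k)" by (rule sum_Pow_alternating[OF K(1)])
  also have "(\<forall>k\<in>K. y \<notin> ideal k) \<longleftrightarrow> x \<in> p <# Omega G P K"
  proof
    assume "\<forall>k\<in>K. y \<notin> ideal k"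
    then show "x \<in> p <# Omega G P K" using y by (auto simp: l_coset_def Omega_def)
  next
    assume "x \<in> p <# Omega G P K"
    then obtain y' where y': "y' \<in> Omega G P K" "x = p \<otimes> y'" by (auto simp: l_coset_def)
    then have "y' \<in> P" by (simp add: Omega_def)
    then have "y' = y" using y y' p by (simp add: cancel)
    then show "\<forall>k\<in>K. y \<notin> ideal k" using y' by (auto simp: Omega_def)
  qed
  finally show ?thesis .
qed

lemma coeff_support:
  assumes K: "finite K" "K \<subseteq> P"
  shows "finite {q. coeff p K q \<noteq> 0}"
    and "coeff p K q \<noteq> 0 \<Longrightarrow> \<exists>L\<subseteq>K. \<exists>z\<in>P. join1 L = Some z \<and> q = p \<otimes> z"
proof -
  show ex: "\<exists>L\<subseteq>K. \<exists>z\<in>P. join1 L = Some z \<and> q = p \<otimes> z" if nz: "coeff p K q \<noteq> 0" for q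
  proof (rule ccontr)
    assume no: "\<not> (\<exists>L\<subseteq>K. \<exists>z\<in>P. join1 L = Some z \<and> q = p \<otimes> z)"
    have "coeff p K q = 0" unfolding coeff_def expansion_def
    proof (intro sum.neutral ballI)
      fix L assume L: "L \<in> Pow K"
      then have Lf: "finite L" "L \<subseteq> P" using K finite_subset by auto
      show "(case join1 L of None \<Rightarrow> 0 | Some z \<Rightarrow> (- 1) ^ card L * of_bool (p \<otimes> z = q)) = (0::real)"
        using no L join1_Some(1)[OF Lf] by (auto split: option.split)
    qed
    then show False using nz by simp
  qed
  have "{q. coeff p K q \<noteq> 0} \<subseteq> (\<lambda>L. p \<otimes> the (join1 L)) ` Pow K"
  proof
    fix q assume "q \<in> {q. coeff p K q \<noteq> 0}"
    then obtain L z where "L \<subseteq> K" "join1 L = Some z" "q = p \<otimes> z" using ex by blast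
    then show "q \<in> (\<lambda>L. p \<otimes> the (join1 L)) ` Pow K" by (intro image_eqI[of _ _ L]) auto
  qed
  then show "finite {q. coeff p K q \<noteq> 0}" by (rule finite_subset) (use K in simp)
qed

lemma expansion_eq_sum:
  assumes K: "finite K" "K \<subseteq> P" and S: "finite S" "{q. coeff p K q \<noteq> 0} \<subseteq> S"
  shows "expansion p K f = (\<Sum>q\<in>S. coeff p K q * f q)"
proof -
  define S' where "S' = S \<union> (\<lambda>L. p \<otimes> the (join1 L)) ` Pow K"
  have S': "finite S'" using S K by (simp add: S'_def)
  have "(\<Sum>q\<in>S'. coeff p K q * f q)
    = (\<Sum>L\<in>Pow K. \<Sum>q\<in>S'. (case join1 L of None \<Rightarrow> 0 | Some z \<Rightarrow> (- 1) ^ card L * of_bool (p \<otimes> z = q)) * f q)"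
    unfolding coeff_def expansion_def sum_distrib_right by (rule sum.swap)
  also have "\<dots> = expansion p K f"
    unfolding expansion_def
  proof (rule sum.cong[OF refl])
    fix L assume L: "L \<in> Pow K"
    show "(\<Sum>q\<in>S'. (case join1 L of None \<Rightarrow> 0 | Some z \<Rightarrow> (- 1) ^ card L * of_bool (p \<otimes> z = q)) * f q)
      = (case join1 L of None \<Rightarrow> 0 | Some z \<Rightarrow> (- 1) ^ card L * f (p \<otimes> z))"
    proof (cases "join1 L")
      case (Some z)
      have z: "p \<otimes> z \<in> S'" unfolding S'_def by (rule UnI2, rule image_eqI[of _ _ L]) (use L Some in auto)
      have "(\<Sum>q\<in>S'. ((- 1) ^ card L * of_bool (p \<otimes> z = q)) * f q) = (\<Sum>q\<in>S'. if p \<otimes> z = q then (- 1) ^ card L * f q else 0)"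
        by (rule sum.cong) auto
      also have "\<dots> = (- 1) ^ card L * f (p \<otimes> z)" using S' z by simp
      finally show ?thesis using Some by simp
    qed simp
  qed
  also have "(\<Sum>q\<in>S'. coeff p K q * f q) = (\<Sum>q\<in>S. coeff p K q * f q)"
    using S S' by (intro sum.mono_neutral_right) (auto simp: S'_def)
  finally show ?thesis by simp
qed

lemma coeff_translate:
  assumes p: "p \<in> P" and K: "finite K" "K \<subseteq> P" and z: "z \<in> P"
  shows "coeff p K (p \<otimes> z) = coeff \<one> K z"
  unfolding coeff_def expansion_def
proof (rule sum.cong[OF refl])
  fix L assume "L \<in> Pow K"
  then have L: "finite L" "L \<subseteq> P" using K finite_subset by auto
  show "(case join1 L of None \<Rightarrow> 0 | Some w \<Rightarrow> (- 1) ^ card L * of_bool (p \<otimes> w = p \<otimes> z))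
    = (case join1 L of None \<Rightarrow> 0 | Some w \<Rightarrow> (- 1) ^ card L * (of_bool (\<one> \<otimes> w = z) :: real))"
    using join1_Some(1)[OF L] p z carr by (auto split: option.split simp: cancel)
qed

lemma expansion_translate:
  assumes p: "p \<in> P" and K: "finite K" "K \<subseteq> P"
  shows "expansion p K f = expansion \<one> K (\<lambda>z. f (p \<otimes> z))"
  unfolding expansion_def
proof (rule sum.cong[OF refl])
  fix L assume "L \<in> Pow K"
  then have L: "finite L" "L \<subseteq> P" using K finite_subset by auto
  show "(case join1 L of None \<Rightarrow> 0 | Some w \<Rightarrow> (- 1) ^ card L * f (p \<otimes> w))
    = (case join1 L of None \<Rightarrow> 0 | Some w \<Rightarrow> (- 1) ^ card L * f (p \<otimes> (\<one> \<otimes> w)))"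
    using join1_Some(1)[OF L] carr by (auto split: option.split)
qed

text \<open>
  Discarding the elements of \<open>K\<close> that are not below \<open>z\<close> leaves only the terms of the expansion
  at elements below \<open>z\<close>. If the coefficient at \<open>z\<close> is negative, the inequality for the
  smaller set thus bounds the trace at \<open>z\<close> by traces at elements strictly below \<open>z\<close>.
\<close>

lemma coeff_restrict:
  assumes K: "finite K" "K \<subseteq> P" and z: "z \<in> P" and q: "q \<in> P"
  shows "coeff \<one> {k\<in>K. z \<in> ideal k} q = (if z \<in> ideal q then coeff \<one> K q else 0)"
proof -
  let ?K = "{k\<in>K. z \<in> ideal k}"
  let ?g = "\<lambda>L. case join1 L of None \<Rightarrow> 0 | Some w \<Rightarrow> (- 1) ^ card L * (of_bool (\<one> \<otimes> w = q) :: real)"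
  have sub: "finite L" "L \<subseteq> P" if "L \<subseteq> K" for L using that K finite_subset by auto
  have below: "L \<subseteq> ?K \<longleftrightarrow> z \<in> ideal q" if "L \<subseteq> K" "join1 L = Some q" for L
    using join1_Some(2)[OF sub[OF that(1)] that(2) z] that by auto
  have zero: "?g L = 0" if "L \<subseteq> K" "join1 L \<noteq> Some q" for L
    using that join1_Some(1)[OF sub[OF that(1)]] carr by (auto split: option.split)
  have "?g L = 0" if "L \<in> Pow K - Pow ?K" "z \<in> ideal q" for L
    using that below[of L] zero[of L] by blast
  moreover have "?g L = 0" if "L \<in> Pow ?K" "z \<notin> ideal q" for L
    using that below[of L] zero[of L] by blast
  ultimately show ?thesis
    unfolding coeff_def expansion_def using K
    by (auto intro!: sum.mono_neutral_left sum.neutral)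
qed

text \<open>
  Evaluating at \<open>q\<close> isolates \<open>c q\<close>, once the coefficients at all elements strictly below \<open>q\<close> vanish.
\<close>

lemma indicators_independent:
  assumes S: "finite S" "S \<subseteq> P"
    and zero: "\<And>x. x \<in> P \<Longrightarrow> (\<Sum>q\<in>S. c q * of_bool (x \<in> ideal q)) = (0::real)"
    and q: "q \<in> S"
  shows "c q = 0"
  using q
proof (induction "card {r\<in>S. q \<in> ideal r}" arbitrary: q rule: less_induct)
  case less
  have qP: "q \<in> P" using less.prems S by auto
  have smaller: "c r = 0" if r: "r \<in> S" "r \<noteq> q" "q \<in> ideal r" for r
  proof (rule less.hyps)
    have "{s\<in>S. r \<in> ideal s} \<subset> {s\<in>S. q \<in> ideal s}"
    proof
      show "{s\<in>S. r \<in> ideal s} \<subseteq> {s\<in>S. q \<in> ideal s}" using r(3) ideal_trans S by blast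
      show "{s\<in>S. r \<in> ideal s} \<noteq> {s\<in>S. q \<in> ideal s}"
        using less.prems r ideal_refl[OF qP] ideal_antisym[of q r] S by blast
    qed
    then show "card {s\<in>S. r \<in> ideal s} < card {s\<in>S. q \<in> ideal s}" using S by (intro psubset_card_mono) auto
  qed (rule r)
  have "0 = (\<Sum>r\<in>S. c r * of_bool (q \<in> ideal r))" using zero[OF qP] by simp
  also have "\<dots> = (\<Sum>r\<in>{q}. c r * of_bool (q \<in> ideal r))"
    using smaller less.prems S by (intro sum.mono_neutral_right) auto
  also have "\<dots> = c q" using ideal_refl[OF qP] by simp
  finally show ?case by simp
qed

lemma atoms_subset: "atoms G P \<subseteq> P - {\<one>}" by (auto simp: atoms_def)

lemma translate_Omega_mem:
  assumes p: "p \<in> P" and K: "finite K" "K \<subseteq> P" and A: "Sigma_Algebra.algebra P A" "ideal ` P \<subseteq> A"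
  shows "p <# Omega G P K \<in> A"
proof -
  interpret A: Sigma_Algebra.algebra P A by (rule A)
  have "p <# Omega G P K = ideal p - (\<Union>k\<in>K. ideal (p \<otimes> k))"
  proof (rule Set.set_eqI)
    fix x
    have "p \<otimes> y \<in> ideal (p \<otimes> k) \<longleftrightarrow> y \<in> ideal k" if "y \<in> P" "k \<in> K" for y k
      using that K p ideal_mult_cancel by blast
    then show "x \<in> p <# Omega G P K \<longleftrightarrow> x \<in> ideal p - (\<Union>k\<in>K. ideal (p \<otimes> k))"
      by (auto simp: l_coset_def[of _ p] Omega_def)
  qed
  moreover have "ideal p \<in> A" "\<And>k. k \<in> K \<Longrightarrow> ideal (p \<otimes> k) \<in> A" using A(2) p K by blast+
  ultimately show ?thesis using K by (simp add: A.Diff A.finite_UN)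
qed

lemma ideal_in_atom_collection:
  assumes "p \<in> P" shows "ideal p \<in> atom_collection G P"
proof -
  have "Omega G P {} = P" by (simp add: Omega_def)
  then show ?thesis using assms unfolding atom_collection_def
    by (intro CollectI exI[of _ "1::nat"] exI[of _ "\<lambda>_. p"] exI[of _ "\<lambda>_. {}"])
      (auto simp: disjoint_family_on_def)
qed

lemma atom_collection_eq_ideal_algebra:
  assumes alg: "Sigma_Algebra.algebra P (atom_collection G P)"
  shows "atom_collection G P = ideal_algebra G P"
proof
  show "ideal_algebra G P \<subseteq> atom_collection G P"
    unfolding ideal_algebra_def using alg ideal_in_atom_collection by blast
  show "atom_collection G P \<subseteq> ideal_algebra G P"
  proof (unfold ideal_algebra_def, intro subsetI InterI, clarify)
    fix E M assume E: "E \<in> atom_collection G P" and M: "Sigma_Algebra.algebra P M" "ideal ` P \<subseteq> M"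
    interpret M: Sigma_Algebra.algebra P M by (rule M)
    obtain n :: nat and p K where pK: "\<And>j. j < n \<Longrightarrow> p j \<in> P \<and> finite (K j) \<and> K j \<subseteq> atoms G P"
      and E: "E = (\<Union>j<n. p j <# Omega G P (K j))"
      using E unfolding atom_collection_def by blast
    show "E \<in> M" unfolding E
      using pK atoms_subset by (intro M.finite_UN translate_Omega_mem[OF _ _ _ M]) blast+
  qed
qed

text \<open>
  A partition is an identity between indicator functions, hence between their coefficients.
\<close>

lemma Omega_decomposition:
  assumes alg: "Sigma_Algebra.algebra P (atom_collection G P)" and J: "finite J" "J \<subseteq> P"
  shows "\<exists>(n::nat) p K. (\<forall>j<n. p j \<in> P \<and> finite (K j) \<and> K j \<subseteq> atoms G P) \<and>
    (\<forall>q. coeff \<one> J q = (\<Sum>j<n. coeff (p j) (K j) q))"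
proof -
  have "\<one> <# Omega G P J \<in> atom_collection G P"
    using ideal_in_atom_collection by (intro translate_Omega_mem[OF _ J alg]) auto
  then obtain n :: nat and p K where pK: "\<forall>j<n. p j \<in> P \<and> finite (K j) \<and> K j \<subseteq> atoms G P"
    and disj: "disjoint_family_on (\<lambda>j. p j <# Omega G P (K j)) {..<n}"
    and eq: "\<one> <# Omega G P J = (\<Union>j<n. p j <# Omega G P (K j))"
    unfolding atom_collection_def by blast
  have KP: "finite (K j)" "K j \<subseteq> P" "p j \<in> P" if "j < n" for j using pK that atoms_subset by auto
  define S where "S = {q. coeff \<one> J q \<noteq> 0} \<union> (\<Union>j<n. {q. coeff (p j) (K j) q \<noteq> 0})"
  have S: "finite S" unfolding S_def using coeff_support(1)[OF J] coeff_support(1)[OF KP(1,2)] by auto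
  have SP: "S \<subseteq> P" unfolding S_def
    using coeff_support(2)[OF J] coeff_support(2)[OF KP(1,2)] KP(3) by fastforce
  define c where "c q = coeff \<one> J q - (\<Sum>j<n. coeff (p j) (K j) q)" for q
  have "(\<Sum>q\<in>S. c q * of_bool (x \<in> ideal q)) = 0" if x: "x \<in> P" for x
  proof -
    have "(\<Sum>q\<in>S. c q * of_bool (x \<in> ideal q)) = (\<Sum>q\<in>S. coeff \<one> J q * of_bool (x \<in> ideal q))
      - (\<Sum>q\<in>S. \<Sum>j<n. coeff (p j) (K j) q * of_bool (x \<in> ideal q))"
      unfolding c_def left_diff_distrib sum_subtractf sum_distrib_right ..
    also have "(\<Sum>q\<in>S. \<Sum>j<n. coeff (p j) (K j) q * of_bool (x \<in> ideal q))
      = (\<Sum>j<n. \<Sum>q\<in>S. coeff (p j) (K j) q * of_bool (x \<in> ideal q))" by (rule sum.swap)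
    also have "\<dots> = (\<Sum>j<n. of_bool (x \<in> p j <# Omega G P (K j)))"
    proof (rule sum.cong[OF refl])
      fix j assume "j \<in> {..<n}"
      then have j: "j < n" by simp
      have "(\<Sum>q\<in>S. coeff (p j) (K j) q * of_bool (x \<in> ideal q)) = expansion (p j) (K j) (\<lambda>q. of_bool (x \<in> ideal q))"
        by (rule expansion_eq_sum[symmetric, OF KP(1,2)[OF j] S]) (use j in \<open>auto simp: S_def\<close>)
      then show "(\<Sum>q\<in>S. coeff (p j) (K j) q * of_bool (x \<in> ideal q)) = of_bool (x \<in> p j <# Omega G P (K j))"
        using expansion_indicator[OF KP(3)[OF j] KP(1,2)[OF j] x] by simp
    qed
    also have "\<dots> = of_bool (x \<in> (\<Union>j<n. p j <# Omega G P (K j)))"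
    proof (cases "\<exists>i<n. x \<in> p i <# Omega G P (K i)")
      case True
      then obtain i where i: "i < n" "x \<in> p i <# Omega G P (K i)" by blast
      have "of_bool (x \<in> p j <# Omega G P (K j)) = (if j = i then 1 else 0 :: real)" if "j \<in> {..<n}" for j
        using disj i that unfolding disjoint_family_on_def by fastforce
      then have "(\<Sum>j<n. of_bool (x \<in> p j <# Omega G P (K j))) = (\<Sum>j<n. if j = i then 1 else 0 :: real)"
        by (rule sum.cong[OF refl])
      then show ?thesis using i by auto
    qed auto
    also have "(\<Sum>q\<in>S. coeff \<one> J q * of_bool (x \<in> ideal q)) = expansion \<one> J (\<lambda>q. of_bool (x \<in> ideal q))"
      by (rule expansion_eq_sum[symmetric, OF J S]) (auto simp: S_def)
    also have "\<dots> = of_bool (x \<in> \<one> <# Omega G P J)"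
      by (rule expansion_indicator[OF _ J x]) simp
    finally show ?thesis unfolding eq by simp
  qed
  then have "c q = 0" if "q \<in> S" for q using indicators_independent[OF S SP _ that, of c] by blast
  moreover have "c q = 0" if "q \<notin> S" for q using that by (simp add: c_def S_def)
  ultimately have "c q = 0" for q by blast
  then have "\<forall>q. coeff \<one> J q = (\<Sum>j<n. coeff (p j) (K j) q)" unfolding c_def by simp
  then show ?thesis using pK by blast
qed

lemma coeff_singleton:
  assumes p: "p \<in> P" "p \<noteq> \<one>"
  shows "coeff \<one> {p} q = of_bool (q = \<one>) - of_bool (q = p)"
proof -
  have "Pow {p} = {{}, {p}}" by auto
  then show ?thesis using p carr join1_singleton[of p] by (auto simp: coeff_def expansion_def)
qed

text \<open>
  Induction principle for properties of the elements of \<open>P\<close>. Partition the complement of \<open>qP\<close> and let \<open>r\<close>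
  have a nonzero coefficient in some piece. If a coefficient of \<open>r\<close> is negative, the step applies to
  that piece, restricted to the atoms that matter at \<open>r\<close>, and reduces the claim to smaller elements. If
  none is negative, they add up to a positive number; but the sum is the coefficient of \<open>r\<close> in
  \<open>1\<^sub>P - 1\<^sub>q\<^sub>P\<close>, so \<open>r\<close> is the unit. Finally \<open>q\<close> itself occurs, since that coefficient is \<open>-1\<close> at \<open>q\<close>.
\<close>

lemma propagation:
  assumes alg: "Sigma_Algebra.algebra P (atom_collection G P)"
    and one: "Fin \<one>"
    and step: "\<And>p K z. p \<in> P \<Longrightarrow> finite K \<Longrightarrow> K \<subseteq> atoms G P \<Longrightarrow> z \<in> P \<Longrightarrow> coeff \<one> K z < 0 \<Longrightarrow>
      (\<And>y. y \<in> P \<Longrightarrow> 0 < coeff \<one> K y \<Longrightarrow> Fin (p \<otimes> y)) \<Longrightarrow> Fin (p \<otimes> z)"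
    and q: "q \<in> P"
  shows "Fin q"
proof (cases "q = \<one>")
  case False
  obtain n :: nat and p K where pK: "\<And>j. j < n \<Longrightarrow> p j \<in> P \<and> finite (K j) \<and> K j \<subseteq> atoms G P"
    and sum: "\<And>r. coeff \<one> {q} r = (\<Sum>j<n. coeff (p j) (K j) r)"
    using Omega_decomposition[OF alg, of "{q}"] q by auto
  have KP: "finite (K j)" "K j \<subseteq> P" "p j \<in> P" if "j < n" for j using pK[OF that] atoms_subset by auto
  define S where "S = (\<Union>j<n. {r. coeff (p j) (K j) r \<noteq> 0})"
  have S: "finite S" unfolding S_def using coeff_support(1)[OF KP(1,2)] by auto
  have SP: "S \<subseteq> P" unfolding S_def using coeff_support(2)[OF KP(1,2)] KP(3) by fastforce
  have "Fin r" if "r \<in> S" for r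
    using that
  proof (induction "card {s\<in>S. r \<in> ideal s}" arbitrary: r rule: less_induct)
    case less
    have rP: "r \<in> P" using less.prems SP by auto
    have smaller: "Fin s" if s: "s \<in> S" "s \<noteq> r" "r \<in> ideal s" for s
    proof (rule less.hyps)
      have "{t\<in>S. s \<in> ideal t} \<subset> {t\<in>S. r \<in> ideal t}"
      proof
        show "{t\<in>S. s \<in> ideal t} \<subseteq> {t\<in>S. r \<in> ideal t}" using s(3) ideal_trans SP by blast
        show "{t\<in>S. s \<in> ideal t} \<noteq> {t\<in>S. r \<in> ideal t}"
          using less.prems s ideal_refl[OF rP] ideal_antisym[of r s] SP by blast
      qed
      then show "card {t\<in>S. s \<in> ideal t} < card {t\<in>S. r \<in> ideal t}" using S by (intro psubset_card_mono) auto
    qed (rule s)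
    show ?case
    proof (cases "\<exists>j<n. coeff (p j) (K j) r < 0")
      case True
      then obtain j where j: "j < n" "coeff (p j) (K j) r < 0" by blast
      note KPj = KP[OF j(1)]
      obtain z where z: "z \<in> P" "r = p j \<otimes> z" using coeff_support(2)[OF KPj(1,2), of "p j" r] j by auto
      have neg: "coeff \<one> (K j) z < 0" using j z coeff_translate[OF KPj(3,1,2) z(1)] by simp
      \<comment> \<open>Without this restriction the step would ask for elements that are not below \<open>r\<close>.\<close>
      let ?K = "{k\<in>K j. z \<in> ideal k}"
      have restrict: "coeff \<one> ?K y = (if z \<in> ideal y then coeff \<one> (K j) y else 0)" if "y \<in> P" for y
        by (rule coeff_restrict[OF KPj(1,2) z(1) that])
      have "Fin (p j \<otimes> z)"
      proof (rule step[of "p j" ?K])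
        show "coeff \<one> ?K z < 0" using neg restrict[OF z(1)] ideal_refl[OF z(1)] by simp
        fix y assume y: "y \<in> P" "0 < coeff \<one> ?K y"
        then have zy: "z \<in> ideal y" and pos: "0 < coeff \<one> (K j) y" using restrict[of y] by (auto split: if_splits)
        have "y \<noteq> z" using pos neg by auto
        show "Fin (p j \<otimes> y)"
        proof (rule smaller)
          show "p j \<otimes> y \<in> S" unfolding S_def
            using j(1) pos coeff_translate[OF KPj(3,1,2) y(1)] by (intro UN_I[of j]) auto
          show "p j \<otimes> y \<noteq> r" using \<open>y \<noteq> z\<close> z y KPj by (simp add: cancel)
          show "r \<in> ideal (p j \<otimes> y)" unfolding z(2) using ideal_mult_cancel KPj y z zy by blast
        qed
      qed (use pK[OF j(1)] z in auto)
      then show ?thesis using z by simp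
    next
      case no_neg: False
      obtain i where i: "i < n" "coeff (p i) (K i) r \<noteq> 0" using less.prems by (auto simp: S_def)
      have "0 \<le> coeff (p j) (K j) r" if "j < n" for j using no_neg that by (meson not_less)
      then have "0 < (\<Sum>j<n. coeff (p j) (K j) r)"
        using i by (intro sum_pos2[of _ i]) (auto simp: less_le)
      then have "0 < coeff \<one> {q} r" using sum by simp
      then have "r = \<one>" using coeff_singleton[OF q False] by (auto split: if_splits)
      then show ?thesis using one by simp
    qed
  qed
  moreover have "q \<in> S"
  proof (rule ccontr)
    assume "q \<notin> S"
    then have "(\<Sum>j<n. coeff (p j) (K j) q) = 0" by (simp add: S_def)
    then show False using sum[of q] coeff_singleton[OF q False] False by simp
  qed
  ultimately show ?thesis by blast
qed (use one in simp)

end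

section \<open>Traces of a product system\<close>

locale traced_product_system = wqlo G P
  for G :: "('g, 'z) monoid_scheme" (structure) and P :: "'g set" +
  fixes S :: "('g, 'x::complex_vector, 'a::cstar_algebra) psystem" and \<tau> :: "'a \<Rightarrow> complex"
  assumes ps: "product_system G P S" and \<tau>: "tracial_state \<tau>"
begin

abbreviation T :: "'g \<Rightarrow> 'a \<Rightarrow> ennreal" where "T \<equiv> fibre_trace S \<tau>"

definition t :: "'g \<Rightarrow> 'a \<Rightarrow> real" where "t p a = enn2real (T p a)"

lemma fibre_corresp: "p \<in> P \<Longrightarrow> corresp (fib S p)"
  using ps unfolding product_system_def corresp_def by blast

lemma unit_fibre: "coefficient_fibre (fib S \<one>) (emb S)"
  using ps unfolding product_system_def by blast

lemma fibres_tensor: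
  assumes p: "p \<in> P" "p \<noteq> \<one>" and q: "q \<in> P"
  shows "tensor_fibres (fib S p) (fib S q) (fib S (p \<otimes> q)) (pmul S p q)"
proof -
  have pq: "p \<otimes> q \<in> P" using p q by simp
  have mem: "pmul S r s \<xi> \<eta> \<in> car (fib S (r \<otimes> s))"
    if "r \<in> P" "s \<in> P" "\<xi> \<in> car (fib S r)" "\<eta> \<in> car (fib S s)" for r s \<xi> \<eta>
    using ps that unfolding product_system_def by blast
  have assoc: "pmul S (r \<otimes> s) u (pmul S r s \<xi> \<eta>) \<zeta> = pmul S r (s \<otimes> u) \<xi> (pmul S s u \<eta> \<zeta>)"
    if "r \<in> P" "s \<in> P" "u \<in> P" "\<xi> \<in> car (fib S r)" "\<eta> \<in> car (fib S s)" "\<zeta> \<in> car (fib S u)" for r s u \<xi> \<eta> \<zeta>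
    using ps that unfolding product_system_def by blast
  have left: "pmul S \<one> r (emb S a) \<xi> = lact (fib S r) a \<xi>" if "r \<in> P" "\<xi> \<in> car (fib S r)" for r \<xi> a
    using ps that unfolding product_system_def by blast
  have emb: "emb S a \<in> car (fib S \<one>)" for a
    using unit_fibre unfolding coefficient_fibre_def bij_betw_def by blast
  have iso: "extends_to_tensor_iso (fib S p) (fib S q) (fib S (p \<otimes> q)) (pmul S p q)"
    using ps p q unfolding product_system_def by blast
  have lact: "lact (fib S (p \<otimes> q)) a (pmul S p q \<xi> \<eta>) = pmul S p q (lact (fib S p) a \<xi>) \<eta>"
    if \<xi>: "\<xi> \<in> car (fib S p)" and \<eta>: "\<eta> \<in> car (fib S q)" for \<xi> \<eta> a
  proof -
    have "pmul S p q (lact (fib S p) a \<xi>) \<eta> = pmul S (\<one> \<otimes> p) q (pmul S \<one> p (emb S a) \<xi>) \<eta>"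
      using left[OF p(1) \<xi>] p carr by simp
    also have "\<dots> = pmul S \<one> (p \<otimes> q) (emb S a) (pmul S p q \<xi> \<eta>)"
      by (rule assoc) (use p q \<xi> \<eta> emb in auto)
    also have "\<dots> = lact (fib S (p \<otimes> q)) a (pmul S p q \<xi> \<eta>)"
      by (rule left[OF pq mem[OF p(1) q \<xi> \<eta>]])
    finally show ?thesis by simp
  qed
  show ?thesis
    by (intro tensor_fibres.intro tensor_fibres_axioms.intro fibre_corresp)
      (use p q pq mem iso lact in auto)
qed

lemma trace_eq_ltrace:
  assumes "p \<in> P" shows "T p (star b * b) = corresp.ltrace (fib S p) \<tau> b"
  unfolding fibre_trace_def
  by (rule corresp.induced_trace_eq_ltrace[OF fibre_corresp[OF assms] tracial_state_positive_functional[OF \<tau>]])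

lemma trace_one: "a \<in> positive_elements \<Longrightarrow> T \<one> a = ennreal (Re (\<tau> a))"
  using trace_eq_ltrace[of "\<one>"] corresp.ltrace_coefficient_fibre[OF fibre_corresp \<tau> unit_fibre]
  unfolding positive_elements_def by auto

abbreviation dominated_in :: "'g \<Rightarrow> 'x list \<Rightarrow> bool" where
  "dominated_in p L \<equiv> \<exists>R R'. hmod.dominated (fib S p) L R R'"

abbreviation sq :: "'g \<Rightarrow> 'a \<Rightarrow> 'x \<Rightarrow> 'a" where
  "sq p b \<xi> \<equiv> inn (fib S p) (lact (fib S p) b \<xi>) (lact (fib S p) b \<xi>)"

lemma sq_positive:
  assumes p: "p \<in> P" and L: "dominated_in p L" and \<xi>: "\<xi> \<in> set L"
  shows "sq p b \<xi> \<in> positive_elements"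
proof -
  interpret Y: corresp "fib S p" by (rule fibre_corresp[OF p])
  show ?thesis using L \<xi> Y.dominatedD(1) by (blast intro: Y.inn_pos Y.lact_mem)
qed

lemma trace_lower:
  assumes p: "p \<in> P" "p \<noteq> \<one>" and q: "q \<in> P" and L: "dominated_in p L"
  shows "(\<Sum>\<xi>\<leftarrow>L. T q (sq p b \<xi>)) \<le> T (p \<otimes> q) (star b * b)"
proof -
  have pq: "p \<otimes> q \<in> P" using p q by simp
  show ?thesis
    unfolding trace_eq_ltrace[OF pq] using tensor_fibres.product_trace_lower[OF fibres_tensor[OF p q] \<tau>] L
    unfolding fibre_trace_def by blast
qed

text \<open>
  One family \<open>L\<close> serves all \<open>z\<close> in the finite set \<open>Z\<close>. This is what makes the trace induced from a linear
  combination the linear combination of the induced traces.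
\<close>

lemma trace_upper:
  assumes p: "p \<in> P" "p \<noteq> \<one>" and Z: "finite Z" "Z \<subseteq> P" and e: "0 < e"
    and r: "\<And>z. z \<in> Z \<Longrightarrow> r z \<le> 0 \<or> ennreal (r z) < T (p \<otimes> z) (star b * b)"
  shows "\<exists>L. dominated_in p L \<and> (\<forall>z\<in>Z. ennreal (r z) \<le> (\<Sum>\<xi>\<leftarrow>L. T z (sq p b \<xi>)) + ennreal e)"
proof -
  interpret Y: corresp "fib S p" by (rule fibre_corresp[OF p(1)])
  \<comment> \<open>The conditions under which \<open>L\<close> serves the element \<open>z\<close>.\<close>
  define good where "good z qs \<delta> \<longleftrightarrow> 0 < \<delta> \<and> (\<forall>(\<sigma>, \<alpha>)\<in>set qs. positive_functional \<sigma> \<and> \<alpha> \<in> car (fib S p)) \<and>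
    (\<forall>L R R'. Y.dominated L R R' \<longrightarrow> (\<forall>(\<sigma>, \<alpha>)\<in>set qs. Re (\<sigma> (inn (fib S p) (R \<alpha>) (R \<alpha>))) < \<delta>) \<longrightarrow>
      ennreal (r z) \<le> (\<Sum>\<xi>\<leftarrow>L. T z (sq p b \<xi>)) + ennreal e)" for z qs and \<delta> :: real
  have ex: "\<exists>qd. good z (fst qd) (snd qd)" if z: "z \<in> Z" for z
  proof (cases "r z \<le> 0")
    case True
    then have "good z [] 1" by (simp add: good_def ennreal_neg)
    then show ?thesis by (intro exI[of _ "([], 1)"]) simp
  next
    case False
    have zP: "z \<in> P" "p \<otimes> z \<in> P" using z Z p by auto
    interpret W: corresp "fib S (p \<otimes> z)" by (rule fibre_corresp[OF zP(2)])
    interpret tf: tensor_fibres "fib S p" "fib S z" "fib S (p \<otimes> z)" "pmul S p z"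
      by (rule fibres_tensor[OF p zP(1)])
    have "ennreal (r z) < W.ltrace \<tau> (star b)"
      using r[OF z] False trace_eq_ltrace[OF zP(2)] W.ltrace_star[OF \<tau>] by simp
    then obtain F R R' where F: "W.dominated F R R'"
      and less: "ennreal (r z) < (\<Sum>\<zeta>\<leftarrow>F. ennreal (Re (\<tau> (sq (p \<otimes> z) (star b) \<zeta>))))"
      unfolding W.ltrace_def less_SUP_iff by blast
    obtain qs \<delta> where d: "0 < \<delta>" and q: "\<forall>(\<sigma>, \<alpha>)\<in>set qs. positive_functional \<sigma> \<and> \<alpha> \<in> car (fib S p)"
      and up: "\<And>L R R'. Y.dominated L R R' \<Longrightarrow> \<forall>(\<sigma>, \<alpha>)\<in>set qs. Re (\<sigma> (inn (fib S p) (R \<alpha>) (R \<alpha>))) < \<delta> \<Longrightarrow>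
      (\<Sum>\<zeta>\<leftarrow>F. ennreal (Re (\<tau> (sq (p \<otimes> z) (star b) \<zeta>)))) \<le> (\<Sum>\<xi>\<leftarrow>L. T z (sq p b \<xi>)) + ennreal e"
      using tf.product_trace_upper[OF \<tau> F e, of b] unfolding fibre_trace_def by blast
    have "good z qs \<delta>" unfolding good_def
      using d q up less by (meson less_imp_le order_trans)
    then show ?thesis by (intro exI[of _ "(qs, \<delta>)"]) simp
  qed
  then obtain g where g: "\<And>z. z \<in> Z \<Longrightarrow> good z (fst (g z)) (snd (g z))" by metis
  obtain zs where zs: "set zs = Z" using Z(1) finite_list by blast
  define qs where "qs = concat (map (\<lambda>z. fst (g z)) zs)"
  define \<delta> where "\<delta> = Min (insert 1 ((\<lambda>z. snd (g z)) ` Z))"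
  have \<delta>: "0 < \<delta>" using Z g by (auto simp: \<delta>_def good_def)
  have \<delta>_le: "\<delta> \<le> snd (g z)" if "z \<in> Z" for z using that Z by (auto simp: \<delta>_def)
  have qs_pos: "positive_functional \<sigma> \<and> \<alpha> \<in> car (fib S p)" if "(\<sigma>, \<alpha>) \<in> set qs" for \<sigma> \<alpha>
    using that g zs by (fastforce simp: qs_def good_def)
  obtain L R R' where L: "Y.dominated L R R'"
    and small: "\<forall>(\<sigma>, \<alpha>)\<in>set qs. Re (\<sigma> (inn (fib S p) (R \<alpha>) (R \<alpha>))) < \<delta>"
    using Y.dominated_approximates[OF \<delta> qs_pos] by blast
  have "ennreal (r z) \<le> (\<Sum>\<xi>\<leftarrow>L. T z (sq p b \<xi>)) + ennreal e" if z: "z \<in> Z" for z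
  proof -
    have "\<forall>(\<sigma>, \<alpha>)\<in>set (fst (g z)). Re (\<sigma> (inn (fib S p) (R \<alpha>) (R \<alpha>))) < snd (g z)"
      using small \<delta>_le[OF z] z zs by (fastforce simp: qs_def)
    then show ?thesis using g[OF z] L unfolding good_def by blast
  qed
  then show ?thesis using L by blast
qed

definition trace_finite :: "'g \<Rightarrow> bool" where
  "trace_finite q \<longleftrightarrow> (\<forall>a\<in>positive_elements. T q a < \<infinity>)"

lemma ennreal_t: "trace_finite q \<Longrightarrow> a \<in> positive_elements \<Longrightarrow> ennreal (t q a) = T q a"
  by (simp add: trace_finite_def t_def)

lemma t_nonneg: "0 \<le> t q a" by (simp add: t_def)

lemma sum_traces:
  assumes p: "p \<in> P" and L: "dominated_in p L" and z: "trace_finite z"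
  shows "(\<Sum>\<xi>\<leftarrow>L. T z (sq p b \<xi>)) = ennreal (\<Sum>\<xi>\<leftarrow>L. t z (sq p b \<xi>))"
proof -
  have "(\<Sum>\<xi>\<leftarrow>L. T z (sq p b \<xi>)) = (\<Sum>\<xi>\<leftarrow>L. ennreal (t z (sq p b \<xi>)))"
    by (rule arg_cong[where f=sum_list], rule map_cong[OF refl])
      (use ennreal_t[OF z] sq_positive[OF p L] in simp)
  then show ?thesis by (simp add: sum_list_ennreal t_nonneg)
qed

lemma sum_combination:
  "(\<Sum>z\<in>Z. c z * (\<Sum>\<xi>\<leftarrow>L. f z \<xi>)) = (\<Sum>\<xi>\<leftarrow>L. \<Sum>z\<in>Z. c z * f z \<xi>)" for c :: "'g \<Rightarrow> real"
  by (induction L) (simp_all add: distrib_left sum.distrib)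

text \<open>
  On a common family \<open>L\<close> the combination of the values is a sum of combinations evaluated at the positive
  elements \<open>\<langle>b\<xi>,b\<xi>\<rangle>\<close>, and each value approximates the trace on the product fibre.
\<close>

lemma combination_nonneg:
  assumes p: "p \<in> P" and Z: "finite Z" "Z \<subseteq> P"
    and fin: "\<And>z. z \<in> Z \<Longrightarrow> trace_finite z" "\<And>z. z \<in> Z \<Longrightarrow> trace_finite (p \<otimes> z)"
    and pos: "\<And>a. a \<in> positive_elements \<Longrightarrow> 0 \<le> (\<Sum>z\<in>Z. c z * t z a)"
    and a: "a \<in> positive_elements"
  shows "0 \<le> (\<Sum>z\<in>Z. c z * t (p \<otimes> z) a)"
proof (cases "p = \<one>")
  case True
  have "(\<Sum>z\<in>Z. c z * t (p \<otimes> z) a) = (\<Sum>z\<in>Z. c z * t z a)"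
    by (rule sum.cong) (use True Z carr in auto)
  then show ?thesis using pos[OF a] by simp
next
  case False
  obtain b where b: "a = star b * b" using a unfolding positive_elements_def by blast
  show ?thesis
  proof (rule field_le_epsilon)
    fix e :: real assume e: "0 < e"
    define C where "C = (\<Sum>z\<in>Z. \<bar>c z\<bar>)"
    have C: "0 \<le> C" by (simp add: C_def sum_nonneg)
    define e1 where "e1 = e / (2 * (C + 1))"
    have e1: "0 < e1" "C * (2 * e1) \<le> e" using e C by (auto simp: e1_def field_simps)
    have "t (p \<otimes> z) a - e1 \<le> 0 \<or> ennreal (t (p \<otimes> z) a - e1) < T (p \<otimes> z) (star b * b)" if "z \<in> Z" for z
    proof -
      have "T (p \<otimes> z) (star b * b) = ennreal (t (p \<otimes> z) a)"
        using ennreal_t[OF fin(2)[OF that] a] b by simp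
      moreover have "ennreal (t (p \<otimes> z) a - e1) < ennreal (t (p \<otimes> z) a)" if "0 < t (p \<otimes> z) a - e1"
        by (rule ennreal_lessI) (use e1(1) that in auto)
      ultimately show ?thesis by (metis not_less)
    qed
    from trace_upper[OF p False Z e1(1) this]
    obtain L where L: "dominated_in p L"
      and up: "\<And>z. z \<in> Z \<Longrightarrow> ennreal (t (p \<otimes> z) a - e1) \<le> (\<Sum>\<xi>\<leftarrow>L. T z (sq p b \<xi>)) + ennreal e1" by blast
    define A where "A z = (\<Sum>\<xi>\<leftarrow>L. t z (sq p b \<xi>))" for z
    have A: "0 \<le> A z" for z by (auto simp: A_def t_nonneg intro!: sum_list_nonneg)
    have close: "\<bar>t (p \<otimes> z) a - A z\<bar> \<le> 2 * e1" if z: "z \<in> Z" for z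
    proof -
      have "ennreal (A z) \<le> ennreal (t (p \<otimes> z) a)"
        using trace_lower[OF p False _ L, of z b] z Z sum_traces[OF p L fin(1)[OF z], of b] ennreal_t[OF fin(2)[OF z] a] b
        by (auto simp: A_def)
      then have "A z \<le> t (p \<otimes> z) a" using t_nonneg by simp
      moreover have "ennreal (t (p \<otimes> z) a - e1) \<le> ennreal (A z + e1)"
        using up[OF z] sum_traces[OF p L fin(1)[OF z], of b] A[of z] e1 by (simp add: A_def ennreal_plus)
      then have "t (p \<otimes> z) a - e1 \<le> A z + e1"
        using A[of z] e1(1) ennreal_le_iff[of "A z + e1" "t (p \<otimes> z) a - e1"] by linarith
      ultimately show ?thesis by simp
    qed
    have "0 \<le> (\<Sum>\<xi>\<leftarrow>L. \<Sum>z\<in>Z. c z * t z (sq p b \<xi>))"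
      by (rule sum_list_nonneg) (use pos sq_positive[OF p L] in auto)
    also have "\<dots> = (\<Sum>z\<in>Z. c z * A z)" by (simp only: A_def sum_combination)
    finally have nonneg: "0 \<le> (\<Sum>z\<in>Z. c z * A z)" .
    have "(\<Sum>z\<in>Z. c z * A z) - (\<Sum>z\<in>Z. c z * t (p \<otimes> z) a) = (\<Sum>z\<in>Z. c z * (A z - t (p \<otimes> z) a))"
      by (simp add: sum_subtractf right_diff_distrib)
    also have "\<dots> \<le> (\<Sum>z\<in>Z. \<bar>c z\<bar> * (2 * e1))"
    proof (rule sum_mono)
      fix z assume z: "z \<in> Z"
      have "c z * (A z - t (p \<otimes> z) a) \<le> \<bar>c z\<bar> * \<bar>t (p \<otimes> z) a - A z\<bar>"
        by (metis abs_ge_self abs_minus_commute abs_mult)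
      also have "\<dots> \<le> \<bar>c z\<bar> * (2 * e1)" using close[OF z] by (intro mult_left_mono) auto
      finally show "c z * (A z - t (p \<otimes> z) a) \<le> \<bar>c z\<bar> * (2 * e1)" .
    qed
    also have "\<dots> = C * (2 * e1)" by (simp only: C_def sum_distrib_right)
    finally show "0 \<le> (\<Sum>z\<in>Z. c z * t (p \<otimes> z) a) + e" using nonneg e1(2) by linarith
  qed
qed

text \<open>
  The terms with positive coefficient bound those with negative coefficient on every family \<open>L\<close>,
  hence in the supremum.
\<close>

lemma combination_finite:
  assumes p: "p \<in> P" and Z: "finite Z" "Z \<subseteq> P"
    and fin: "\<And>z. z \<in> Z \<Longrightarrow> trace_finite z" "\<And>z. z \<in> Z \<Longrightarrow> 0 < c z \<Longrightarrow> trace_finite (p \<otimes> z)"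
    and pos: "\<And>a. a \<in> positive_elements \<Longrightarrow> 0 \<le> (\<Sum>z\<in>Z. c z * t z a)"
    and z0: "z0 \<in> Z" "c z0 < 0"
  shows "trace_finite (p \<otimes> z0)"
proof (cases "p = \<one>")
  case True
  then show ?thesis using fin(1)[OF z0(1)] z0 Z carr by auto
next
  case False
  show ?thesis unfolding trace_finite_def
  proof
    fix a :: 'a assume a: "a \<in> positive_elements"
    then obtain b where b: "a = star b * b" unfolding positive_elements_def by blast
    define Q where "Q = {z\<in>Z. 0 < c z}"
    have Q: "finite Q" "Q \<subseteq> Z" using Z by (auto simp: Q_def)
    define D where "D = (\<Sum>z\<in>Q. c z * t (p \<otimes> z) a)"
    \<comment> \<open>The summand 1 leaves room for the error 1/2 in the approximation.\<close>
    define r where "r = D / (- c z0) + 1"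
    have "T (p \<otimes> z0) a \<le> ennreal r"
    proof (rule ccontr)
      assume "\<not> T (p \<otimes> z0) a \<le> ennreal r"
      then have "\<exists>L. dominated_in p L \<and> (\<forall>z\<in>{z0}. ennreal r \<le> (\<Sum>\<xi>\<leftarrow>L. T z (sq p b \<xi>)) + ennreal (1/2))"
        using z0 Z b by (intro trace_upper[OF p False]) auto
      then obtain L where L: "dominated_in p L"
        and up: "ennreal r \<le> (\<Sum>\<xi>\<leftarrow>L. T z0 (sq p b \<xi>)) + ennreal (1/2)" by auto
      define A where "A z = (\<Sum>\<xi>\<leftarrow>L. t z (sq p b \<xi>))" for z
      have A: "0 \<le> A z" for z by (auto simp: A_def t_nonneg intro!: sum_list_nonneg)
      have "ennreal r \<le> ennreal (A z0 + 1/2)"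
        using up sum_traces[OF p L fin(1)[OF z0(1)], of b] A[of z0] by (simp add: A_def ennreal_plus)
      then have r_le: "r \<le> A z0 + 1/2" using A[of z0] ennreal_le_iff[of "A z0 + 1/2" r] by linarith
      have "0 \<le> (\<Sum>\<xi>\<leftarrow>L. \<Sum>z\<in>Z. c z * t z (sq p b \<xi>))"
        by (rule sum_list_nonneg) (use pos sq_positive[OF p L] in auto)
      also have "\<dots> = (\<Sum>z\<in>Z. c z * A z)" by (simp only: A_def sum_combination)
      also have "\<dots> = (\<Sum>z\<in>Q. c z * A z) + (\<Sum>z\<in>Z - Q. c z * A z)"
        using sum.subset_diff[OF Q(2) Z(1), of "\<lambda>z. c z * A z"] by simp
      also have "(\<Sum>z\<in>Q. c z * A z) \<le> D"
        unfolding D_def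
      proof (rule sum_mono)
        fix z assume z: "z \<in> Q"
        then have zz: "z \<in> Z" "0 < c z" by (auto simp: Q_def)
        have "ennreal (A z) \<le> ennreal (t (p \<otimes> z) a)"
          using trace_lower[OF p False _ L, of z b] zz Z sum_traces[OF p L fin(1)[OF zz(1)], of b] ennreal_t[OF fin(2)[OF zz] a] b
          by (auto simp: A_def)
        then have "A z \<le> t (p \<otimes> z) a" using t_nonneg by simp
        then show "c z * A z \<le> c z * t (p \<otimes> z) a" using zz by simp
      qed
      also have "(\<Sum>z\<in>Z - Q. c z * A z) \<le> (\<Sum>z\<in>{z0}. c z * A z)"
      proof -
        have "(\<Sum>z\<in>{z0}. - (c z * A z)) \<le> (\<Sum>z\<in>Z - Q. - (c z * A z))"
          using z0 Z A by (intro sum_mono2) (auto simp: Q_def mult_le_0_iff not_less)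
        then show ?thesis by (simp add: sum_negf)
      qed
      finally have "0 \<le> D + c z0 * A z0" by simp
      then have "A z0 \<le> D / (- c z0)" using z0 by (simp add: field_simps)
      then show False using r_le by (simp add: r_def)
    qed
    then show "T (p \<otimes> z0) a < \<infinity>" using le_less_trans by fastforce
  qed
qed

lemma positivity_iff_expansion:
  assumes J: "finite J" "J \<subseteq> P - {\<one>}" and a: "a \<in> positive_elements" and N: "N \<one> = 1"
  shows "positivity_inequality G P S N \<beta> \<tau> J a \<longleftrightarrow>
    (\<forall>L r. L \<subseteq> J \<and> join1 L = Some r \<longrightarrow> T r a < \<infinity>) \<and> 0 \<le> expansion \<one> J (\<lambda>q. N q powr (- \<beta>) * t q a)"
proof -
  have JP: "J \<subseteq> P" using J by auto
  have \<tau>_nonneg: "0 \<le> Re (\<tau> a)"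
    using a positive_functionalD(7)[OF tracial_state_positive_functional[OF \<tau>]] by blast
  have "(\<forall>K r. K \<noteq> {} \<and> K \<subseteq> J \<and> join G P K = Some r \<longrightarrow> T r a < \<infinity>)
    \<longleftrightarrow> (\<forall>L r. L \<subseteq> J \<and> join1 L = Some r \<longrightarrow> T r a < \<infinity>)"
    using trace_one[OF a] by (auto simp: join1_def)
  moreover have "expansion \<one> J (\<lambda>q. N q powr (- \<beta>) * t q a) = Re (\<tau> a) +
    (\<Sum>K\<in>{K. K \<noteq> {} \<and> K \<subseteq> J}. case join G P K of None \<Rightarrow> 0
      | Some r \<Rightarrow> (- 1) ^ card K * N r powr (- \<beta>) * enn2real (T r a))"
  proof -
    have "Pow J = insert {} {K. K \<noteq> {} \<and> K \<subseteq> J}" by auto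
    then have "expansion \<one> J (\<lambda>q. N q powr (- \<beta>) * t q a) = N \<one> powr (- \<beta>) * t \<one> a +
      (\<Sum>K\<in>{K. K \<noteq> {} \<and> K \<subseteq> J}. case join1 K of None \<Rightarrow> 0
        | Some z \<Rightarrow> (- 1) ^ card K * (N (\<one> \<otimes> z) powr (- \<beta>) * t (\<one> \<otimes> z) a))"
      unfolding expansion_def using J(1) by simp
    also have "N \<one> powr (- \<beta>) * t \<one> a = Re (\<tau> a)"
      using trace_one[OF a] \<tau>_nonneg by (simp add: N t_def)
    also have "(\<Sum>K\<in>{K. K \<noteq> {} \<and> K \<subseteq> J}. case join1 K of None \<Rightarrow> 0
        | Some z \<Rightarrow> (- 1) ^ card K * (N (\<one> \<otimes> z) powr (- \<beta>) * t (\<one> \<otimes> z) a))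
      = (\<Sum>K\<in>{K. K \<noteq> {} \<and> K \<subseteq> J}. case join G P K of None \<Rightarrow> 0
      | Some r \<Rightarrow> (- 1) ^ card K * N r powr (- \<beta>) * enn2real (T r a))"
    proof (rule sum.cong[OF refl])
      fix K assume K: "K \<in> {K. K \<noteq> {} \<and> K \<subseteq> J}"
      then have Kf: "finite K" "K \<subseteq> P" using J(1) JP finite_subset by auto
      have eq: "join1 K = join G P K" using K by (simp add: join1_def)
      show "(case join1 K of None \<Rightarrow> 0
        | Some z \<Rightarrow> (- 1) ^ card K * (N (\<one> \<otimes> z) powr (- \<beta>) * t (\<one> \<otimes> z) a))
        = (case join G P K of None \<Rightarrow> 0 | Some r \<Rightarrow> (- 1) ^ card K * N r powr (- \<beta>) * enn2real (T r a))"
        using join1_Some(1)[OF Kf] carr unfolding eq by (auto split: option.split simp: t_def)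
    qed
    finally show ?thesis .
  qed
  ultimately show ?thesis unfolding positivity_inequality_def by simp
qed

lemma positivity_from_atoms:
  assumes alg: "Sigma_Algebra.algebra P (atom_collection G P)"
    and N_pos: "\<And>p. p \<in> P \<Longrightarrow> 0 < N p" and N_mult: "\<And>p q. p \<in> P \<Longrightarrow> q \<in> P \<Longrightarrow> N (p \<otimes> q) = N p * N q"
    and atomic: "\<And>a J. a \<in> positive_elements \<Longrightarrow> finite J \<Longrightarrow> J \<subseteq> atoms G P \<Longrightarrow> positivity_inequality G P S N \<beta> \<tau> J a"
    and a: "a \<in> positive_elements" and J: "finite J" "J \<subseteq> P - {\<one>}"
  shows "positivity_inequality G P S N \<beta> \<tau> J a"
proof -
  have N1: "N \<one> = 1" using N_mult[of "\<one>" "\<one>"] N_pos[of "\<one>"] by simp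
  define \<mu> where "\<mu> a q = N q powr (- \<beta>) * t q a" for a q
  have atomP: "K \<subseteq> P" "K \<subseteq> P - {\<one>}" if "K \<subseteq> atoms G P" for K using that atoms_subset by auto
  have join_finite: "trace_finite q" if K: "finite K" "K \<subseteq> atoms G P" and q: "coeff \<one> K q \<noteq> 0" for K q
  proof -
    obtain L z where L: "L \<subseteq> K" "z \<in> P" "join1 L = Some z" "q = \<one> \<otimes> z"
      using coeff_support(2)[OF K(1) atomP(1)[OF K(2)] q] by blast
    have "q = z" using L carr by simp
    show ?thesis unfolding trace_finite_def
    proof
      fix c :: 'a assume c: "c \<in> positive_elements"
      note iff = positivity_iff_expansion[where N=N, OF K(1) atomP(2)[OF K(2)] c N1]
      show "T q c < \<infinity>"
        using conjunct1[OF iffD1[OF iff atomic[OF c K]]] L(1,3) \<open>q = z\<close> by simp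
    qed
  qed
  have atoms_nonneg: "0 \<le> expansion \<one> K (\<mu> c)" if "finite K" "K \<subseteq> atoms G P" "c \<in> positive_elements" for K c
    using conjunct2[OF iffD1[OF positivity_iff_expansion[where N=N, OF that(1) atomP(2)[OF that(2)] that(3) N1] atomic[OF that(3,1,2)]]]
    unfolding \<mu>_def .
  have support: "{q. coeff \<one> K q \<noteq> 0} \<subseteq> P" if "finite K" "K \<subseteq> P" for K
    using coeff_support(2)[OF that] by fastforce
  have all_finite: "trace_finite q" if "q \<in> P" for q
    using alg _ _ that
  proof (rule propagation)
    show "trace_finite \<one>" by (simp add: trace_finite_def trace_one)
    fix p K z assume p: "p \<in> P" and K: "finite K" "K \<subseteq> atoms G P" and z: "z \<in> P" "coeff \<one> K z < 0"
      and up: "\<And>y. y \<in> P \<Longrightarrow> 0 < coeff \<one> K y \<Longrightarrow> trace_finite (p \<otimes> y)"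
    let ?Z = "{q. coeff \<one> K q \<noteq> 0}"
    note KP = K(1) atomP(1)[OF K(2)]
    show "trace_finite (p \<otimes> z)"
    proof (rule combination_finite[where Z="?Z" and c="\<lambda>q. coeff \<one> K q * N q powr (- \<beta>)"])
      show "?Z \<subseteq> P" by (rule support[OF KP])
      show "trace_finite q" if "q \<in> ?Z" for q using join_finite[OF K] that by simp
      show "trace_finite (p \<otimes> q)" if "q \<in> ?Z" "0 < coeff \<one> K q * N q powr (- \<beta>)" for q
      proof (rule up)
        show "q \<in> P" using support[OF KP] that(1) by blast
        show "0 < coeff \<one> K q" using that(2) by (auto simp: zero_less_mult_iff)
      qed
      show "0 \<le> (\<Sum>q\<in>?Z. coeff \<one> K q * N q powr (- \<beta>) * t q c)" if "c \<in> positive_elements" for c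
        using atoms_nonneg[OF K that] expansion_eq_sum[OF KP coeff_support(1)[OF KP] order_refl]
        by (simp add: \<mu>_def mult.assoc)
      show "coeff \<one> K z * N z powr (- \<beta>) < 0" using z N_pos[OF z(1)] by (simp add: mult_neg_pos)
    qed (use p z coeff_support(1)[OF KP] in auto)
  qed
  have translated: "0 \<le> expansion p K (\<mu> a)" if p: "p \<in> P" and K: "finite K" "K \<subseteq> atoms G P" for p K
  proof -
    let ?Z = "{q. coeff \<one> K q \<noteq> 0}"
    note KP = K(1) atomP(1)[OF K(2)]
    note ZP = support[OF KP]
    have "expansion p K (\<mu> a) = (\<Sum>z\<in>?Z. coeff \<one> K z * \<mu> a (p \<otimes> z))"
      using expansion_translate[OF p KP] expansion_eq_sum[OF KP coeff_support(1)[OF KP] order_refl] by simp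
    also have "\<dots> = N p powr (- \<beta>) * (\<Sum>z\<in>?Z. coeff \<one> K z * N z powr (- \<beta>) * t (p \<otimes> z) a)"
      unfolding sum_distrib_left
    proof (rule sum.cong[OF refl])
      fix z assume "z \<in> ?Z"
      then have z: "z \<in> P" using ZP by blast
      show "coeff \<one> K z * \<mu> a (p \<otimes> z) = N p powr (- \<beta>) * (coeff \<one> K z * N z powr (- \<beta>) * t (p \<otimes> z) a)"
        using N_pos[OF p] N_pos[OF z] by (simp add: \<mu>_def N_mult[OF p z] powr_mult)
    qed
    also have "0 \<le> \<dots>"
    proof (intro mult_nonneg_nonneg combination_nonneg[OF p coeff_support(1)[OF KP] ZP _ _ _ a])
      show "0 \<le> (\<Sum>q\<in>?Z. coeff \<one> K q * N q powr (- \<beta>) * t q c)" if "c \<in> positive_elements" for c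
        using atoms_nonneg[OF K that] expansion_eq_sum[OF KP coeff_support(1)[OF KP] order_refl]
        by (simp add: \<mu>_def mult.assoc)
    qed (use all_finite ZP p in auto)
    finally show ?thesis .
  qed
  have JP: "J \<subseteq> P" using J by auto
  obtain n :: nat and p K where pK: "\<And>j. j < n \<Longrightarrow> p j \<in> P \<and> finite (K j) \<and> K j \<subseteq> atoms G P"
    and sum: "\<And>q. coeff \<one> J q = (\<Sum>j<n. coeff (p j) (K j) q)"
    using Omega_decomposition[OF alg J(1) JP] by blast
  define B where "B = {q. coeff \<one> J q \<noteq> 0} \<union> (\<Union>j<n. {q. coeff (p j) (K j) q \<noteq> 0})"
  have B: "finite B" unfolding B_def
    using coeff_support(1)[OF J(1) JP] coeff_support(1) pK atomP(1) by auto
  have "expansion \<one> J (\<mu> a) = (\<Sum>q\<in>B. coeff \<one> J q * \<mu> a q)"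
    by (rule expansion_eq_sum[OF J(1) JP B]) (auto simp: B_def)
  also have "\<dots> = (\<Sum>q\<in>B. \<Sum>j<n. coeff (p j) (K j) q * \<mu> a q)" by (simp only: sum sum_distrib_right)
  also have "\<dots> = (\<Sum>j<n. \<Sum>q\<in>B. coeff (p j) (K j) q * \<mu> a q)" by (rule sum.swap)
  also have "\<dots> = (\<Sum>j<n. expansion (p j) (K j) (\<mu> a))"
  proof (rule sum.cong[OF refl])
    fix j assume "j \<in> {..<n}"
    then have j: "j < n" by simp
    show "(\<Sum>q\<in>B. coeff (p j) (K j) q * \<mu> a q) = expansion (p j) (K j) (\<mu> a)"
      by (rule expansion_eq_sum[symmetric, OF _ _ B]) (use j pK[OF j] atomP in \<open>auto simp: B_def\<close>)
  qed
  also have "0 \<le> \<dots>" by (rule sum_nonneg) (use translated pK in auto)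
  finally have "0 \<le> expansion \<one> J (\<mu> a)" .
  moreover have "T r a < \<infinity>" if "L \<subseteq> J" "join1 L = Some r" for L r
  proof -
    have "r \<in> P" using join1_Some(1)[of L r] that J(1) JP finite_subset[of L J] by auto
    then show ?thesis using all_finite a by (auto simp: trace_finite_def)
  qed
  ultimately show ?thesis unfolding positivity_iff_expansion[where N=N, OF J a N1] \<mu>_def by blast
qed

end

theorem theorem7p1:
  fixes G :: "('g, 'z) monoid_scheme" and P :: "'g set"
  assumes "weak_quasi_lattice_ordered G P"
    and "Sigma_Algebra.algebra P (atom_collection G P)"
  shows "atom_collection G P = ideal_algebra G P \<and>
    (\<forall>(S :: ('g, 'x::complex_vector, 'a::cstar_algebra) psystem) (N :: 'g \<Rightarrow> real) (\<beta> :: real)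
        (\<tau> :: 'a \<Rightarrow> complex).
      product_system G P S \<and> (\<forall>p\<in>P. essential (fib S p)) \<and> compactly_aligned G P S \<and>
      (\<forall>p\<in>P. N p > 0) \<and> (\<forall>p\<in>P. \<forall>q\<in>P. N (p \<otimes>\<^bsub>G\<^esub> q) = N p * N q) \<and>
      tracial_state \<tau> \<longrightarrow>
      ((\<forall>a\<in>positive_elements. \<forall>J. finite J \<and> J \<subseteq> P - {\<one>\<^bsub>G\<^esub>} \<longrightarrow>
          positivity_inequality G P S N \<beta> \<tau> J a) \<longleftrightarrow>
       (\<forall>a\<in>positive_elements. \<forall>J. finite J \<and> J \<subseteq> atoms G P \<longrightarrow>
          positivity_inequality G P S N \<beta> \<tau> J a)))"
proof (intro conjI allI impI)
  interpret wqlo G P by unfold_locales (rule assms(1))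
  show "atom_collection G P = ideal_algebra G P"
    by (rule atom_collection_eq_ideal_algebra[OF assms(2)])
  fix S :: "('g, 'x, 'a) psystem" and N :: "'g \<Rightarrow> real" and \<beta> :: real and \<tau> :: "'a \<Rightarrow> complex"
  assume h: "product_system G P S \<and> (\<forall>p\<in>P. essential (fib S p)) \<and> compactly_aligned G P S \<and>
      (\<forall>p\<in>P. N p > 0) \<and> (\<forall>p\<in>P. \<forall>q\<in>P. N (p \<otimes>\<^bsub>G\<^esub> q) = N p * N q) \<and> tracial_state \<tau>"
  then interpret traced_product_system G P S \<tau> by unfold_locales auto
  show "(\<forall>a\<in>positive_elements. \<forall>J. finite J \<and> J \<subseteq> P - {\<one>\<^bsub>G\<^esub>} \<longrightarrow>
          positivity_inequality G P S N \<beta> \<tau> J a) \<longleftrightarrow>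
       (\<forall>a\<in>positive_elements. \<forall>J. finite J \<and> J \<subseteq> atoms G P \<longrightarrow>
          positivity_inequality G P S N \<beta> \<tau> J a)"
  proof
    assume "\<forall>a\<in>positive_elements. \<forall>J. finite J \<and> J \<subseteq> P - {\<one>\<^bsub>G\<^esub>} \<longrightarrow> positivity_inequality G P S N \<beta> \<tau> J a"
    then show "\<forall>a\<in>positive_elements. \<forall>J. finite J \<and> J \<subseteq> atoms G P \<longrightarrow> positivity_inequality G P S N \<beta> \<tau> J a"
      using atoms_subset by (meson order_trans)
  next
    assume atomic: "\<forall>a\<in>positive_elements. \<forall>J. finite J \<and> J \<subseteq> atoms G P \<longrightarrow> positivity_inequality G P S N \<beta> \<tau> J a"
    show "\<forall>a\<in>positive_elements. \<forall>J. finite J \<and> J \<subseteq> P - {\<one>\<^bsub>G\<^esub>} \<longrightarrow> positivity_inequality G P S N \<beta> \<tau> J a"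
      using positivity_from_atoms[OF assms(2), of N \<beta>] h atomic by blast
  qed
qed

end
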